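(* Let $[\cdot,\cdot]_{L^*}:\Gamma(L^* )\times\Gamma(L^* )\to\Gamma(L^* )$ be a Kirillov structure on the real line bundle $\pi_L:L\to K$. Suppose that $(\Phi^L,\Phi^K)$ is a compatible representation of a Lie group $G$ on $L$, and that the orbit space $K/G$ of $\Phi^K$ is a smooth quotient manifold. Then: (1) There is a one-to-one correspondence between $G$-equivariant sections $h:K\to L^*$ of $\pi_{L^*}:L^*\to K$ with respect to $(\Phi^{L^*},\Phi^K)$ and sections $h^G:K/G\to L^*/G$ of the line bundle $\pi_{L^*/G}:L^*/G\to K/G$. (2) On the space of sections of $\pi_{L^*/G}:L^*/G\to K/G$ there is a Kirillov structure $[\cdot,\cdot]_{L^*/G}$, characterized by $$[h_1^G,h_2^G]_{L^*/G}=([h_1,h_2]_{L^*})^G$$ for all $G$-equivariant sections $h_1,h_2$ of $\pi_{L^*}$. (3) If $h:K\to L^*$ is a $G$-equivariant section of $\pi_{L^*}$, then the symbol $X_h^{[\cdot,\cdot]_{L^*}}\in\mathfrak{X}(K)$ associated with the derivation $[\cdot,h]_{L^*}$ is $G$-invariant with respect to $\Phi^K$. Moreover, if $\wp_K:K\to K/G$ is the quotient map, the $\wp_K$-projection of $X_h^{[\cdot,\cdot]_{L^*}}$ is the symbol $X_{h^G}^{[\cdot,\cdot]_{L^*/G}}\in\mathfrak{X}(K/G)$ of the derivation $[\cdot,h^G]_{L^*/G}$.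
   Context: Everything is smooth. A Kirillov structure on a real line bundle $\pi_L:L\to K$ is a Lie bracket $[\cdot,\cdot]_{L^*}$ on the space $\Gamma(L^* )$ of sections of the dual bundle $\pi_{L^*}:L^*\to K$ such that for every $h_2\in\Gamma(L^* )$ there is a vector field $X^{[\cdot,\cdot]_{L^*}}_{h_2}\in\mathfrak{X}(K)$, called the symbol of $[\cdot,h_2]_{L^*}$, with $[fh_1,h_2]_{L^*}=f[h_1,h_2]_{L^*}+X^{[\cdot,\cdot]_{L^*}}_{h_2}(f)\,h_1$ for all $h_1\in\Gamma(L^* )$, $f\in C^\infty(K)$. A representation of $G$ on $\pi_L:L\to K$ is a pair of actions $(\Phi^L:G\times L\to L,\ \Phi^K:G\times K\to K)$ such that $(\Phi^L_g,\Phi^K_g)$ is a vector bundle isomorphism for every $g\in G$. The dual representation is $(\Phi^{L^*},\Phi^K)$ on $L^*$, with $\langle\Phi^{L^*}_g(\alpha),x\rangle=\langle\alpha,\Phi^L_{g^{-1}}(x)\rangle$. A section $h:K\to L^*$ is $G$-equivariant if $\Phi^{L^*}_g\circ h=h\circ\Phi^K_g$ for all $g\in G$. The representation is compatible with the Kirillov structure if the bracket $[\cdot,\cdot]_{L^*}$ is closed for $G$-equivariant sections, i.e. $[h_1,h_2]_{L^*}$ is $G$-equivariant whenever $h_1,h_2\in\Gamma(L^* )$ are $G$-equivariant. Quotients: $L/G\to K/G$ is a real line bundle with fibers isomorphic to those of $L$, and its dual is identified with the line bundle $\pi_{L^*/G}:L^*/G\to K/G$ induced by $\pi_{L^*}$;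 $\wp_{L^*}:L^*\to L^*/G$ is the quotient map. The correspondence in (1) is given by $h^G(\wp_K(x))=\wp_{L^*}(h(x))$ for $x\in K$. A Kirillov structure on the space of sections of $L^*/G\cong(L/G)^*$ means a Kirillov structure on the line bundle $L/G$.
   Formalization: In (3), literal G-invariance of the symbol fails for merely compatible representations; it is proved when the bracket is G-equivariant on all sections, and in general only that the symbol maps G-invariant functions to G-invariant functions. *)

theory Defs
  imports "HOL-Analysis.Analysis" "HOL-Algebra.Group_Action"
begin

section \<open>Smooth manifolds\<close>

text \<open>
  Model spaces are the finite-dimensional real inner product spaces. In contrast to
  \<^class>\<open>euclidean_space\<close> this includes dimension zero, which is needed for discrete
  groups and for orbit spaces of transitive actions.
\<close>

class finite_dim_inner = real_inner +
  assumes finite_dim: "\<exists>B. finite B \<and> (\<forall>x. \<exists>c. x = (\<Sum>b\<in>B. c b *\<^sub>R b))"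

instance euclidean_space \<subseteq> finite_dim_inner
  by standard (metis euclidean_representation finite_Basis)

fun Ck_on :: "nat \<Rightarrow> 'a::real_normed_vector set \<Rightarrow> ('a \<Rightarrow> 'b::real_normed_vector) \<Rightarrow> bool" where
  "Ck_on 0 S f \<longleftrightarrow> continuous_on S f"
| "Ck_on (Suc k) S f \<longleftrightarrow>
     (\<forall>x\<in>S. f differentiable (at x)) \<and> (\<forall>v. Ck_on k S (\<lambda>x. frechet_derivative f (at x) v))"

text \<open>Only used for open \<open>S\<close>.\<close>

definition smooth_on :: "'a::real_normed_vector set \<Rightarrow> ('a \<Rightarrow> 'b::real_normed_vector) \<Rightarrow> bool" where
  "smooth_on S f \<longleftrightarrow> (\<forall>k. Ck_on k S f)"

text \<open>
  A manifold is given by an atlas (not necessarily maximal); the underlying set and the topology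
  are recovered from it.
\<close>

type_synonym ('a, 'e) chart = "'a set \<times> ('a \<Rightarrow> 'e)"

definition points :: "('a, 'e) chart set \<Rightarrow> 'a set" where
  "points A = (\<Union>(U, \<phi>)\<in>A. U)"

definition smooth_atlas :: "('a, 'e::real_normed_vector) chart set \<Rightarrow> bool" where
  "smooth_atlas A \<longleftrightarrow>
     (\<forall>(U, \<phi>)\<in>A. inj_on \<phi> U \<and> open (\<phi> ` U)) \<and>
     (\<forall>(U, \<phi>)\<in>A. \<forall>(V, \<psi>)\<in>A.
        open (\<phi> ` (U \<inter> V)) \<and> smooth_on (\<phi> ` (U \<inter> V)) (\<psi> \<circ> inv_into U \<phi>))"

definition atlas_topology :: "('a, 'e::real_normed_vector) chart set \<Rightarrow> 'a topology" where
  "atlas_topology A = topology (\<lambda>W. W \<subseteq> points A \<and> (\<forall>(U, \<phi>)\<in>A. open (\<phi> ` (W \<inter> U))))"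

lemma openin_atlas_topology:
  assumes "smooth_atlas A"
  shows "openin (atlas_topology A) W \<longleftrightarrow> W \<subseteq> points A \<and> (\<forall>(U, \<phi>)\<in>A. open (\<phi> ` (W \<inter> U)))"
proof -
  have "istopology (\<lambda>W. W \<subseteq> points A \<and> (\<forall>(U, \<phi>)\<in>A. open (\<phi> ` (W \<inter> U))))"
    unfolding istopology_def
  proof (intro conjI allI impI)
    fix S T
    assume S: "S \<subseteq> points A \<and> (\<forall>(U, \<phi>)\<in>A. open (\<phi> ` (S \<inter> U)))"
      and T: "T \<subseteq> points A \<and> (\<forall>(U, \<phi>)\<in>A. open (\<phi> ` (T \<inter> U)))"
    show "S \<inter> T \<subseteq> points A" using S by blast
    have "open (\<phi> ` (S \<inter> T \<inter> U))" if "(U, \<phi>) \<in> A" for U \<phi>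
    proof -
      have "inj_on \<phi> U" using that assms by (auto simp: smooth_atlas_def)
      then have "\<phi> ` ((S \<inter> U) \<inter> (T \<inter> U)) = \<phi> ` (S \<inter> U) \<inter> \<phi> ` (T \<inter> U)"
        by (intro inj_on_image_Int) auto
      moreover have "S \<inter> T \<inter> U = (S \<inter> U) \<inter> (T \<inter> U)" by blast
      ultimately show ?thesis using S T that by (auto intro!: open_Int)
    qed
    then show "\<forall>(U, \<phi>)\<in>A. open (\<phi> ` (S \<inter> T \<inter> U))" by blast
  next
    fix \<K>
    assume K: "\<forall>S\<in>\<K>. S \<subseteq> points A \<and> (\<forall>(U, \<phi>)\<in>A. open (\<phi> ` (S \<inter> U)))"
    then show "\<Union>\<K> \<subseteq> points A" by blast
    have "open (\<phi> ` (\<Union>\<K> \<inter> U))" if "(U, \<phi>) \<in> A" for U \<phi>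
    proof -
      have "\<phi> ` (\<Union>\<K> \<inter> U) = (\<Union>S\<in>\<K>. \<phi> ` (S \<inter> U))" by blast
      moreover have "\<forall>S\<in>\<K>. open (\<phi> ` (S \<inter> U))" using K that by blast
      ultimately show ?thesis by (simp add: open_UN)
    qed
    then show "\<forall>(U, \<phi>)\<in>A. open (\<phi> ` (\<Union>\<K> \<inter> U))" by blast
  qed
  then show ?thesis unfolding atlas_topology_def by simp
qed

definition smooth_manifold :: "('a, 'e::finite_dim_inner) chart set \<Rightarrow> bool" where
  "smooth_manifold A \<longleftrightarrow> smooth_atlas A \<and>
     Hausdorff_space (atlas_topology A) \<and> second_countable (atlas_topology A)"

definition sub_atlas :: "('a, 'e) chart set \<Rightarrow> 'a set \<Rightarrow> ('a, 'e) chart set" where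
  "sub_atlas A W = {(U \<inter> W, \<phi>) | U \<phi>. (U, \<phi>) \<in> A}"

definition prod_atlas ::
  "('a, 'e) chart set \<Rightarrow> ('b, 'f) chart set \<Rightarrow> ('a \<times> 'b, 'e \<times> 'f) chart set" where
  "prod_atlas A B = {(U \<times> V, map_prod \<phi> \<psi>) | U \<phi> V \<psi>. (U, \<phi>) \<in> A \<and> (V, \<psi>) \<in> B}"

definition real_atlas :: "(real, real) chart set" where
  "real_atlas = {(UNIV, id)}"

text \<open>Openness of the coordinate domains \<open>\<phi> ` (U \<inter> F -` V)\<close> encodes continuity of \<open>F\<close>.\<close>

definition smooth_map ::
  "('a, 'e::real_normed_vector) chart set \<Rightarrow> ('b, 'f::real_normed_vector) chart set \<Rightarrow> ('a \<Rightarrow> 'b) \<Rightarrow> bool" where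
  "smooth_map A B F \<longleftrightarrow> F \<in> points A \<rightarrow> points B \<and>
     (\<forall>(U, \<phi>)\<in>A. \<forall>(V, \<psi>)\<in>B.
        open (\<phi> ` (U \<inter> F -` V)) \<and> smooth_on (\<phi> ` (U \<inter> F -` V)) (\<psi> \<circ> F \<circ> inv_into U \<phi>))"

definition diffeo ::
  "('a, 'e::real_normed_vector) chart set \<Rightarrow> ('b, 'f::real_normed_vector) chart set \<Rightarrow> ('a \<Rightarrow> 'b) \<Rightarrow> bool" where
  "diffeo A B F \<longleftrightarrow> bij_betw F (points A) (points B) \<and>
     smooth_map A B F \<and> smooth_map B A (inv_into (points A) F)"

definition submersion ::
  "('a, 'e::real_normed_vector) chart set \<Rightarrow> ('b, 'f::real_normed_vector) chart set \<Rightarrow> ('a \<Rightarrow> 'b) \<Rightarrow> bool" where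
  "submersion A B F \<longleftrightarrow> smooth_map A B F \<and>
     (\<forall>(U, \<phi>)\<in>A. \<forall>(V, \<psi>)\<in>B. \<forall>x \<in> U \<inter> F -` V.
        surj (frechet_derivative (\<psi> \<circ> F \<circ> inv_into U \<phi>) (at (\<phi> x))))"


section \<open>Smooth functions and vector fields\<close>

definition smooth_functions :: "('a, 'e::real_normed_vector) chart set \<Rightarrow> ('a \<Rightarrow> real) set" where
  "smooth_functions A = {f \<in> extensional (points A). smooth_map A real_atlas f}"

text \<open>Tangent vectors at \<open>x\<close> are the point derivations of the algebra of smooth functions.\<close>

definition tangent_space ::
  "('a, 'e::real_normed_vector) chart set \<Rightarrow> 'a \<Rightarrow> (('a \<Rightarrow> real) \<Rightarrow> real) set" where
  "tangent_space A x = {v \<in> extensional (smooth_functions A).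
     (\<forall>f\<in>smooth_functions A. \<forall>g\<in>smooth_functions A.
        v (\<lambda>y\<in>points A. f y + g y) = v f + v g \<and>
        v (\<lambda>y\<in>points A. f y * g y) = v f * g x + f x * v g) \<and>
     (\<forall>c. \<forall>f\<in>smooth_functions A. v (\<lambda>y\<in>points A. c * f y) = c * v f)}"

definition vf_apply :: "('a, 'e) chart set \<Rightarrow> ('a \<Rightarrow> ('a \<Rightarrow> real) \<Rightarrow> real) \<Rightarrow> ('a \<Rightarrow> real) \<Rightarrow> 'a \<Rightarrow> real" where
  "vf_apply A X f = (\<lambda>x\<in>points A. X x f)"

definition vector_fields ::
  "('a, 'e::real_normed_vector) chart set \<Rightarrow> ('a \<Rightarrow> ('a \<Rightarrow> real) \<Rightarrow> real) set" where
  "vector_fields A = {X \<in> extensional (points A).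
     (\<forall>x\<in>points A. X x \<in> tangent_space A x) \<and>
     (\<forall>f\<in>smooth_functions A. vf_apply A X f \<in> smooth_functions A)}"

definition tangent_map ::
  "('a, 'e::real_normed_vector) chart set \<Rightarrow> ('b, 'f::real_normed_vector) chart set \<Rightarrow> ('a \<Rightarrow> 'b) \<Rightarrow>
   (('a \<Rightarrow> real) \<Rightarrow> real) \<Rightarrow> ('b \<Rightarrow> real) \<Rightarrow> real" where
  "tangent_map A B F v = (\<lambda>f\<in>smooth_functions B. v (\<lambda>x\<in>points A. f (F x)))"

definition projects_to ::
  "('a, 'e::real_normed_vector) chart set \<Rightarrow> ('b, 'f::real_normed_vector) chart set \<Rightarrow> ('a \<Rightarrow> 'b) \<Rightarrow>
   ('a \<Rightarrow> ('a \<Rightarrow> real) \<Rightarrow> real) \<Rightarrow> ('b \<Rightarrow> ('b \<Rightarrow> real) \<Rightarrow> real) \<Rightarrow> bool" where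
  "projects_to A B F X Y \<longleftrightarrow> (\<forall>x\<in>points A. tangent_map A B F (X x) = Y (F x))"


section \<open>Lie groups, smooth actions, quotient manifolds\<close>

definition lie_group ::
  "('g, 'm) monoid_scheme \<Rightarrow> ('g, 'e::finite_dim_inner) chart set \<Rightarrow> bool" where
  "lie_group G AG \<longleftrightarrow> group G \<and> smooth_manifold AG \<and> points AG = carrier G \<and>
     smooth_map (prod_atlas AG AG) AG (\<lambda>(g, h). g \<otimes>\<^bsub>G\<^esub> h) \<and>
     smooth_map AG AG (\<lambda>g. inv\<^bsub>G\<^esub> g)"

definition smooth_action ::
  "('g, 'm) monoid_scheme \<Rightarrow> ('g, 'e::real_normed_vector) chart set \<Rightarrow>
   ('a, 'f::real_normed_vector) chart set \<Rightarrow> ('g \<Rightarrow> 'a \<Rightarrow> 'a) \<Rightarrow> bool" where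
  "smooth_action G AG A \<Phi> \<longleftrightarrow> group_action G (points A) \<Phi> \<and>
     smooth_map (prod_atlas AG A) A (\<lambda>(g, x). \<Phi> g x)"

text \<open>
  \<open>AQ\<close> is a manifold structure on the set of orbits, with quotient map \<^term>\<open>orbit G \<Phi>\<close>.
  The submersion property forces the topology to be the quotient topology and makes the smooth
  structure unique.
\<close>

definition quotient_manifold ::
  "('g, 'm) monoid_scheme \<Rightarrow> ('a, 'e::finite_dim_inner) chart set \<Rightarrow> ('g \<Rightarrow> 'a \<Rightarrow> 'a) \<Rightarrow>
   ('a set, 'f::finite_dim_inner) chart set \<Rightarrow> bool" where
  "quotient_manifold G A \<Phi> AQ \<longleftrightarrow> smooth_manifold AQ \<and>
     points AQ = orbits G (points A) \<Phi> \<and> submersion A AQ (orbit G \<Phi>)"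

definition G_invariant_functions ::
  "('g, 'm) monoid_scheme \<Rightarrow> ('a, 'e::real_normed_vector) chart set \<Rightarrow> ('g \<Rightarrow> 'a \<Rightarrow> 'a) \<Rightarrow> ('a \<Rightarrow> real) set" where
  "G_invariant_functions G A \<Phi> =
     {f \<in> smooth_functions A. \<forall>g\<in>carrier G. \<forall>x\<in>points A. f (\<Phi> g x) = f x}"

definition G_invariant_vector_field ::
  "('g, 'm) monoid_scheme \<Rightarrow> ('a, 'e::real_normed_vector) chart set \<Rightarrow> ('g \<Rightarrow> 'a \<Rightarrow> 'a) \<Rightarrow>
   ('a \<Rightarrow> ('a \<Rightarrow> real) \<Rightarrow> real) \<Rightarrow> bool" where
  "G_invariant_vector_field G A \<Phi> X \<longleftrightarrow>
     (\<forall>g\<in>carrier G. \<forall>x\<in>points A. tangent_map A A (\<Phi> g) (X x) = X (\<Phi> g x))"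

text \<open>
  Invariance as an operator on invariant functions. For invariant \<open>f\<close> one has
  \<open>f \<circ> \<Phi> g = f\<close>, so this is the equation of \<^const>\<open>G_invariant_vector_field\<close> tested on
  invariant functions only, i.e. invariance up to vector fields tangent to the orbits.

  A bracket that is closed on equivariant sections only yields this form of invariance for its
  symbols. For the translations in \<open>y\<close> on \<open>\<real>\<^sup>2\<close>, acting trivially on the fibres of the trivial
  line bundle, the Poisson bracket \<open>y (f\<^sub>x g\<^sub>y - f\<^sub>y g\<^sub>x)\<close> vanishes on invariant functions, but the
  symbol of the invariant function \<open>x\<close> is \<open>- y \<partial>\<^sub>y\<close>, which is not an invariant vector field.
\<close>

definition preserves_G_invariance ::
  "('g, 'm) monoid_scheme \<Rightarrow> ('a, 'e::real_normed_vector) chart set \<Rightarrow> ('g \<Rightarrow> 'a \<Rightarrow> 'a) \<Rightarrow>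
   ('a \<Rightarrow> ('a \<Rightarrow> real) \<Rightarrow> real) \<Rightarrow> bool" where
  "preserves_G_invariance G A \<Phi> X \<longleftrightarrow>
     (\<forall>f\<in>G_invariant_functions G A \<Phi>. vf_apply A X f \<in> G_invariant_functions G A \<Phi>)"


section \<open>Line bundles\<close>

text \<open>
  An element \<open>(U, \<tau>)\<close> of \<open>triv\<close> stands for the local trivialization
  \<open>l \<mapsto> (bproj l, \<tau> l)\<close> from the part of the total space over \<open>U\<close> to \<open>U \<times> \<real>\<close>; the values of
  \<open>\<tau>\<close> elsewhere are irrelevant.
\<close>

record ('k, 'l) pre_bundle =
  total_space :: "'l set"
  bproj :: "'l \<Rightarrow> 'k"
  fadd :: "'l \<Rightarrow> 'l \<Rightarrow> 'l"
  fscale :: "real \<Rightarrow> 'l \<Rightarrow> 'l"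
  triv :: "('k set \<times> ('l \<Rightarrow> real)) set"

definition fibre :: "('k, 'l) pre_bundle \<Rightarrow> 'k \<Rightarrow> 'l set" where
  "fibre L x = {l \<in> total_space L. bproj L l = x}"

definition linear_on_fibre :: "('k, 'l) pre_bundle \<Rightarrow> 'k \<Rightarrow> ('l \<Rightarrow> real) \<Rightarrow> bool" where
  "linear_on_fibre L x \<alpha> \<longleftrightarrow>
     (\<forall>a\<in>fibre L x. \<forall>b\<in>fibre L x. \<alpha> (fadd L a b) = \<alpha> a + \<alpha> b) \<and>
     (\<forall>c. \<forall>a\<in>fibre L x. \<alpha> (fscale L c a) = c * \<alpha> a)"

text \<open>The local frame \<open>x \<mapsto> \<tau>\<^sub>x\<^sup>-\<^sup>1(1)\<close> belonging to a trivialization.\<close>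

definition frame :: "('k, 'l) pre_bundle \<Rightarrow> ('l \<Rightarrow> real) \<Rightarrow> 'k \<Rightarrow> 'l" where
  "frame L \<tau> x = inv_into (fibre L x) \<tau> 1"

definition local_triv ::
  "('k, 'e::real_normed_vector) chart set \<Rightarrow> ('k, 'l) pre_bundle \<Rightarrow> 'k set \<Rightarrow> ('l \<Rightarrow> real) \<Rightarrow> bool" where
  "local_triv A L U \<tau> \<longleftrightarrow> openin (atlas_topology A) U \<and>
     (\<forall>x\<in>U. linear_on_fibre L x \<tau> \<and> bij_betw \<tau> (fibre L x) UNIV) \<and>
     (\<forall>(V, \<sigma>)\<in>triv L. smooth_map (sub_atlas A (U \<inter> V)) real_atlas (\<lambda>x. \<tau> (frame L \<sigma> x)))"

text \<open>
  The vector space axioms of the fibres follow from the fibrewise linear bijections onto \<open>\<real>\<close>.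
\<close>

definition line_bundle :: "('k, 'e::real_normed_vector) chart set \<Rightarrow> ('k, 'l) pre_bundle \<Rightarrow> bool" where
  "line_bundle A L \<longleftrightarrow> bproj L \<in> total_space L \<rightarrow> points A \<and>
     (\<forall>x. \<forall>a\<in>fibre L x. \<forall>b\<in>fibre L x. fadd L a b \<in> fibre L x) \<and>
     (\<forall>x c. \<forall>a\<in>fibre L x. fscale L c a \<in> fibre L x) \<and>
     points A = (\<Union>(U, \<tau>)\<in>triv L. U) \<and>
     (\<forall>(U, \<tau>)\<in>triv L. local_triv A L U \<tau>)"

definition total_atlas ::
  "('k, 'e) chart set \<Rightarrow> ('k, 'l) pre_bundle \<Rightarrow> ('l, 'e \<times> real) chart set" where
  "total_atlas A L = {({l \<in> total_space L. bproj L l \<in> U \<inter> V}, \<lambda>l. (\<phi> (bproj L l), \<tau> l)) |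
     U \<phi> V \<tau>. (U, \<phi>) \<in> A \<and> (V, \<tau>) \<in> triv L}"

definition sections ::
  "('k, 'e::real_normed_vector) chart set \<Rightarrow> ('k, 'l) pre_bundle \<Rightarrow> ('k \<Rightarrow> 'l) set" where
  "sections A L = {s \<in> extensional (points A).
     smooth_map A (total_atlas A L) s \<and> (\<forall>x\<in>points A. bproj L (s x) = x)}"

definition sec_add :: "('k, 'e) chart set \<Rightarrow> ('k, 'l) pre_bundle \<Rightarrow> ('k \<Rightarrow> 'l) \<Rightarrow> ('k \<Rightarrow> 'l) \<Rightarrow> 'k \<Rightarrow> 'l" where
  "sec_add A L s t = (\<lambda>x\<in>points A. fadd L (s x) (t x))"

definition sec_scale :: "('k, 'e) chart set \<Rightarrow> ('k, 'l) pre_bundle \<Rightarrow> ('k \<Rightarrow> real) \<Rightarrow> ('k \<Rightarrow> 'l) \<Rightarrow> 'k \<Rightarrow> 'l" where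
  "sec_scale A L f s = (\<lambda>x\<in>points A. fscale L (f x) (s x))"

definition line_bundle_iso ::
  "('k, 'e::real_normed_vector) chart set \<Rightarrow> ('k, 'l) pre_bundle \<Rightarrow>
   ('q, 'f::real_normed_vector) chart set \<Rightarrow> ('q, 'p) pre_bundle \<Rightarrow> ('l \<Rightarrow> 'p) \<Rightarrow> ('k \<Rightarrow> 'q) \<Rightarrow> bool" where
  "line_bundle_iso A L B M F f \<longleftrightarrow>
     diffeo A B f \<and> diffeo (total_atlas A L) (total_atlas B M) F \<and>
     (\<forall>l\<in>total_space L. bproj M (F l) = f (bproj L l)) \<and>
     (\<forall>x. \<forall>a\<in>fibre L x. \<forall>b\<in>fibre L x. F (fadd L a b) = fadd M (F a) (F b)) \<and>
     (\<forall>x c. \<forall>a\<in>fibre L x. F (fscale L c a) = fscale M c (F a))"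

text \<open>
  Points of the dual bundle are pairs \<open>(x, \<alpha>)\<close> with \<open>\<alpha>\<close> a linear functional on the fibre over
  \<open>x\<close>. The trivialization dual to \<open>\<tau>\<close> evaluates \<open>\<alpha>\<close> on the frame of \<open>\<tau>\<close>.
\<close>

definition dual_bundle :: "('k, 'l) pre_bundle \<Rightarrow> ('k, 'k \<times> ('l \<Rightarrow> real)) pre_bundle" where
  "dual_bundle L = \<lparr>
     total_space = {(x, \<alpha>). x \<in> bproj L ` total_space L \<and> \<alpha> \<in> extensional (fibre L x) \<and>
                            linear_on_fibre L x \<alpha>},
     bproj = fst,
     fadd = (\<lambda>(x, \<alpha>) (y, \<beta>). (x, \<lambda>l\<in>fibre L x. \<alpha> l + \<beta> l)),
     fscale = (\<lambda>c (x, \<alpha>). (x, \<lambda>l\<in>fibre L x. c * \<alpha> l)),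
     triv = {(U, \<lambda>(x, \<alpha>). \<alpha> (frame L \<tau> x)) | U \<tau>. (U, \<tau>) \<in> triv L} \<rparr>"


section \<open>Representations and quotient bundles\<close>

definition bundle_representation ::
  "('g, 'm) monoid_scheme \<Rightarrow> ('g, 'd::real_normed_vector) chart set \<Rightarrow>
   ('k, 'e::real_normed_vector) chart set \<Rightarrow> ('k, 'l) pre_bundle \<Rightarrow>
   ('g \<Rightarrow> 'l \<Rightarrow> 'l) \<Rightarrow> ('g \<Rightarrow> 'k \<Rightarrow> 'k) \<Rightarrow> bool" where
  "bundle_representation G AG A L \<Phi>L \<Phi>K \<longleftrightarrow>
     smooth_action G AG (total_atlas A L) \<Phi>L \<and> smooth_action G AG A \<Phi>K \<and>
     (\<forall>g\<in>carrier G. line_bundle_iso A L A L (\<Phi>L g) (\<Phi>K g))"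

definition dual_action ::
  "('g, 'm) monoid_scheme \<Rightarrow> ('k, 'l) pre_bundle \<Rightarrow> ('g \<Rightarrow> 'l \<Rightarrow> 'l) \<Rightarrow> ('g \<Rightarrow> 'k \<Rightarrow> 'k) \<Rightarrow>
   'g \<Rightarrow> 'k \<times> ('l \<Rightarrow> real) \<Rightarrow> 'k \<times> ('l \<Rightarrow> real)" where
  "dual_action G L \<Phi>L \<Phi>K g = (\<lambda>(x, \<alpha>) \<in> total_space (dual_bundle L).
     (\<Phi>K g x, \<lambda>l\<in>fibre L (\<Phi>K g x). \<alpha> (\<Phi>L (inv\<^bsub>G\<^esub> g) l)))"

definition equivariant_sections ::
  "('g, 'm) monoid_scheme \<Rightarrow> ('k, 'e::real_normed_vector) chart set \<Rightarrow> ('k, 'l) pre_bundle \<Rightarrow>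
   ('g \<Rightarrow> 'l \<Rightarrow> 'l) \<Rightarrow> ('g \<Rightarrow> 'k \<Rightarrow> 'k) \<Rightarrow> ('k \<Rightarrow> 'l) set" where
  "equivariant_sections G A L \<Phi>L \<Phi>K =
     {s \<in> sections A L. \<forall>g\<in>carrier G. \<forall>x\<in>points A. \<Phi>L g (s x) = s (\<Phi>K g x)}"

text \<open>
  The total space is the set of orbits. The projection and the fibre operations are the images of
  those of \<open>L\<close>: when the isotropy groups act trivially on the fibres (which is necessary for the
  quotient to be a line bundle), \<open>fadd\<close> maps the orbits of \<open>a\<close> and \<open>b\<close>, with \<open>a\<close> and \<open>b\<close> in the
  same fibre, to the orbit of \<open>fadd L a b\<close>. The trivializations are all those which pull back to
  smooth local trivializations of \<open>L\<close> along the quotient maps.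
\<close>

definition quotient_bundle ::
  "('g, 'm) monoid_scheme \<Rightarrow> ('k, 'e::real_normed_vector) chart set \<Rightarrow> ('k, 'l) pre_bundle \<Rightarrow>
   ('g \<Rightarrow> 'l \<Rightarrow> 'l) \<Rightarrow> ('g \<Rightarrow> 'k \<Rightarrow> 'k) \<Rightarrow> ('k set, 'l set) pre_bundle" where
  "quotient_bundle G A L \<Phi>L \<Phi>K = \<lparr>
     total_space = orbits G (total_space L) \<Phi>L,
     bproj = (\<lambda>p. bproj L ` p),
     fadd = (\<lambda>p q. {fadd L a b | a b. a \<in> p \<and> b \<in> q \<and> bproj L a = bproj L b}),
     fscale = (\<lambda>c p. fscale L c ` p),
     triv = {(U, \<tau>). U \<subseteq> orbits G (points A) \<Phi>K \<and>
               local_triv A L {x \<in> points A. orbit G \<Phi>K x \<in> U} (\<tau> \<circ> orbit G \<Phi>L)} \<rparr>"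

text \<open>
  For equivariant \<open>h\<close> the image under \<open>h\<close> of the orbit of \<open>x\<close> is the orbit of \<open>h x\<close>.
\<close>

definition quotient_section ::
  "('g, 'm) monoid_scheme \<Rightarrow> ('k, 'e) chart set \<Rightarrow> ('g \<Rightarrow> 'k \<Rightarrow> 'k) \<Rightarrow> ('k \<Rightarrow> 'l) \<Rightarrow> 'k set \<Rightarrow> 'l set" where
  "quotient_section G A \<Phi>K h = (\<lambda>p \<in> orbits G (points A) \<Phi>K. h ` p)"

text \<open>
  The canonical map from the quotient \<open>L\<^sup>*/G\<close> of the dual bundle to the dual \<open>(L/G)\<^sup>*\<close> of the
  quotient bundle \<open>LQ\<close>: the orbit of \<open>(x, \<alpha>)\<close> sends the orbit of \<open>l\<close>, with \<open>l\<close> in the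
  fibre over \<open>x\<close>, to \<open>\<alpha> l\<close>.
\<close>

definition quotient_dual_map ::
  "('k, 'l) pre_bundle \<Rightarrow> ('k set, 'l set) pre_bundle \<Rightarrow>
   ('k \<times> ('l \<Rightarrow> real)) set \<Rightarrow> 'k set \<times> ('l set \<Rightarrow> real)" where
  "quotient_dual_map L LQ p =
     (fst ` p, \<lambda>q \<in> fibre LQ (fst ` p). THE r. \<exists>(x, \<alpha>)\<in>p. \<exists>l\<in>q. bproj L l = x \<and> r = \<alpha> l)"


section \<open>Kirillov structures\<close>

text \<open>In the Jacobi identity, \<open>0 \<cdot> s\<close> is the zero section.\<close>

definition lie_bracket ::
  "('k, 'e::real_normed_vector) chart set \<Rightarrow> ('k, 'l) pre_bundle \<Rightarrow>
   (('k \<Rightarrow> 'l) \<Rightarrow> ('k \<Rightarrow> 'l) \<Rightarrow> 'k \<Rightarrow> 'l) \<Rightarrow> bool" where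
  "lie_bracket A D B \<longleftrightarrow>
     (\<forall>s\<in>sections A D. \<forall>t\<in>sections A D.
        B s t \<in> sections A D \<and> B s t = sec_scale A D (\<lambda>_. -1) (B t s) \<and>
        (\<forall>c. B (sec_scale A D (\<lambda>_. c) s) t = sec_scale A D (\<lambda>_. c) (B s t) \<and>
             B s (sec_scale A D (\<lambda>_. c) t) = sec_scale A D (\<lambda>_. c) (B s t)) \<and>
        (\<forall>u\<in>sections A D.
           B (sec_add A D s u) t = sec_add A D (B s t) (B u t) \<and>
           B s (sec_add A D t u) = sec_add A D (B s t) (B s u) \<and>
           sec_add A D (sec_add A D (B s (B t u)) (B t (B u s))) (B u (B s t)) =
             sec_scale A D (\<lambda>_. 0) s))"

definition is_symbol ::
  "('k, 'e::real_normed_vector) chart set \<Rightarrow> ('k, 'l) pre_bundle \<Rightarrow>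
   (('k \<Rightarrow> 'l) \<Rightarrow> ('k \<Rightarrow> 'l) \<Rightarrow> 'k \<Rightarrow> 'l) \<Rightarrow> ('k \<Rightarrow> 'l) \<Rightarrow> ('k \<Rightarrow> ('k \<Rightarrow> real) \<Rightarrow> real) \<Rightarrow> bool" where
  "is_symbol A D B h2 X \<longleftrightarrow> X \<in> vector_fields A \<and>
     (\<forall>h1\<in>sections A D. \<forall>f\<in>smooth_functions A.
        B (sec_scale A D f h1) h2 =
          sec_add A D (sec_scale A D f (B h1 h2)) (sec_scale A D (vf_apply A X f) h1))"

text \<open>A Kirillov structure on \<open>L\<close> lives on the sections of \<open>D = L\<^sup>*\<close>.\<close>

definition kirillov_bracket ::
  "('k, 'e::real_normed_vector) chart set \<Rightarrow> ('k, 'l) pre_bundle \<Rightarrow>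
   (('k \<Rightarrow> 'l) \<Rightarrow> ('k \<Rightarrow> 'l) \<Rightarrow> 'k \<Rightarrow> 'l) \<Rightarrow> bool" where
  "kirillov_bracket A D B \<longleftrightarrow>
     lie_bracket A D B \<and> (\<forall>h2\<in>sections A D. \<exists>X. is_symbol A D B h2 X)"

definition kirillov_structure ::
  "('k, 'e::real_normed_vector) chart set \<Rightarrow> ('k, 'l) pre_bundle \<Rightarrow>
   (('k \<Rightarrow> 'k \<times> ('l \<Rightarrow> real)) \<Rightarrow> ('k \<Rightarrow> 'k \<times> ('l \<Rightarrow> real)) \<Rightarrow> 'k \<Rightarrow> 'k \<times> ('l \<Rightarrow> real)) \<Rightarrow> bool" where
  "kirillov_structure A L B \<longleftrightarrow> kirillov_bracket A (dual_bundle L) B"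

definition compatible_representation ::
  "('g, 'm) monoid_scheme \<Rightarrow> ('k, 'e::real_normed_vector) chart set \<Rightarrow> ('k, 'l) pre_bundle \<Rightarrow>
   ('g \<Rightarrow> 'l \<Rightarrow> 'l) \<Rightarrow> ('g \<Rightarrow> 'k \<Rightarrow> 'k) \<Rightarrow>
   (('k \<Rightarrow> 'k \<times> ('l \<Rightarrow> real)) \<Rightarrow> ('k \<Rightarrow> 'k \<times> ('l \<Rightarrow> real)) \<Rightarrow> 'k \<Rightarrow> 'k \<times> ('l \<Rightarrow> real)) \<Rightarrow> bool" where
  "compatible_representation G A L \<Phi>L \<Phi>K B \<longleftrightarrow>
     (let E = equivariant_sections G A (dual_bundle L) (dual_action G L \<Phi>L \<Phi>K) \<Phi>K
      in \<forall>h1\<in>E. \<forall>h2\<in>E. B h1 h2 \<in> E)"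

definition section_action ::
  "('g, 'm) monoid_scheme \<Rightarrow> ('k, 'e) chart set \<Rightarrow> ('g \<Rightarrow> 'l \<Rightarrow> 'l) \<Rightarrow> ('g \<Rightarrow> 'k \<Rightarrow> 'k) \<Rightarrow>
   'g \<Rightarrow> ('k \<Rightarrow> 'l) \<Rightarrow> 'k \<Rightarrow> 'l" where
  "section_action G A \<Phi>L \<Phi>K g s = (\<lambda>x\<in>points A. \<Phi>L g (s (\<Phi>K (inv\<^bsub>G\<^esub> g) x)))"

text \<open>The group acts on the Lie algebra of all sections of \<open>D\<close> by automorphisms.\<close>

definition equivariant_bracket ::
  "('g, 'm) monoid_scheme \<Rightarrow> ('k, 'e::real_normed_vector) chart set \<Rightarrow> ('k, 'l) pre_bundle \<Rightarrow>
   ('g \<Rightarrow> 'l \<Rightarrow> 'l) \<Rightarrow> ('g \<Rightarrow> 'k \<Rightarrow> 'k) \<Rightarrow>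
   (('k \<Rightarrow> 'l) \<Rightarrow> ('k \<Rightarrow> 'l) \<Rightarrow> 'k \<Rightarrow> 'l) \<Rightarrow> bool" where
  "equivariant_bracket G A D \<Phi>D \<Phi>K B \<longleftrightarrow>
     (\<forall>g\<in>carrier G. \<forall>s\<in>sections A D. \<forall>t\<in>sections A D.
        B (section_action G A \<Phi>D \<Phi>K g s) (section_action G A \<Phi>D \<Phi>K g t) =
          section_action G A \<Phi>D \<Phi>K g (B s t))"

end

theory Submission
  imports Defs
begin

text \<open>
  Pulled back to \<open>K\<close>, a trivialization of \<open>L/G\<close> is a \<open>G\<close>-invariant trivialization of \<open>L\<close>. In
  such a trivialization a section is equivariant exactly when its coordinate is an invariant
  function, and an invariant function on \<open>K\<close> is a function on \<open>K/G\<close>. It is smooth on \<open>K/G\<close> as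
  soon as it is smooth on \<open>K\<close>, because the submersion \<open>K \<rightarrow> K/G\<close> has smooth local sections
  (\<open>submersion_local_section\<close>, \<open>smooth_at_descends\<close>). Invariant trivializations of \<open>L\<close> have
  equivariant frames, so they dualize to invariant trivializations of \<open>L\<^sup>*\<close>
  (\<open>dual_coord_invariant\<close>). Hence \<open>L\<^sup>*/G\<close> is a line bundle, it is the identity onto \<open>(L/G)\<^sup>*\<close> in
  these coordinates (\<open>quotient_dual_iso\<close>), and its sections are the equivariant sections of
  \<open>L\<^sup>*\<close> (\<open>bij_betw_qs\<close>).

  The bijection is linear over the invariant functions. By compatibility the bracket restricts to
  equivariant sections, so it is transported to \<open>L\<^sup>*/G\<close> together with all Lie algebra identities
  (\<open>lie_bracket_BQ\<close>).

  The symbols are read off from \<open>[f h\<^sub>1, h] = f [h\<^sub>1, h] + X(f) h\<^sub>1\<close>. For \<open>h\<close>, \<open>h\<^sub>1\<close> equivariant and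
  \<open>f\<close> invariant, every term but the last is known to be equivariant, so \<open>X(f) h\<^sub>1\<close> is equivariant,
  and dividing by \<open>h\<^sub>1\<close> shows that \<open>X(f)\<close> is invariant. The division needs, for every point of
  \<open>K\<close>, an equivariant section that does not vanish there; it is the lift of a bump function times
  a local frame on the Hausdorff manifold \<open>K/G\<close>
  (\<open>ex_nonvanishing_equivariant_section\<close>). The same division identifies the projection of \<open>X\<close>
  with the symbol of the quotient bracket (\<open>symbol_projects\<close>), and for a \<open>G\<close>-equivariant bracket
  it gives the invariance of \<open>X\<close> on all functions (\<open>symbol_invariant\<close>).

  Smoothness is defined by iterated directional derivatives in spaces of arbitrary finite
  dimension, zero included. The chain rule, the smooth inverse function theorem and bump functions
  are therefore derived first; from then on smoothness of maps between manifolds is treated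
  pointwise (\<open>smooth_at\<close>).
\<close>

section \<open>Calculus of smooth maps\<close>

lemma Ck_on_subset: "Ck_on k S f \<Longrightarrow> T \<subseteq> S \<Longrightarrow> Ck_on k T f"
  by (induction k arbitrary: f) (auto intro: continuous_on_subset)

lemma Ck_on_cong:
  assumes "open S" "\<And>x. x \<in> S \<Longrightarrow> f x = g x" "Ck_on k S f"
  shows "Ck_on k S g"
  using assms(2,3)
proof (induction k arbitrary: f g)
  case 0
  then show ?case using continuous_on_eq[of S f g] by simp
next
  case (Suc k)
  have der: "(g has_derivative frechet_derivative f (at x)) (at x)" if "x \<in> S" for x
  proof (rule has_derivative_transform_within_open[where f=f and s=S])
    show "(f has_derivative frechet_derivative f (at x)) (at x)"
      using Suc.prems that by (simp flip: frechet_derivative_works)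
  qed (use Suc.prems that \<open>open S\<close> in auto)
  then have eq: "frechet_derivative f (at x) v = frechet_derivative g (at x) v" if "x \<in> S" for x v
    using frechet_derivative_at that by metis
  have "Ck_on k S (\<lambda>x. frechet_derivative g (at x) v)" for v
    by (rule Suc.IH[OF eq]) (use Suc.prems in auto)
  then show ?case using der by (auto simp: differentiable_def)
qed

lemma Ck_on_SucI:
  assumes "open S" "\<And>x. x \<in> S \<Longrightarrow> (f has_derivative f' x) (at x)"
    "\<And>v. Ck_on k S (\<lambda>x. f' x v)"
  shows "Ck_on (Suc k) S f"
proof -
  have "f' x v = frechet_derivative f (at x) v" if "x \<in> S" for x v
    using frechet_derivative_at[OF assms(2)[OF that]] by simp
  then have "Ck_on k S (\<lambda>x. frechet_derivative f (at x) v)" for v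
    using Ck_on_cong[OF \<open>open S\<close> _ assms(3)] by auto
  then show ?thesis using assms(2) by (auto simp: differentiable_def)
qed

lemma Ck_on_SucD:
  assumes "Ck_on (Suc k) S f" "x \<in> S"
  shows "(f has_derivative frechet_derivative f (at x)) (at x)"
  using assms by (simp add: frechet_derivative_works)

lemma Ck_on_Suc_lower: "Ck_on (Suc k) S f \<Longrightarrow> Ck_on k S f"
proof (induction k arbitrary: f)
  case 0
  then show ?case
    by (simp add: differentiable_imp_continuous_within continuous_at_imp_continuous_on)
next
  case (Suc k)
  then show ?case by (metis Ck_on.simps(2))
qed

lemma Ck_on_local:
  assumes "\<And>x. x \<in> S \<Longrightarrow> \<exists>T. open T \<and> x \<in> T \<and> Ck_on k T f"
  shows "Ck_on k S f"
  using assms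
proof (induction k arbitrary: f)
  case 0
  have "isCont f x" if "x \<in> S" for x
    using 0[OF that] continuous_on_eq_continuous_at by auto
  then show ?case by (simp add: continuous_at_imp_continuous_on)
next
  case (Suc k)
  have "f differentiable (at x)" if "x \<in> S" for x
    using Suc.prems[OF that] by auto
  moreover have "Ck_on k S (\<lambda>x. frechet_derivative f (at x) v)" for v
    by (rule Suc.IH) (use Suc.prems in fastforce)
  ultimately show ?case by simp
qed

lemma Ck_on_const [simp]: "open S \<Longrightarrow> Ck_on k S (\<lambda>x. c)"
proof (induction k arbitrary: c)
  case (Suc k)
  then show ?case by (intro Ck_on_SucI[where f'="\<lambda>x v. 0"]) auto
qed simp

lemma Ck_on_bounded_linear_compose:
  assumes "bounded_linear l" "open S" "Ck_on k S f"
  shows "Ck_on k S (\<lambda>x. l (f x))"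
  using assms(3)
proof (induction k arbitrary: f)
  case 0
  then show ?case using bounded_linear.continuous_on[OF assms(1)] by simp
next
  case (Suc k)
  show ?case
  proof (rule Ck_on_SucI[OF \<open>open S\<close>])
    show "((\<lambda>x. l (f x)) has_derivative (\<lambda>v. l (frechet_derivative f (at x) v))) (at x)"
      if "x \<in> S" for x
      using bounded_linear.has_derivative[OF assms(1) Ck_on_SucD[OF Suc.prems that]] .
    show "Ck_on k S (\<lambda>x. l (frechet_derivative f (at x) v))" for v
      using Suc by simp
  qed
qed

lemma Ck_on_bounded_linear:
  assumes "bounded_linear l" "open S"
  shows "Ck_on k S l"
proof (cases k)
  case 0
  then show ?thesis by (simp add: assms(1) linear_continuous_on)
next
  case (Suc m)
  show ?thesis
    unfolding Suc
    by (rule Ck_on_SucI[OF \<open>open S\<close> bounded_linear_imp_has_derivative[OF assms(1)]])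
      (simp add: \<open>open S\<close>)
qed

lemma Ck_on_add:
  assumes "open S" "Ck_on k S f" "Ck_on k S g"
  shows "Ck_on k S (\<lambda>x. f x + g x)"
  using assms(2,3)
proof (induction k arbitrary: f g)
  case 0
  then show ?case by (simp add: continuous_on_add)
next
  case (Suc k)
  show ?case
  proof (rule Ck_on_SucI[OF \<open>open S\<close>])
    show "((\<lambda>x. f x + g x) has_derivative
        (\<lambda>v. frechet_derivative f (at x) v + frechet_derivative g (at x) v)) (at x)"
      if "x \<in> S" for x
      using Ck_on_SucD[OF Suc.prems(1) that] Ck_on_SucD[OF Suc.prems(2) that]
      by (rule has_derivative_add)
  qed (use Suc in auto)
qed

lemma Ck_on_sum:
  assumes "open S" "\<And>i. i \<in> I \<Longrightarrow> Ck_on k S (f i)"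
  shows "Ck_on k S (\<lambda>x. \<Sum>i\<in>I. f i x)"
  using assms(2) by (induction I rule: infinite_finite_induct) (auto intro!: Ck_on_add simp: \<open>open S\<close>)

lemma Ck_on_scaleR:
  fixes f :: "'a::real_normed_vector \<Rightarrow> real"
  assumes "open S" "Ck_on k S f" "Ck_on k S g"
  shows "Ck_on k S (\<lambda>x. f x *\<^sub>R g x)"
  using assms(2,3)
proof (induction k arbitrary: f g)
  case 0
  then show ?case by (simp add: continuous_on_scaleR)
next
  case (Suc k)
  show ?case
  proof (rule Ck_on_SucI[OF \<open>open S\<close>])
    show "((\<lambda>x. f x *\<^sub>R g x) has_derivative
        (\<lambda>v. f x *\<^sub>R frechet_derivative g (at x) v + frechet_derivative f (at x) v *\<^sub>R g x)) (at x)"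
      if "x \<in> S" for x
      using Ck_on_SucD[OF Suc.prems(1) that] Ck_on_SucD[OF Suc.prems(2) that]
      by (rule has_derivative_scaleR)
    show "Ck_on k S (\<lambda>x. f x *\<^sub>R frechet_derivative g (at x) v + frechet_derivative f (at x) v *\<^sub>R g x)"
      for v
      using Suc Ck_on_Suc_lower[OF Suc.prems(1)] Ck_on_Suc_lower[OF Suc.prems(2)]
      by (intro Ck_on_add \<open>open S\<close> Suc.IH) auto
  qed
qed

lemma Ck_on_mult:
  fixes f g :: "'a::real_normed_vector \<Rightarrow> real"
  assumes "open S" "Ck_on k S f" "Ck_on k S g"
  shows "Ck_on k S (\<lambda>x. f x * g x)"
  using Ck_on_scaleR[OF assms] by simp

lemma Ck_on_prod:
  fixes f :: "'i \<Rightarrow> 'a::real_normed_vector \<Rightarrow> real"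
  assumes "open S" "\<And>i. i \<in> I \<Longrightarrow> Ck_on k S (f i)"
  shows "Ck_on k S (\<lambda>x. \<Prod>i\<in>I. f i x)"
  using assms(2) by (induction I rule: infinite_finite_induct) (auto intro!: Ck_on_mult simp: \<open>open S\<close>)

lemma Ck_on_inverse:
  fixes f :: "'a::real_normed_vector \<Rightarrow> real"
  assumes "open S" "\<And>x. x \<in> S \<Longrightarrow> f x \<noteq> 0" "Ck_on k S f"
  shows "Ck_on k S (\<lambda>x. inverse (f x))"
  using assms(3)
proof (induction k)
  case 0
  then show ?case using assms(2) by (simp add: continuous_on_inverse)
next
  case (Suc k)
  show ?case
  proof (rule Ck_on_SucI[OF \<open>open S\<close>])
    show "((\<lambda>x. inverse (f x)) has_derivative
        (\<lambda>v. - (inverse (f x) * frechet_derivative f (at x) v * inverse (f x)))) (at x)"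
      if "x \<in> S" for x
      using Ck_on_SucD[OF Suc.prems that] assms(2)[OF that]
      by (auto intro!: derivative_eq_intros)
    have "Ck_on k S (\<lambda>x. (- 1) * (inverse (f x) * frechet_derivative f (at x) v * inverse (f x)))" for v
      using Suc Ck_on_Suc_lower[OF Suc.prems] by (intro Ck_on_mult \<open>open S\<close> Ck_on_const) auto
    then show "Ck_on k S (\<lambda>x. - (inverse (f x) * frechet_derivative f (at x) v * inverse (f x)))" for v
      by simp
  qed
qed

lemma Ck_on_divide:
  fixes f g :: "'a::real_normed_vector \<Rightarrow> real"
  assumes "open S" "Ck_on k S f" "Ck_on k S g" "\<And>x. x \<in> S \<Longrightarrow> g x \<noteq> 0"
  shows "Ck_on k S (\<lambda>x. f x / g x)"
  unfolding divide_inverse using assms by (intro Ck_on_mult Ck_on_inverse)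

subsection \<open>Finite-dimensional inner product spaces\<close>

text \<open>
  Parseval's expansion formula is taken as the definition: it exhibits the coordinates as bounded
  linear maps without any comparison of norms.
\<close>

definition is_onb :: "'a::real_inner set \<Rightarrow> bool" where
  "is_onb C \<longleftrightarrow> finite C \<and> (\<forall>v. (\<Sum>b\<in>C. (v \<bullet> b) *\<^sub>R b) = v)"

text \<open>
  Gram--Schmidt orthogonalization of a finite spanning set. The formula is checked on the
  orthogonal vectors and extended by linearity; then zero is dropped and the rest is normalized.
\<close>

lemma ex_onb: "\<exists>C :: 'a::finite_dim_inner set. is_onb C"
proof -
  obtain B :: "'a set" where B: "finite B" "\<And>x. \<exists>c. x = (\<Sum>b\<in>B. c b *\<^sub>R b)"
    using finite_dim by metis
  obtain C where C: "finite C" "span C = span B" "pairwise orthogonal C"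
    using basis_orthogonal[OF B(1)] by blast
  have "x \<in> span B" for x
  proof -
    obtain c where "x = (\<Sum>b\<in>B. c b *\<^sub>R b)" using B(2) by blast
    then show ?thesis by (metis (no_types, lifting) span_sum span_scale span_base)
  qed
  then have span: "x \<in> span C" for x using C by blast
  define n where "n b = (1 / norm b) *\<^sub>R b" for b :: 'a
  have "(\<Sum>b\<in>C. (v \<bullet> n b) *\<^sub>R n b) = v" for v
    using span[of v]
  proof (induction v rule: span_induct)
    case base
    show ?case
      by (auto simp: subspace_def inner_left_distrib scaleR_left_distrib sum.distrib
          simp flip: scaleR_scaleR scaleR_sum_right)
  next
    case (step c)
    have "(\<Sum>b\<in>C. (c \<bullet> n b) *\<^sub>R n b) = (\<Sum>b\<in>C. if b = c then c else 0)"
    proof (rule sum.cong[OF refl])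
      fix b assume "b \<in> C"
      then have "b \<noteq> c \<Longrightarrow> c \<bullet> b = 0"
        using C(3) step by (auto simp: pairwise_def orthogonal_def)
      moreover have "(c \<bullet> n c) *\<^sub>R n c = c"
        by (cases "c = 0") (auto simp: n_def dot_square_norm power2_eq_square)
      ultimately show "(c \<bullet> n b) *\<^sub>R n b = (if b = c then c else 0)"
        by (auto simp: n_def)
    qed
    then show ?case using step C(1) by simp
  qed
  note ex = this
  have ninj: "inj_on n (C - {0})"
  proof (rule inj_onI, rule ccontr)
    fix a b assume ab: "a \<in> C - {0}" "b \<in> C - {0}" "n a = n b" "a \<noteq> b"
    then have "a \<bullet> b = 0" using C(3) by (auto simp: pairwise_def orthogonal_def)
    then have "n a \<bullet> n b = 0" by (simp add: n_def)
    then have "n a = 0" using ab(3) by (metis inner_eq_zero_iff)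
    then show False using ab by (simp add: n_def)
  qed
  have "(\<Sum>b\<in>n ` (C - {0}). (v \<bullet> b) *\<^sub>R b) = v" for v
  proof -
    have "(\<Sum>b\<in>n ` (C - {0}). (v \<bullet> b) *\<^sub>R b) = (\<Sum>b\<in>C - {0}. (v \<bullet> n b) *\<^sub>R n b)"
      using sum.reindex[OF ninj] by simp
    also have "\<dots> = (\<Sum>b\<in>C. (v \<bullet> n b) *\<^sub>R n b)"
      using C(1) by (intro sum.mono_neutral_left) (auto simp: n_def)
    finally show ?thesis using ex by simp
  qed
  then have "is_onb (n ` (C - {0}))" using C(1) by (simp add: is_onb_def)
  then show ?thesis by blast
qed

definition onb :: "'a::finite_dim_inner set" where "onb = (SOME C. is_onb C)"

lemma finite_onb [simp]: "finite onb" and onb_expansion: "(\<Sum>b\<in>onb. (v \<bullet> b) *\<^sub>R b) = v"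
proof -
  have "is_onb onb" unfolding onb_def using ex_onb by (rule someI_ex)
  then show "finite onb" "(\<Sum>b\<in>onb. (v \<bullet> b) *\<^sub>R b) = v" by (auto simp: is_onb_def)
qed

instance prod :: (finite_dim_inner, finite_dim_inner) finite_dim_inner
proof
  let ?B = "(\<lambda>b. (b, 0)) ` onb \<union> (\<lambda>b. (0, b)) ` onb :: ('a \<times> 'b) set"
  have "x \<in> span ?B" for x
  proof -
    obtain u v where x: "x = (u, v)" by (cases x)
    have "(\<Sum>b\<in>onb. (u \<bullet> b) *\<^sub>R (b, 0 :: 'b)) \<in> span ?B"
      by (intro span_sum span_scale span_base) auto
    moreover have "(\<Sum>b\<in>onb. (v \<bullet> b) *\<^sub>R (0 :: 'a, b)) \<in> span ?B"
      by (intro span_sum span_scale span_base) auto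
    ultimately have "(\<Sum>b\<in>onb. (u \<bullet> b) *\<^sub>R (b, 0)) + (\<Sum>b\<in>onb. (v \<bullet> b) *\<^sub>R (0, b)) \<in> span ?B"
      by (rule span_add)
    also have "(\<Sum>b\<in>onb. (u \<bullet> b) *\<^sub>R (b, 0)) + (\<Sum>b\<in>onb. (v \<bullet> b) *\<^sub>R (0, b)) = x"
      unfolding x by (simp add: prod_eq_iff fst_sum snd_sum onb_expansion)
    finally show ?thesis .
  qed
  then show "\<exists>B. finite B \<and> (\<forall>x :: 'a \<times> 'b. \<exists>c. x = (\<Sum>b\<in>B. c b *\<^sub>R b))"
    using span_finite[of ?B] by (intro exI[of _ ?B]) (auto simp: image_iff)
qed

lemma linear_imp_bounded_linear:
  fixes l :: "'a::finite_dim_inner \<Rightarrow> 'b::real_normed_vector"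
  assumes "linear l" shows "bounded_linear l"
proof -
  have "l v = (\<Sum>b\<in>onb. (v \<bullet> b) *\<^sub>R l b)" for v
  proof -
    have "l v = l (\<Sum>b\<in>onb. (v \<bullet> b) *\<^sub>R b)" by (simp only: onb_expansion)
    also have "\<dots> = (\<Sum>b\<in>onb. (v \<bullet> b) *\<^sub>R l b)"
      by (simp only: linear_sum[OF assms] linear_scale[OF assms])
    finally show ?thesis .
  qed
  then have "l = (\<lambda>v. \<Sum>b\<in>onb. (v \<bullet> b) *\<^sub>R l b)" by blast
  moreover have "bounded_linear (\<lambda>v. \<Sum>b\<in>onb. (v \<bullet> b) *\<^sub>R l b)"
    by (intro bounded_linear_sum bounded_linear_scaleR_left[THEN bounded_linear_compose]
        bounded_linear_inner_left)
  ultimately show ?thesis by simp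
qed

text \<open>
  The derivative of \<open>g \<circ> f\<close> in direction \<open>v\<close> is \<open>Dg(f x) (Df(x) v)\<close>, where the direction
  \<open>Df(x) v\<close> moves with \<open>x\<close>, while \<open>Ck_on\<close> only speaks of fixed directions. Expanding it in an
  orthonormal basis of the middle space leaves products of \<open>C\<^sup>k\<close> functions.
\<close>

lemma Ck_on_compose:
  fixes f :: "'a::real_normed_vector \<Rightarrow> 'b::finite_dim_inner" and g :: "'b \<Rightarrow> 'c::real_normed_vector"
  assumes "open S" "open T" "f ` S \<subseteq> T" "Ck_on k S f" "Ck_on k T g"
  shows "Ck_on k S (\<lambda>x. g (f x))"
  using assms(3-5)
proof (induction k arbitrary: f g)
  case 0
  then show ?case using continuous_on_compose2[of T g S f] by simp
next
  case (Suc k)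
  have fin: "f x \<in> T" if "x \<in> S" for x using Suc.prems that by auto
  let ?D = "\<lambda>x v. \<Sum>b\<in>onb. (frechet_derivative f (at x) v \<bullet> b) *\<^sub>R frechet_derivative g (at (f x)) b"
  show ?case
  proof (rule Ck_on_SucI[OF \<open>open S\<close>])
    fix x assume x: "x \<in> S"
    have g: "(g has_derivative frechet_derivative g (at (f x))) (at (f x))"
      using Ck_on_SucD[OF Suc.prems(3) fin[OF x]] .
    have "((\<lambda>x. g (f x)) has_derivative
        (\<lambda>v. frechet_derivative g (at (f x)) (frechet_derivative f (at x) v))) (at x)"
      using has_derivative_compose[OF Ck_on_SucD[OF Suc.prems(2) x] g] .
    also have "(\<lambda>v. frechet_derivative g (at (f x)) (frechet_derivative f (at x) v)) = ?D x"
    proof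
      fix v
      have lin: "linear (frechet_derivative g (at (f x)))"
        using g by (rule has_derivative_linear)
      have "frechet_derivative g (at (f x)) (\<Sum>b\<in>onb. (frechet_derivative f (at x) v \<bullet> b) *\<^sub>R b) = ?D x v"
        by (simp only: linear_sum[OF lin] linear_scale[OF lin])
      then show "frechet_derivative g (at (f x)) (frechet_derivative f (at x) v) = ?D x v"
        by (simp only: onb_expansion)
    qed
    finally show "((\<lambda>x. g (f x)) has_derivative ?D x) (at x)" .
  next
    show "Ck_on k S (\<lambda>x. ?D x v)" for v
    proof (intro Ck_on_sum Ck_on_scaleR \<open>open S\<close>)
      show "Ck_on k S (\<lambda>x. frechet_derivative f (at x) v \<bullet> b)" for b
        using Suc.prems(2) by (intro Ck_on_bounded_linear_compose[OF bounded_linear_inner_left] \<open>open S\<close>) auto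
      show "Ck_on k S (\<lambda>x. frechet_derivative g (at (f x)) b)" for b
        using Suc.prems Ck_on_Suc_lower[OF Suc.prems(2)] by (intro Suc.IH) auto
    qed
  qed
qed

subsection \<open>Smooth maps between open sets\<close>

lemma smooth_on_subset: "smooth_on S f \<Longrightarrow> T \<subseteq> S \<Longrightarrow> smooth_on T f"
  using Ck_on_subset unfolding smooth_on_def by blast

lemma smooth_on_cong:
  "smooth_on S f \<Longrightarrow> open S \<Longrightarrow> (\<And>x. x \<in> S \<Longrightarrow> f x = g x) \<Longrightarrow> smooth_on S g"
  using Ck_on_cong unfolding smooth_on_def by metis

lemma smooth_on_local:
  "(\<And>x. x \<in> S \<Longrightarrow> \<exists>T. open T \<and> x \<in> T \<and> smooth_on T f) \<Longrightarrow> smooth_on S f"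
  unfolding smooth_on_def by (metis Ck_on_local)

lemma smooth_on_imp_continuous_on: "smooth_on S f \<Longrightarrow> continuous_on S f"
  unfolding smooth_on_def by (metis Ck_on.simps(1))

lemma smooth_on_has_derivative:
  "smooth_on S f \<Longrightarrow> x \<in> S \<Longrightarrow> (f has_derivative frechet_derivative f (at x)) (at x)"
  unfolding smooth_on_def using Ck_on_SucD by blast

lemma smooth_on_compose:
  fixes f :: "'a::real_normed_vector \<Rightarrow> 'b::finite_dim_inner"
  shows "smooth_on S f \<Longrightarrow> smooth_on T g \<Longrightarrow> open S \<Longrightarrow> open T \<Longrightarrow> f ` S \<subseteq> T \<Longrightarrow>
    smooth_on S (\<lambda>x. g (f x))"
  unfolding smooth_on_def using Ck_on_compose by blast

lemma smooth_on_const: "open S \<Longrightarrow> smooth_on S (\<lambda>x. c)"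
  by (simp add: smooth_on_def)

lemma smooth_on_bounded_linear: "bounded_linear l \<Longrightarrow> open S \<Longrightarrow> smooth_on S l"
  by (simp add: smooth_on_def Ck_on_bounded_linear)

lemma smooth_on_bounded_linear_compose:
  "bounded_linear l \<Longrightarrow> open S \<Longrightarrow> smooth_on S f \<Longrightarrow> smooth_on S (\<lambda>x. l (f x))"
  by (simp add: smooth_on_def Ck_on_bounded_linear_compose)

lemma smooth_on_ident: "open S \<Longrightarrow> smooth_on S (\<lambda>x. x)"
  by (rule smooth_on_bounded_linear[OF bounded_linear_ident])

lemma smooth_on_add: "open S \<Longrightarrow> smooth_on S f \<Longrightarrow> smooth_on S g \<Longrightarrow> smooth_on S (\<lambda>x. f x + g x)"
  by (simp add: smooth_on_def Ck_on_add)

lemma smooth_on_scaleR: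
  "open S \<Longrightarrow> smooth_on S f \<Longrightarrow> smooth_on S g \<Longrightarrow> smooth_on S (\<lambda>x. f x *\<^sub>R g x)"
  by (simp add: smooth_on_def Ck_on_scaleR)

lemma smooth_on_mult:
  fixes f g :: "'a::real_normed_vector \<Rightarrow> real"
  shows "open S \<Longrightarrow> smooth_on S f \<Longrightarrow> smooth_on S g \<Longrightarrow> smooth_on S (\<lambda>x. f x * g x)"
  by (simp add: smooth_on_def Ck_on_mult)

lemma smooth_on_divide:
  fixes f g :: "'a::real_normed_vector \<Rightarrow> real"
  shows "open S \<Longrightarrow> smooth_on S f \<Longrightarrow> smooth_on S g \<Longrightarrow> (\<And>x. x \<in> S \<Longrightarrow> g x \<noteq> 0) \<Longrightarrow>
    smooth_on S (\<lambda>x. f x / g x)"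
  by (simp add: smooth_on_def Ck_on_divide)

lemma smooth_on_Pair:
  fixes f :: "'a::real_normed_vector \<Rightarrow> 'b::real_normed_vector" and g :: "'a \<Rightarrow> 'c::real_normed_vector"
  assumes "open S" "smooth_on S f" "smooth_on S g"
  shows "smooth_on S (\<lambda>x. (f x, g x))"
proof -
  have l: "bounded_linear (\<lambda>u. (u, 0 :: 'c))" "bounded_linear (\<lambda>v. (0 :: 'b, v))"
    by (intro bounded_linear_Pair bounded_linear_ident bounded_linear_zero)+
  have "smooth_on S (\<lambda>x. (f x, 0) + (0, g x))"
    using assms l by (intro smooth_on_add smooth_on_bounded_linear_compose[of "\<lambda>u. (u, 0)"]
        smooth_on_bounded_linear_compose[of "\<lambda>v. (0, v)"]) auto
  then show ?thesis by simp
qed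

lemma smooth_on_inner_self:
  fixes c :: "'a::finite_dim_inner"
  assumes "open S"
  shows "smooth_on S (\<lambda>x. (x - c) \<bullet> (x - c))"
proof -
  have exp: "(x - c) \<bullet> (x - c) = (\<Sum>b\<in>onb. (x \<bullet> b + (- (c \<bullet> b))) * ((x \<bullet> b) + (- (c \<bullet> b))))" for x
  proof -
    have "(x - c) \<bullet> (x - c) = (\<Sum>b\<in>onb. ((x - c) \<bullet> b) *\<^sub>R b) \<bullet> (x - c)"
      by (simp add: onb_expansion)
    also have "\<dots> = (\<Sum>b\<in>onb. ((x - c) \<bullet> b) * ((x - c) \<bullet> b))"
      by (simp add: inner_sum_left inner_commute[of "x - c"])
    finally show ?thesis by (simp add: inner_diff_left)
  qed
  have "Ck_on k S (\<lambda>x. \<Sum>b\<in>onb. (x \<bullet> b + (- (c \<bullet> b))) * ((x \<bullet> b) + (- (c \<bullet> b))))" for k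
    using assms by (intro Ck_on_sum Ck_on_mult Ck_on_add Ck_on_const
        Ck_on_bounded_linear[OF bounded_linear_inner_left]) auto
  then show ?thesis unfolding exp smooth_on_def by blast
qed

subsection \<open>Bump functions\<close>

text \<open>
  The exponent \<open>n\<close> makes the family closed under differentiation up to linear combinations, so
  that all derivatives of \<open>exp (-1/t)\<close> are handled by a single induction.
\<close>

definition flat_exp :: "nat \<Rightarrow> real \<Rightarrow> real" where
  "flat_exp n t = (if t > 0 then exp (- (1 / t)) / t ^ n else 0)"

lemma flat_exp_tendsto_0: "(flat_exp n \<longlongrightarrow> 0) (at 0)"
proof -
  have "((\<lambda>t. (inverse t) ^ n / exp (inverse t)) \<longlongrightarrow> 0) (at_right (0::real))"
    using filterlim_compose[OF tendsto_power_div_exp_0 filterlim_inverse_at_top_right] .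
  then have "(flat_exp n \<longlongrightarrow> 0) (at_right 0)"
    by (rule Lim_transform_eventually)
      (auto simp: eventually_at_right_field flat_exp_def exp_minus field_simps intro: exI[of _ 1])
  moreover have "(flat_exp n \<longlongrightarrow> 0) (at_left 0)"
    by (rule Lim_transform_eventually[of "\<lambda>_. 0"])
      (auto simp: eventually_at_left_field flat_exp_def intro: exI[of _ "-1"])
  ultimately show ?thesis by (simp add: filterlim_split_at)
qed

lemma flat_exp_has_derivative:
  "(flat_exp n has_real_derivative (- real n) * flat_exp (Suc n) t + flat_exp (Suc (Suc n)) t) (at t)"
proof (cases t "0 :: real" rule: linorder_cases)
  case less
  have "(flat_exp n has_real_derivative 0) (at t)"
    by (rule has_field_derivative_transform_within_open[of "\<lambda>_. 0" 0 t "{..<0}"])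
      (use less in \<open>auto simp: flat_exp_def\<close>)
  then show ?thesis using less by (simp add: flat_exp_def)
next
  case equal
  have "((\<lambda>h. flat_exp (Suc n) h) \<longlongrightarrow> 0) (at 0)" by (rule flat_exp_tendsto_0)
  then have "((\<lambda>h. (flat_exp n (0 + h) - flat_exp n 0) / h) \<longlongrightarrow> 0) (at 0)"
    by (rule Lim_transform_eventually) (auto simp: flat_exp_def eventually_at_filter)
  then have "(flat_exp n has_real_derivative 0) (at 0)"
    by (simp add: DERIV_def)
  then show ?thesis using equal by (simp add: flat_exp_def)
next
  case greater
  have "((\<lambda>t. exp (- (1 / t)) / t ^ n) has_real_derivative
      (- real n) * flat_exp (Suc n) t + flat_exp (Suc (Suc n)) t) (at t)"
  proof -
    have "((\<lambda>t. t ^ n) has_real_derivative real n * t ^ n / t) (at t)"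
      using greater by (intro DERIV_cong[OF DERIV_pow]) (cases n; simp)
    moreover have "((\<lambda>t. exp (- (1 / t))) has_real_derivative exp (- (1 / t)) / t\<^sup>2) (at t)"
      using greater by (auto intro!: derivative_eq_intros simp: power2_eq_square)
    ultimately show ?thesis
      using greater
      by (intro DERIV_cong[OF DERIV_divide]) (auto simp: flat_exp_def field_simps power2_eq_square)
  qed
  then show ?thesis
    by (rule has_field_derivative_transform_within_open[where S="{0<..}"])
      (use greater in \<open>auto simp: flat_exp_def\<close>)
qed

lemma smooth_on_flat_exp: "smooth_on UNIV (flat_exp n)"
proof -
  have "Ck_on k UNIV (flat_exp n)" for k
  proof (induction k arbitrary: n)
    case 0
    show ?case
      using flat_exp_has_derivative[THEN DERIV_isCont] by (simp add: continuous_at_imp_continuous_on)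
  next
    case (Suc k)
    show ?case
    proof (rule Ck_on_SucI)
      show "(flat_exp n has_derivative
          (\<lambda>v. ((- real n) * flat_exp (Suc n) t + flat_exp (Suc (Suc n)) t) * v)) (at t)" for t
        using flat_exp_has_derivative[of n t] by (simp add: has_field_derivative_def)
      show "Ck_on k UNIV (\<lambda>t. ((- real n) * flat_exp (Suc n) t + flat_exp (Suc (Suc n)) t) * v)" for v
        by (intro Ck_on_add Ck_on_mult Suc Ck_on_const open_UNIV)
    qed simp
  qed
  then show ?thesis by (simp add: smooth_on_def)
qed

definition bump :: "'a::finite_dim_inner \<Rightarrow> real \<Rightarrow> 'a \<Rightarrow> real" where
  "bump c r x = flat_exp 0 (r\<^sup>2 - (x - c) \<bullet> (x - c))"

lemma smooth_on_bump: "open S \<Longrightarrow> smooth_on S (bump c r)"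
proof -
  assume S: "open S"
  have "smooth_on S (\<lambda>x. r\<^sup>2 + (- 1) * ((x - c) \<bullet> (x - c)))"
    by (intro smooth_on_add smooth_on_mult smooth_on_const smooth_on_inner_self S)
  then have "smooth_on S (\<lambda>x. flat_exp 0 (r\<^sup>2 + (- 1) * ((x - c) \<bullet> (x - c))))"
    using smooth_on_compose[OF _ smooth_on_flat_exp S open_UNIV] by blast
  then show ?thesis
    by (simp add: bump_def[abs_def])
qed

lemma bump_center: "r > 0 \<Longrightarrow> bump c r c > 0"
  by (simp add: bump_def flat_exp_def)

lemma bump_eq_0:
  assumes "r > 0" "x \<notin> ball c r"
  shows "bump c r x = 0"
proof -
  have "r \<le> norm (x - c)" using assms by (simp add: dist_norm norm_minus_commute)
  then have "r\<^sup>2 \<le> (x - c) \<bullet> (x - c)"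
    using assms(1) by (metis dot_square_norm power_mono less_imp_le)
  then show ?thesis by (simp add: bump_def flat_exp_def)
qed

section \<open>Smooth local sections of submersions between open sets\<close>

lemma Ck_on_det:
  fixes A :: "'a::real_normed_vector \<Rightarrow> real^'n^'n"
  assumes "open S" "\<And>i j. Ck_on k S (\<lambda>x. A x $ i $ j)"
  shows "Ck_on k S (\<lambda>x. det (A x))"
  unfolding det_def
  by (intro Ck_on_sum Ck_on_mult Ck_on_prod Ck_on_const assms)

lemma Ck_on_vec:
  fixes f :: "'a::real_normed_vector \<Rightarrow> real^'n"
  assumes "open S" "\<And>i. Ck_on k S (\<lambda>x. f x $ i)"
  shows "Ck_on k S f"
proof -
  have eq: "f = (\<lambda>x. \<Sum>i\<in>UNIV. (f x $ i) *\<^sub>R axis i 1)"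
    by (simp add: fun_eq_iff vec_eq_iff axis_def if_distrib[of "\<lambda>z. _ * z"] cong: if_cong)
  show ?thesis
    by (subst eq) (intro Ck_on_sum Ck_on_scaleR Ck_on_const assms)
qed

text \<open>
  The \<open>C\<^sup>1\<close> inverse function theorem provides a differentiable inverse \<open>g\<close> whose derivative at
  \<open>y\<close> is the inverse matrix of \<open>Df(g y)\<close>. By Cramer's rule its entries are rational functions of
  those of \<open>Df(g y)\<close>, so \<open>g \<in> C\<^sup>k\<close> implies \<open>Dg \<in> C\<^sup>k\<close>.
\<close>

lemma smooth_inverse_function:
  fixes f :: "real^'n \<Rightarrow> real^'n"
  assumes U: "open U" "x0 \<in> U" and f: "smooth_on U f"
    and id: "\<And>v. frechet_derivative f (at x0) v = v"
  obtains V g where "open V" "f x0 \<in> V" "g (f x0) = x0" "g ` V \<subseteq> U" "\<And>y. y \<in> V \<Longrightarrow> f (g y) = y"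
    "smooth_on V g"
proof -
  define f' where "f' x = Blinfun (frechet_derivative f (at x))" for x
  have f': "blinfun_apply (f' x) = frechet_derivative f (at x)" if "x \<in> U" for x
    unfolding f'_def
    using smooth_on_has_derivative[OF f that]
    by (intro bounded_linear_Blinfun_apply) (rule has_derivative_bounded_linear)
  have Ckf': "Ck_on k U (\<lambda>x. blinfun_apply (f' x) v)" for k v
  proof (rule Ck_on_cong[OF U(1)])
    show "Ck_on k U (\<lambda>x. frechet_derivative f (at x) v)"
      using f unfolding smooth_on_def by (metis Ck_on.simps(2))
  qed (simp add: f')
  have "continuous_on U f'"
    by (rule continuous_on_blinfun_componentwise) (use Ckf'[of 0] in simp)
  moreover have "id_blinfun o\<^sub>L f' x0 = id_blinfun"
    using id U by (intro blinfun_eqI) (simp add: f')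
  ultimately obtain U' V g g' where I: "open U'" "U' \<subseteq> U" "x0 \<in> U'" "open V" "f x0 \<in> V"
    "homeomorphism U' V f g" "\<And>y. y \<in> V \<Longrightarrow> (g has_derivative (g' y)) (at y)"
    "\<And>y. y \<in> V \<Longrightarrow> g' y = inv_into UNIV (blinfun_apply (f' (g y)))"
    "\<And>y. y \<in> V \<Longrightarrow> bij (blinfun_apply (f' (g y)))"
    using inverse_function_theorem[OF U(1) _ _ U(2), of f f' id_blinfun] f'
      smooth_on_has_derivative[OF f] by metis
  have gV: "g y \<in> U" "f (g y) = y" if "y \<in> V" for y
    using I(2,6) that by (auto simp: homeomorphism_def)
  have "Ck_on k V g" for k
  proof (induction k)
    case 0
    show ?case using I(6) by (simp add: homeomorphism_def)
  next
    case (Suc k)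
    show ?case
    proof (rule Ck_on_SucI[OF \<open>open V\<close> I(7)])
      fix v :: "real^'n"
      define A where "A y = matrix (blinfun_apply (f' (g y)))" for y
      have A: "Ck_on k V (\<lambda>y. A y $ i $ j)" for i j
      proof -
        have "Ck_on k V (\<lambda>y. blinfun_apply (f' (g y)) (axis j 1))"
          using gV by (intro Ck_on_compose[OF \<open>open V\<close> U(1) _ Suc Ckf']) auto
        then have "Ck_on k V (\<lambda>y. blinfun_apply (f' (g y)) (axis j 1) $ i)"
          by (rule Ck_on_bounded_linear_compose[OF bounded_linear_vec_nth \<open>open V\<close>])
        then show ?thesis by (simp add: A_def matrix_def)
      qed
      have Av: "A y *v w = blinfun_apply (f' (g y)) w" for y w
        unfolding A_def
        by (simp add: matrix_works linear_matrix_vector_mul_eq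
            bounded_linear.linear[OF blinfun.bounded_linear_right])
      have det: "det (A y) \<noteq> 0" if "y \<in> V" for y
        unfolding A_def using I(9)[OF that]
        by (intro det_nz_iff_inj[THEN iffD2] bij_is_inj
            bounded_linear.linear[OF blinfun.bounded_linear_right])
      \<comment> \<open>Cramer's rule expresses the inverse of the derivative rationally in its entries.\<close>
      define D where "D y = (\<chi> k. det (\<chi> i j. if j = k then v $ i else A y $ i $ j) / det (A y))" for y
      have "g' y v = D y" if "y \<in> V" for y
      proof -
        have "A y *v g' y v = v"
          using I(8,9)[OF that] by (simp add: Av bij_is_surj surj_f_inv_f)
        then show ?thesis using cramer[OF det[OF that]] unfolding D_def by blast
      qed
      moreover have "Ck_on k V D"
      proof (rule Ck_on_vec[OF \<open>open V\<close>])
        have "Ck_on k V (\<lambda>y. det (\<chi> i j. if j = l then v $ i else A y $ i $ j) / det (A y))" for l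
        proof (intro Ck_on_divide Ck_on_det \<open>open V\<close> A det)
          show "Ck_on k V (\<lambda>x. (\<chi> i j. if j = l then v $ i else A x $ i $ j) $ i $ j)" for i j
            using A \<open>open V\<close> by (cases "j = l") auto
        qed
        then show "Ck_on k V (\<lambda>y. D y $ i)" for i by (simp add: D_def)
      qed
      ultimately show "Ck_on k V (\<lambda>y. g' y v)"
        using Ck_on_cong[OF \<open>open V\<close>, of D] by metis
    qed
  qed
  then have "smooth_on V g" by (simp add: smooth_on_def)
  moreover have "g (f x0) = x0" using I(3,6) by (simp add: homeomorphism_def)
  ultimately show ?thesis using that[of V g] I(4,5) gV by blast
qed

text \<open>
  The index type of a vector in \<open>\<real>\<^sup>n\<close> is nonempty, but an orthonormal basis may be empty; hence
  the extra index \<open>0\<close>. It carries no coordinate, so \<open>of_coords\<close> is a left inverse of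
  \<open>to_coords\<close> and not a right inverse.
\<close>

typedef (overloaded) ('a::finite_dim_inner) onb_index = "insert 0 (onb :: 'a set)"
  by blast

instance onb_index :: (finite_dim_inner) finite
proof
  have "(UNIV :: 'a onb_index set) = Abs_onb_index ` insert 0 onb"
    by (metis Rep_onb_index Rep_onb_index_inverse UNIV_eq_I image_eqI)
  moreover have "finite (Abs_onb_index ` insert 0 (onb :: 'a set))" by (intro finite_imageI) simp
  ultimately show "finite (UNIV :: 'a onb_index set)" by (simp only:)
qed

definition to_coords :: "'a::finite_dim_inner \<Rightarrow> real ^ 'a onb_index" where
  "to_coords v = (\<chi> i. v \<bullet> Rep_onb_index i)"

definition of_coords :: "real ^ 'a onb_index \<Rightarrow> 'a::finite_dim_inner" where
  "of_coords w = (\<Sum>i\<in>UNIV. (w $ i) *\<^sub>R Rep_onb_index i)"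

lemma of_to_coords [simp]: "of_coords (to_coords v) = v"
proof -
  have "of_coords (to_coords v) = (\<Sum>b\<in>range Rep_onb_index. (v \<bullet> b) *\<^sub>R b)"
    unfolding of_coords_def to_coords_def
    by (subst sum.reindex) (auto simp: inj_on_def Rep_onb_index_inject)
  also have "range Rep_onb_index = insert 0 (onb :: 'a set)"
    using type_definition.Rep_range[OF type_definition_onb_index] .
  also have "(\<Sum>b\<in>insert 0 onb. (v \<bullet> b) *\<^sub>R b) = v"
    using onb_expansion[of v] by (cases "(0 :: 'a) \<in> onb") (auto simp: insert_absorb)
  finally show ?thesis .
qed

lemma bounded_linear_to_coords: "bounded_linear to_coords"
  by (rule linear_imp_bounded_linear)
    (auto intro!: linearI simp: to_coords_def vec_eq_iff inner_left_distrib)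

lemma bounded_linear_of_coords: "bounded_linear of_coords"
  by (rule linear_imp_bounded_linear)
    (auto intro!: linearI simp: of_coords_def scaleR_left_distrib sum.distrib scaleR_sum_right)

lemmas linear_of_coords = bounded_linear.linear[OF bounded_linear_of_coords]
  and linear_to_coords = bounded_linear.linear[OF bounded_linear_to_coords]

lemma compact_cball_finite_dim:
  fixes c :: "'a::finite_dim_inner"
  shows "compact (cball c r)"
proof -
  obtain M where M: "\<And>v :: 'a. norm (to_coords v) \<le> norm v * M"
    using bounded_linear.bounded[OF bounded_linear_to_coords] by blast
  have "cball (0 :: 'a) r \<subseteq> of_coords ` cball 0 (r * \<bar>M\<bar>)" if "r \<ge> 0"
  proof
    fix v :: 'a assume v: "v \<in> cball 0 r"
    have "norm (to_coords v) \<le> r * \<bar>M\<bar>"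
      using v that by (intro order_trans[OF M] order_trans[OF mult_left_mono mult_right_mono]) auto
    then show "v \<in> of_coords ` cball 0 (r * \<bar>M\<bar>)"
      by (intro image_eqI[of _ _ "to_coords v"]) auto
  qed
  moreover have "compact (of_coords ` cball 0 (r * \<bar>M\<bar>) :: 'a set)"
    by (intro compact_continuous_image linear_continuous_on bounded_linear_of_coords compact_cball)
  ultimately have "compact (cball (0 :: 'a) r)"
    by (metis closed_cball cball_empty compact_empty compact_Int_closed inf.absorb_iff2 not_le)
  then have "compact ((+) c ` cball 0 r)" by (rule compact_translation)
  then show ?thesis by (simp add: image_add_cball)
qed

text \<open>
  Let \<open>R\<close> be a linear right inverse of \<open>DP(a)\<close>. The map \<open>y \<mapsto> P (a + R y)\<close> has the identity as
  derivative at \<open>0\<close>, so it is invertible near \<open>0\<close>, and composing the inverse with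
  \<open>y \<mapsto> a + R y\<close> gives the section.
\<close>

lemma smooth_local_right_inverse:
  fixes P :: "'a::finite_dim_inner \<Rightarrow> 'b::finite_dim_inner"
  assumes N: "open N" "a \<in> N" and P: "smooth_on N P" and surj: "surj (frechet_derivative P (at a))"
  obtains W s where "open W" "P a \<in> W" "s (P a) = a" "s ` W \<subseteq> N" "\<And>y. y \<in> W \<Longrightarrow> P (s y) = y"
    "smooth_on W s"
proof -
  have der: "(P has_derivative frechet_derivative P (at a)) (at a)"
    by (rule smooth_on_has_derivative[OF P N(2)])
  then have lin: "linear (frechet_derivative P (at a))" by (rule has_derivative_linear)
  obtain R where R: "linear R" "frechet_derivative P (at a) \<circ> R = id"
    using linear_surj_right_inverse[OF lin, of UNIV UNIV] surj by (auto simp: fun_eq_iff)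
  have bR: "bounded_linear R" by (rule linear_imp_bounded_linear[OF R(1)])
  define q where "q w = a + R (of_coords w)" for w
  define U where "U = q -` N"
  have bq: "bounded_linear (\<lambda>w. R (of_coords w))"
    using bounded_linear_compose[OF bR bounded_linear_of_coords] .
  have smq: "smooth_on S q" if "open S" for S
    unfolding q_def by (intro smooth_on_add smooth_on_const smooth_on_bounded_linear[OF bq] that)
  then have "continuous_on UNIV q" by (intro smooth_on_imp_continuous_on) auto
  then have "open U" unfolding U_def using N(1) by (rule open_vimage[rotated])
  have q0: "q 0 = a" by (simp add: q_def linear_0[OF linear_of_coords] linear_0[OF R(1)])
  then have "0 \<in> U" using N(2) by (simp add: U_def)
  \<comment> \<open>With \<open>J = to_coords\<close> and \<open>C = of_coords\<close> this is \<open>w - J (C w) + J (P (a + R (C w)) - P a)\<close>: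
    the map above on the image of \<open>J\<close>, the identity on the kernel of \<open>C\<close>. As \<open>C (J v) = v\<close>,
    applying \<open>C\<close> to \<open>f w = J v\<close> recovers \<open>P (a + R (C w)) = P a + v\<close>.\<close>
  define f where "f w = w + ((- 1) *\<^sub>R to_coords (of_coords w) + to_coords ((P (q w) + (- P a))))" for w
  have smf: "smooth_on U f"
    unfolding f_def
  proof (intro smooth_on_add smooth_on_ident smooth_on_scaleR smooth_on_const \<open>open U\<close>
      smooth_on_bounded_linear_compose[OF bounded_linear_to_coords]
      smooth_on_bounded_linear[OF bounded_linear_of_coords])
    show "smooth_on U (\<lambda>w. P (q w))"
      by (rule smooth_on_compose[OF smq P]) (use \<open>open U\<close> N in \<open>auto simp: U_def\<close>)
  qed
  have "(f has_derivative (\<lambda>v. v + ((- 1) *\<^sub>R to_coords (of_coords v) +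
      to_coords (frechet_derivative P (at a) (R (of_coords v)) + 0)))) (at 0)"
    unfolding f_def
  proof (intro has_derivative_add has_derivative_ident has_derivative_scaleR_right
      bounded_linear.has_derivative[OF bounded_linear_to_coords] has_derivative_minus
      bounded_linear_imp_has_derivative[OF bounded_linear_of_coords] has_derivative_const)
    have "(q has_derivative (\<lambda>v. 0 + R (of_coords v))) (at 0)"
      unfolding q_def by (intro has_derivative_add has_derivative_const bounded_linear_imp_has_derivative[OF bq])
    then show "((\<lambda>w. P (q w)) has_derivative (\<lambda>v. frechet_derivative P (at a) (R (of_coords v)))) (at 0)"
      using has_derivative_compose[of q _ 0 UNIV P] der q0 by simp
  qed
  moreover have "frechet_derivative P (at a) (R v) = v" for v
    using R(2) by (metis comp_apply id_apply)
  ultimately have "(f has_derivative (\<lambda>v. v)) (at 0)" by simp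
  then have "frechet_derivative f (at 0) v = v" for v
    using frechet_derivative_at by metis
  then obtain V g where g: "open V" "f 0 \<in> V" "g (f 0) = 0" "g ` V \<subseteq> U"
      "\<And>y. y \<in> V \<Longrightarrow> f (g y) = y" "smooth_on V g"
    using smooth_inverse_function[OF \<open>open U\<close> \<open>0 \<in> U\<close> smf] by metis
  have f0: "f 0 = 0"
    by (simp add: f_def q0 linear_0[OF linear_of_coords] linear_0[OF linear_to_coords])
  define j where "j y = to_coords (y + (- P a))" for y
  have smj: "smooth_on S j" if "open S" for S
    unfolding j_def by (intro smooth_on_bounded_linear_compose[OF bounded_linear_to_coords]
        smooth_on_add smooth_on_ident smooth_on_const that)
  define W where "W = j -` V"
  have "continuous_on UNIV j" using smj by (intro smooth_on_imp_continuous_on) auto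
  then have "open W" unfolding W_def using g(1) by (rule open_vimage[rotated])
  have jP: "j (P a) = 0" by (simp add: j_def linear_0[OF linear_to_coords])
  show thesis
  proof (rule that[of W "\<lambda>y. q (g (j y))"])
    show "P a \<in> W" using g(2) f0 jP by (simp add: W_def)
    show "q (g (j (P a))) = a" using g(3) f0 jP q0 by simp
    show "(\<lambda>y. q (g (j y))) ` W \<subseteq> N" using g(4) by (auto simp: W_def U_def)
    show "P (q (g (j y))) = y" if "y \<in> W" for y
    proof -
      have "f (g (j y)) = j y" using g(5) that by (simp add: W_def)
      then have "of_coords (f (g (j y))) = y - P a" by (simp add: j_def)
      then show ?thesis
        by (simp add: f_def linear_add[OF linear_of_coords] linear_diff[OF linear_of_coords])
    qed
    show "smooth_on W (\<lambda>y. q (g (j y)))"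
      by (rule smooth_on_compose[OF _ smq[OF open_UNIV]], rule smooth_on_compose[OF smj g(6)])
        (use \<open>open W\<close> g(1) in \<open>auto simp: W_def\<close>)
  qed (rule \<open>open W\<close>)
qed

section \<open>Smooth maps of manifolds, pointwise\<close>

text \<open>
  Smoothness near a point in a given pair of charts, including that \<open>F\<close> stays in the second chart
  there. Unlike \<^const>\<open>smooth_map\<close>, the pointwise notion can be restricted, glued and composed
  locally.
\<close>

definition smooth_in ::
  "'a set \<Rightarrow> ('a \<Rightarrow> 'e::real_normed_vector) \<Rightarrow> 'b set \<Rightarrow> ('b \<Rightarrow> 'f::real_normed_vector) \<Rightarrow> ('a \<Rightarrow> 'b) \<Rightarrow> 'a \<Rightarrow> bool"
  where "smooth_in U \<phi> V \<psi> F x \<longleftrightarrow> (\<exists>N. open N \<and> \<phi> x \<in> N \<and> N \<subseteq> \<phi> ` U \<and>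
    (\<forall>a\<in>N. F (inv_into U \<phi> a) \<in> V) \<and> smooth_on N (\<lambda>a. \<psi> (F (inv_into U \<phi> a))))"

definition smooth_at ::
  "('a, 'e::real_normed_vector) chart set \<Rightarrow> ('b, 'f::real_normed_vector) chart set \<Rightarrow> ('a \<Rightarrow> 'b) \<Rightarrow> 'a \<Rightarrow> bool"
  where "smooth_at A B F x \<longleftrightarrow>
    (\<exists>(U, \<phi>)\<in>A. \<exists>(V, \<psi>)\<in>B. x \<in> U \<and> F x \<in> V \<and> smooth_in U \<phi> V \<psi> F x)"

lemma smooth_atlasD:
  assumes "smooth_atlas A" "(U, \<phi>) \<in> A"
  shows "inj_on \<phi> U" "open (\<phi> ` U)"
  using assms by (auto simp: smooth_atlas_def)

lemma smooth_atlas_transition: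
  assumes "smooth_atlas A" "(U, \<phi>) \<in> A" "(V, \<psi>) \<in> A"
  shows "open (\<phi> ` (U \<inter> V))" "smooth_on (\<phi> ` (U \<inter> V)) (\<lambda>a. \<psi> (inv_into U \<phi> a))"
  using assms by (fastforce simp: smooth_atlas_def comp_def)+

lemma points_obtain_chart:
  assumes "x \<in> points A" obtains U \<phi> where "(U, \<phi>) \<in> A" "x \<in> U"
  using assms by (auto simp: points_def)

lemma chart_in_points: "(U, \<phi>) \<in> A \<Longrightarrow> x \<in> U \<Longrightarrow> x \<in> points A"
  by (auto simp: points_def)

lemma open_preimage_smooth:
  "smooth_on S f \<Longrightarrow> open S \<Longrightarrow> open T \<Longrightarrow> open {x \<in> S. f x \<in> T}"
  using continuous_open_preimage[OF smooth_on_imp_continuous_on]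
  by (metis Collect_conj_eq Collect_mem_eq vimage_def)

text \<open>
  Near \<open>x\<close> the new coordinate expression is the old one composed with a transition map on either
  side; \<open>M\<close> and \<open>N'\<close> are the open sets on which the inner and the outer transition are defined.
\<close>

lemma smooth_in_change:
  fixes A :: "('a, 'e::finite_dim_inner) chart set" and B :: "('b, 'f::finite_dim_inner) chart set"
  assumes A: "smooth_atlas A" "(U, \<phi>) \<in> A" "(U', \<phi>') \<in> A" and B: "smooth_atlas B" "(V, \<psi>) \<in> B" "(V', \<psi>') \<in> B"
    and x: "x \<in> U" "x \<in> U'" "F x \<in> V'" and F: "smooth_in U \<phi> V \<psi> F x"
  shows "smooth_in U' \<phi>' V' \<psi>' F x"
proof -
  obtain N where N: "open N" "\<phi> x \<in> N" "N \<subseteq> \<phi> ` U" "\<And>a. a \<in> N \<Longrightarrow> F (inv_into U \<phi> a) \<in> V"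
    "smooth_on N (\<lambda>a. \<psi> (F (inv_into U \<phi> a)))"
    using F unfolding smooth_in_def by blast
  define t where "t a = \<phi> (inv_into U' \<phi>' a)" for a
  note inj = smooth_atlasD(1)[OF A(1,2)] smooth_atlasD(1)[OF A(1,3)]
    smooth_atlasD(1)[OF B(1,2)] smooth_atlasD(1)[OF B(1,3)]
  note T = smooth_atlas_transition[OF A(1,3,2), folded t_def] and T' = smooth_atlas_transition[OF B]
  define M where "M = {a \<in> \<phi>' ` (U' \<inter> U). t a \<in> N}"
  have M: "open M" unfolding M_def by (rule open_preimage_smooth[OF T(2,1) N(1)])
  have smM: "smooth_on M (\<lambda>a. \<psi> (F (inv_into U \<phi> (t a))))"
    by (rule smooth_on_compose[OF smooth_on_subset[OF T(2)] N(5) M N(1)]) (auto simp: M_def)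
  have inv_t: "inv_into U \<phi> (t a) = inv_into U' \<phi>' a \<and> inv_into U' \<phi>' a \<in> U \<inter> U'" if "a \<in> M" for a
    using that inj by (auto simp: M_def t_def)
  define N' where "N' = {a \<in> M. \<psi> (F (inv_into U \<phi> (t a))) \<in> \<psi> ` (V \<inter> V')}"
  have N': "open N'" unfolding N'_def by (rule open_preimage_smooth[OF smM M T'(1)])
  have sub: "N' \<subseteq> M" by (auto simp: N'_def)
  have FV: "F (inv_into U' \<phi>' a) \<in> V \<inter> V'" if "a \<in> N'" for a
  proof -
    have "F (inv_into U \<phi> (t a)) \<in> V" using that N(4) by (auto simp: N'_def M_def)
    moreover have "\<psi> (F (inv_into U \<phi> (t a))) \<in> \<psi> ` (V \<inter> V')"
      using that unfolding N'_def by blast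
    then obtain v where "v \<in> V \<inter> V'" "\<psi> (F (inv_into U \<phi> (t a))) = \<psi> v"
      by blast
    ultimately have "F (inv_into U \<phi> (t a)) \<in> V \<inter> V'" using inj(3) by (metis IntD1 inj_on_def)
    then show ?thesis using inv_t that sub by auto
  qed
  have "smooth_on N' (\<lambda>a. \<psi>' (inv_into V \<psi> (\<psi> (F (inv_into U \<phi> (t a))))))"
    by (rule smooth_on_compose[OF smooth_on_subset[OF smM sub] T'(2) N' T'(1)]) (auto simp: N'_def)
  then have "smooth_on N' (\<lambda>a. \<psi>' (F (inv_into U' \<phi>' a)))"
  proof (rule smooth_on_cong[OF _ N'])
    fix a assume a: "a \<in> N'"
    have "inv_into U \<phi> (t a) = inv_into U' \<phi>' a" using a sub inv_t by blast
    then show "\<psi>' (inv_into V \<psi> (\<psi> (F (inv_into U \<phi> (t a))))) = \<psi>' (F (inv_into U' \<phi>' a))"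
      using FV[OF a] inj(3) by simp
  qed
  moreover have "\<phi>' x \<in> N'"
  proof -
    have x': "inv_into U' \<phi>' (\<phi>' x) = x" "inv_into U \<phi> (\<phi> x) = x" using x inj by auto
    then have "F x \<in> V" using N(2,4) by metis
    then show ?thesis using x x' N(2) by (auto simp: N'_def M_def t_def)
  qed
  moreover have "N' \<subseteq> \<phi>' ` U'" by (auto simp: N'_def M_def)
  ultimately show ?thesis unfolding smooth_in_def using N' FV by blast
qed

lemma smooth_atD:
  fixes A :: "('a, 'e::finite_dim_inner) chart set" and B :: "('b, 'f::finite_dim_inner) chart set"
  assumes "smooth_at A B F x" "smooth_atlas A" "smooth_atlas B" "(U, \<phi>) \<in> A" "(V, \<psi>) \<in> B" "x \<in> U" "F x \<in> V"
  shows "smooth_in U \<phi> V \<psi> F x"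
  using assms smooth_in_change[of A _ _ U \<phi> B _ _ V \<psi> x F] unfolding smooth_at_def by blast

lemma smooth_atI:
  assumes "(U, \<phi>) \<in> A" "(V, \<psi>) \<in> B" "x \<in> U" "F x \<in> V" "smooth_in U \<phi> V \<psi> F x"
  shows "smooth_at A B F x"
  using assms unfolding smooth_at_def by blast

lemma smooth_atE:
  assumes "smooth_at A B F x"
  obtains U \<phi> V \<psi> N where "(U, \<phi>) \<in> A" "(V, \<psi>) \<in> B" "x \<in> U" "F x \<in> V"
    "open N" "\<phi> x \<in> N" "N \<subseteq> \<phi> ` U" "\<forall>a\<in>N. F (inv_into U \<phi> a) \<in> V"
    "smooth_on N (\<lambda>a. \<psi> (F (inv_into U \<phi> a)))"
  using assms unfolding smooth_at_def smooth_in_def by blast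

text \<open>
  The openness required by \<^const>\<open>smooth_map\<close> holds because each point of \<open>\<phi> ` (U \<inter> F -` V)\<close>
  has the neighbourhood \<open>N\<close> from \<^const>\<open>smooth_in\<close>, which lies in that set.
\<close>

lemma smooth_map_iff:
  fixes A :: "('a, 'e::finite_dim_inner) chart set" and B :: "('b, 'f::finite_dim_inner) chart set"
  assumes A: "smooth_atlas A" and B: "smooth_atlas B"
  shows "smooth_map A B F \<longleftrightarrow> F \<in> points A \<rightarrow> points B \<and> (\<forall>x\<in>points A. smooth_at A B F x)"
proof (intro iffI conjI ballI)
  assume F: "smooth_map A B F"
  then show Fp: "F \<in> points A \<rightarrow> points B" by (simp add: smooth_map_def)
  fix x assume x: "x \<in> points A"
  obtain U \<phi> where U: "(U, \<phi>) \<in> A" "x \<in> U" using x by (rule points_obtain_chart)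
  obtain V \<psi> where V: "(V, \<psi>) \<in> B" "F x \<in> V" using x Fp by (meson points_obtain_chart PiE)
  have "open (\<phi> ` (U \<inter> F -` V))" "smooth_on (\<phi> ` (U \<inter> F -` V)) (\<lambda>a. \<psi> (F (inv_into U \<phi> a)))"
    using F U V by (fastforce simp: smooth_map_def comp_def)+
  then have "smooth_in U \<phi> V \<psi> F x"
    using U V smooth_atlasD(1)[OF A U(1)] unfolding smooth_in_def
    by (intro exI[of _ "\<phi> ` (U \<inter> F -` V)"]) auto
  then show "smooth_at A B F x" by (rule smooth_atI[where U=U and \<phi>=\<phi> and V=V and \<psi>=\<psi>, rotated -1]) (use U V in auto)
next
  assume F: "F \<in> points A \<rightarrow> points B \<and> (\<forall>x\<in>points A. smooth_at A B F x)"
  have loc: "\<exists>N. open N \<and> \<phi> x \<in> N \<and> N \<subseteq> \<phi> ` (U \<inter> F -` V) \<and> smooth_on N (\<psi> \<circ> F \<circ> inv_into U \<phi>)"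
    if UV: "(U, \<phi>) \<in> A" "(V, \<psi>) \<in> B" and x: "x \<in> U \<inter> F -` V" for U \<phi> V \<psi> x
  proof -
    have "smooth_in U \<phi> V \<psi> F x"
      using F UV x chart_in_points[OF UV(1)] by (intro smooth_atD[OF _ A B UV]) auto
    then obtain N where N: "open N" "\<phi> x \<in> N" "N \<subseteq> \<phi> ` U" "\<forall>a\<in>N. F (inv_into U \<phi> a) \<in> V"
      "smooth_on N (\<lambda>a. \<psi> (F (inv_into U \<phi> a)))"
      unfolding smooth_in_def by blast
    have "N \<subseteq> \<phi> ` (U \<inter> F -` V)"
    proof
      fix a assume a: "a \<in> N"
      then have "\<phi> (inv_into U \<phi> a) = a" "inv_into U \<phi> a \<in> U"
        using N(3) by (auto simp: f_inv_into_f inv_into_into)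
      then show "a \<in> \<phi> ` (U \<inter> F -` V)" using N(4) a by (metis IntI image_eqI vimageI)
    qed
    then show ?thesis using N by (auto simp: comp_def)
  qed
  have "open (\<phi> ` (U \<inter> F -` V)) \<and> smooth_on (\<phi> ` (U \<inter> F -` V)) (\<psi> \<circ> F \<circ> inv_into U \<phi>)"
    if UV: "(U, \<phi>) \<in> A" "(V, \<psi>) \<in> B" for U \<phi> V \<psi>
  proof
    show "open (\<phi> ` (U \<inter> F -` V))"
      by (subst open_subopen) (use loc[OF UV] in blast)
    show "smooth_on (\<phi> ` (U \<inter> F -` V)) (\<psi> \<circ> F \<circ> inv_into U \<phi>)"
      by (rule smooth_on_local) (use loc[OF UV] in blast)
  qed
  then show "smooth_map A B F" using F unfolding smooth_map_def by blast
qed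

lemma smooth_at_compose:
  fixes A :: "('a, 'e::finite_dim_inner) chart set" and B :: "('b, 'f::finite_dim_inner) chart set"
    and C :: "('c, 'g::finite_dim_inner) chart set"
  assumes F: "smooth_at A B F x" and H: "smooth_at B C H (F x)"
    and at: "smooth_atlas A" "smooth_atlas B" "smooth_atlas C"
  shows "smooth_at A C (\<lambda>x. H (F x)) x"
proof -
  obtain U \<phi> V \<psi> N where UV: "(U, \<phi>) \<in> A" "(V, \<psi>) \<in> B" "x \<in> U" "F x \<in> V"
    and N: "open N" "\<phi> x \<in> N" "N \<subseteq> \<phi> ` U" "\<forall>a\<in>N. F (inv_into U \<phi> a) \<in> V"
      "smooth_on N (\<lambda>a. \<psi> (F (inv_into U \<phi> a)))"
    using F by (rule smooth_atE)
  obtain W \<xi> where W: "(W, \<xi>) \<in> C" "H (F x) \<in> W" using H unfolding smooth_at_def by blast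
  have "smooth_in V \<psi> W \<xi> H (F x)" by (rule smooth_atD[OF H at(2,3) UV(2) W(1) UV(4) W(2)])
  then obtain M where M: "open M" "\<psi> (F x) \<in> M" "M \<subseteq> \<psi> ` V" "\<forall>a\<in>M. H (inv_into V \<psi> a) \<in> W"
    "smooth_on M (\<lambda>a. \<xi> (H (inv_into V \<psi> a)))"
    unfolding smooth_in_def by blast
  define N' where "N' = {a \<in> N. \<psi> (F (inv_into U \<phi> a)) \<in> M}"
  have N': "open N'" unfolding N'_def by (rule open_preimage_smooth[OF N(5,1) M(1)])
  have sub: "N' \<subseteq> N" by (auto simp: N'_def)
  have inv: "inv_into V \<psi> (\<psi> (F (inv_into U \<phi> a))) = F (inv_into U \<phi> a)" if "a \<in> N" for a
    using N(4) that smooth_atlasD(1)[OF at(2) UV(2)] by simp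
  have "smooth_on N' (\<lambda>a. \<xi> (H (inv_into V \<psi> (\<psi> (F (inv_into U \<phi> a))))))"
    by (rule smooth_on_compose[OF smooth_on_subset[OF N(5) sub] M(5) N' M(1)]) (auto simp: N'_def)
  then have "smooth_on N' (\<lambda>a. \<xi> (H (F (inv_into U \<phi> a))))"
    by (rule smooth_on_cong[OF _ N']) (use inv sub in auto)
  moreover have "\<phi> x \<in> N'"
    using N(2) M(2) smooth_atlasD(1)[OF at(1) UV(1)] UV(3) by (simp add: N'_def)
  moreover have "H (F (inv_into U \<phi> a)) \<in> W" if "a \<in> N'" for a
    using M(4) inv[of a] that by (metis (mono_tags, lifting) N'_def mem_Collect_eq)
  ultimately have "smooth_in U \<phi> W \<xi> (\<lambda>x. H (F x)) x"
    unfolding smooth_in_def using N' N(3) sub by (intro exI[of _ N']) auto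
  then show ?thesis by (rule smooth_atI[where F="\<lambda>x. H (F x)", OF UV(1) W(1) UV(3) W(2)])
qed

subsection \<open>The manifold topology\<close>

abbreviation open_in :: "('a, 'e::real_normed_vector) chart set \<Rightarrow> 'a set \<Rightarrow> bool" where
  "open_in A \<equiv> openin (atlas_topology A)"

lemma open_chart_image:
  assumes "smooth_atlas A" "open_in A W" "(U, \<phi>) \<in> A"
  shows "open (\<phi> ` (W \<inter> U))"
  using assms by (auto simp: openin_atlas_topology)

lemma openin_atlas_subset:
  assumes "smooth_atlas A" "open_in A W"
  shows "W \<subseteq> points A"
  using assms by (simp add: openin_atlas_topology)

text \<open>
  A single chart per point decides openness, since the transition maps are continuous.
\<close>

lemma openin_atlas_iff:
  fixes A :: "('a, 'e::finite_dim_inner) chart set"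
  assumes A: "smooth_atlas A"
  shows "open_in A W \<longleftrightarrow> W \<subseteq> points A \<and> (\<forall>x\<in>W. \<exists>U \<phi> N. (U, \<phi>) \<in> A \<and> x \<in> U \<and>
    open N \<and> \<phi> x \<in> N \<and> N \<subseteq> \<phi> ` U \<and> inv_into U \<phi> ` N \<subseteq> W)"
    (is "_ \<longleftrightarrow> _ \<and> (\<forall>x\<in>W. ?P x)")
proof (intro iffI conjI ballI)
  assume W: "open_in A W"
  show sub: "W \<subseteq> points A" using W by (simp add: openin_atlas_topology[OF A])
  fix x assume x: "x \<in> W"
  then obtain U \<phi> where U: "(U, \<phi>) \<in> A" "x \<in> U" using sub by (meson points_obtain_chart subsetD)
  have "open (\<phi> ` (W \<inter> U))" by (rule open_chart_image[OF A W U(1)])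
  then show "?P x"
    using U x smooth_atlasD(1)[OF A U(1)]
    by (intro exI[of _ U] exI[of _ \<phi>] exI[of _ "\<phi> ` (W \<inter> U)"]) auto
next
  assume W: "W \<subseteq> points A \<and> (\<forall>x\<in>W. ?P x)"
  have "open (\<phi>' ` (W \<inter> U'))" if U': "(U', \<phi>') \<in> A" for U' \<phi>'
  proof (subst open_subopen, intro ballI)
    fix b assume "b \<in> \<phi>' ` (W \<inter> U')"
    then obtain x where x: "x \<in> W" "x \<in> U'" "b = \<phi>' x" by blast
    obtain U \<phi> N where U: "(U, \<phi>) \<in> A" "x \<in> U" "open N" "\<phi> x \<in> N" "N \<subseteq> \<phi> ` U" "inv_into U \<phi> ` N \<subseteq> W"
      using W x(1) by meson
    note T = smooth_atlas_transition[OF A U' U(1)]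
    note inj = smooth_atlasD(1)[OF A U'] smooth_atlasD(1)[OF A U(1)]
    let ?N = "{a \<in> \<phi>' ` (U' \<inter> U). \<phi> (inv_into U' \<phi>' a) \<in> N}"
    have "open ?N" by (rule open_preimage_smooth[OF T(2,1) U(3)])
    moreover have "b \<in> ?N" using x U inj by auto
    moreover have "?N \<subseteq> \<phi>' ` (W \<inter> U')"
    proof
      fix a assume "a \<in> ?N"
      then obtain z where z: "z \<in> U'" "z \<in> U" "a = \<phi>' z" "\<phi> z \<in> N" using inj by auto
      then have "z \<in> W" using U(6) inj by (metis image_subset_iff inv_into_f_f)
      then show "a \<in> \<phi>' ` (W \<inter> U')" using z by blast
    qed
    ultimately show "\<exists>T. open T \<and> b \<in> T \<and> T \<subseteq> \<phi>' ` (W \<inter> U')" by blast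
  qed
  then show "open_in A W" using W by (auto simp: openin_atlas_topology[OF A])
qed

lemma topspace_atlas_topology [simp]:
  fixes A :: "('a, 'e::finite_dim_inner) chart set"
  assumes A: "smooth_atlas A"
  shows "topspace (atlas_topology A) = points A"
proof -
  have "open_in A (points A)"
    using smooth_atlas_transition(1)[OF A] chart_in_points points_obtain_chart
  proof -
    have "open (\<phi> ` (points A \<inter> U))" if "(U, \<phi>) \<in> A" for U \<phi>
    proof -
      have "points A \<inter> U = U" using that chart_in_points[OF that] by blast
      then show ?thesis using smooth_atlasD(2)[OF A that] by simp
    qed
    then show ?thesis by (auto simp: openin_atlas_topology[OF A])
  qed
  then show ?thesis
    by (metis (no_types, lifting) A openin_atlas_topology openin_subset openin_topspace subset_antisym)
qed

lemma openin_chart_image: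
  fixes A :: "('a, 'e::finite_dim_inner) chart set"
  assumes A: "smooth_atlas A" "(U, \<phi>) \<in> A" and N: "open N" "N \<subseteq> \<phi> ` U"
  shows "open_in A (inv_into U \<phi> ` N)"
  unfolding openin_atlas_iff[OF A(1)]
proof (intro conjI ballI)
  have im: "inv_into U \<phi> a \<in> U" "\<phi> (inv_into U \<phi> a) = a" if "a \<in> N" for a
    using that N(2) by (auto simp: f_inv_into_f inv_into_into)
  then show "inv_into U \<phi> ` N \<subseteq> points A" using chart_in_points[OF A(2)] by auto
  show "\<exists>U' \<phi>' N'. (U', \<phi>') \<in> A \<and> x \<in> U' \<and> open N' \<and> \<phi>' x \<in> N' \<and> N' \<subseteq> \<phi>' ` U' \<and>
    inv_into U' \<phi>' ` N' \<subseteq> inv_into U \<phi> ` N" if "x \<in> inv_into U \<phi> ` N" for x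
    using that im A(2) N by (intro exI[of _ U] exI[of _ \<phi>] exI[of _ N]) auto
qed

lemma openin_chart:
  fixes A :: "('a, 'e::finite_dim_inner) chart set"
  assumes A: "smooth_atlas A" "(U, \<phi>) \<in> A"
  shows "open_in A U"
proof -
  have "inv_into U \<phi> ` (\<phi> ` U) = U" using smooth_atlasD(1)[OF A] by (simp add: image_image)
  then show ?thesis using openin_chart_image[OF A smooth_atlasD(2)[OF A] subset_refl] by simp
qed

lemma smooth_at_neighbourhood:
  fixes A :: "('a, 'e::finite_dim_inner) chart set" and B :: "('b, 'f::finite_dim_inner) chart set"
  assumes A: "smooth_atlas A" and B: "smooth_atlas B" and F: "smooth_at A B F x"
    and Z: "open_in B W" "F x \<in> W"
  obtains Z where "open_in A Z" "x \<in> Z" "\<And>y. y \<in> Z \<Longrightarrow> F y \<in> W"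
proof -
  obtain U \<phi> V \<psi> N where UV: "(U, \<phi>) \<in> A" "(V, \<psi>) \<in> B" "x \<in> U" "F x \<in> V"
    and N: "open N" "\<phi> x \<in> N" "N \<subseteq> \<phi> ` U" "\<forall>a\<in>N. F (inv_into U \<phi> a) \<in> V"
      "smooth_on N (\<lambda>a. \<psi> (F (inv_into U \<phi> a)))"
    using F by (rule smooth_atE)
  have oW: "open (\<psi> ` (W \<inter> V))" by (rule open_chart_image[OF B Z(1) UV(2)])
  define N' where "N' = {a \<in> N. \<psi> (F (inv_into U \<phi> a)) \<in> \<psi> ` (W \<inter> V)}"
  have N': "open N'" unfolding N'_def by (rule open_preimage_smooth[OF N(5,1) oW])
  have x: "inv_into U \<phi> (\<phi> x) = x" using UV smooth_atlasD(1)[OF A UV(1)] by simp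
  show ?thesis
  proof (rule that[of "inv_into U \<phi> ` N'"])
    show "open_in A (inv_into U \<phi> ` N')"
      by (rule openin_chart_image[OF A UV(1) N']) (use N(3) in \<open>auto simp: N'_def\<close>)
    have "\<phi> x \<in> N'" using N(2) x Z(2) UV(4) by (auto simp: N'_def)
    then show "x \<in> inv_into U \<phi> ` N'" using x by (metis image_eqI)
    fix y assume "y \<in> inv_into U \<phi> ` N'"
    then obtain a w where "a \<in> N" "y = inv_into U \<phi> a" "w \<in> W" "w \<in> V" "\<psi> (F y) = \<psi> w"
      by (auto simp: N'_def)
    moreover have "F y \<in> V" using N(4) calculation by blast
    ultimately show "F y \<in> W" using smooth_atlasD(1)[OF B UV(2)] by (metis inj_onD)
  qed
qed

lemma smooth_at_cong:
  fixes A :: "('a, 'e::finite_dim_inner) chart set" and B :: "('b, 'f::finite_dim_inner) chart set"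
  assumes A: "smooth_atlas A" and F: "smooth_at A B F x"
    and W: "open_in A W" "x \<in> W" "\<And>y. y \<in> W \<Longrightarrow> F y = H y"
  shows "smooth_at A B H x"
proof -
  obtain U \<phi> V \<psi> N where UV: "(U, \<phi>) \<in> A" "(V, \<psi>) \<in> B" "x \<in> U" "F x \<in> V"
    and N: "open N" "\<phi> x \<in> N" "N \<subseteq> \<phi> ` U" "\<forall>a\<in>N. F (inv_into U \<phi> a) \<in> V"
      "smooth_on N (\<lambda>a. \<psi> (F (inv_into U \<phi> a)))"
    using F by (rule smooth_atE)
  have oW: "open (\<phi> ` (W \<inter> U))" by (rule open_chart_image[OF A W(1) UV(1)])
  have eq: "F (inv_into U \<phi> a) = H (inv_into U \<phi> a)" if "a \<in> \<phi> ` (W \<inter> U)" for a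
    using that W(3) smooth_atlasD(1)[OF A UV(1)] by auto
  have "smooth_on (N \<inter> \<phi> ` (W \<inter> U)) (\<lambda>a. \<psi> (H (inv_into U \<phi> a)))"
    by (rule smooth_on_cong[OF smooth_on_subset[OF N(5)]]) (use N(1) oW eq in auto)
  then have "smooth_in U \<phi> V \<psi> H x"
    unfolding smooth_in_def using N W UV oW eq
    by (intro exI[of _ "N \<inter> \<phi> ` (W \<inter> U)"]) auto
  then show ?thesis using smooth_atI[OF UV(1,2,3)] W UV(4) by metis
qed

lemma smooth_at_ident:
  fixes A :: "('a, 'e::finite_dim_inner) chart set"
  assumes A: "smooth_atlas A" and x: "x \<in> points A"
  shows "smooth_at A A (\<lambda>y. y) x"
proof -
  obtain C \<phi> where C: "(C, \<phi>) \<in> A" "x \<in> C" using points_obtain_chart[OF x] .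
  have "smooth_on (\<phi> ` C) (\<lambda>a. \<phi> (inv_into C \<phi> a))"
    using smooth_atlas_transition(2)[OF A C(1) C(1)] by simp
  then have "smooth_in C \<phi> C \<phi> (\<lambda>y. y) x"
    unfolding smooth_in_def using smooth_atlasD(2)[OF A C(1)] C(2)
    by (intro exI[of _ "\<phi> ` C"]) (auto simp: inv_into_into)
  then show ?thesis using C by (intro smooth_atI[where F="\<lambda>y. y"])
qed

lemma openin_points:
  fixes A :: "('a, 'e::finite_dim_inner) chart set"
  shows "smooth_atlas A \<Longrightarrow> open_in A (points A)"
  using topspace_atlas_topology openin_topspace by metis

subsection \<open>Real-valued functions\<close>

lemma smooth_atlas_real: "smooth_atlas real_atlas"
  by (simp add: smooth_atlas_def real_atlas_def smooth_on_bounded_linear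
      bounded_linear_ident[folded id_def] inv_id[unfolded id_def] id_def smooth_on_ident comp_def)

lemma points_real_atlas [simp]: "points real_atlas = UNIV"
  by (simp add: points_def real_atlas_def)

abbreviation smooth_real_at :: "('a, 'e::real_normed_vector) chart set \<Rightarrow> ('a \<Rightarrow> real) \<Rightarrow> 'a \<Rightarrow> bool" where
  "smooth_real_at A \<equiv> smooth_at A real_atlas"

lemma smooth_real_at_iff:
  fixes A :: "('a, 'e::finite_dim_inner) chart set"
  assumes "smooth_atlas A" "(U, \<phi>) \<in> A" "x \<in> U"
  shows "smooth_real_at A f x \<longleftrightarrow>
    (\<exists>N. open N \<and> \<phi> x \<in> N \<and> N \<subseteq> \<phi> ` U \<and> smooth_on N (\<lambda>a. f (inv_into U \<phi> a)))"
    (is "_ \<longleftrightarrow> ?R")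
proof
  assume "smooth_real_at A f x"
  then have "smooth_in U \<phi> UNIV id f x"
    by (rule smooth_atD[OF _ assms(1) smooth_atlas_real assms(2) _ assms(3)]) (auto simp: real_atlas_def)
  then show ?R by (auto simp: smooth_in_def)
next
  assume ?R
  then show "smooth_real_at A f x"
    using assms by (intro smooth_atI[of U \<phi> A UNIV id]) (auto simp: smooth_in_def real_atlas_def)
qed

lemma smooth_real_atE:
  fixes A :: "('a, 'e::finite_dim_inner) chart set"
  assumes "smooth_atlas A" "smooth_real_at A f x" "smooth_real_at A g x"
  obtains U \<phi> N where "(U, \<phi>) \<in> A" "x \<in> U" "open N" "\<phi> x \<in> N" "N \<subseteq> \<phi> ` U"
    "smooth_on N (\<lambda>a. f (inv_into U \<phi> a))" "smooth_on N (\<lambda>a. g (inv_into U \<phi> a))"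
proof -
  obtain U \<phi> where U: "(U, \<phi>) \<in> A" "x \<in> U" using assms(2) by (auto simp: smooth_at_def)
  obtain N M where "open N \<and> \<phi> x \<in> N \<and> N \<subseteq> \<phi> ` U \<and> smooth_on N (\<lambda>a. f (inv_into U \<phi> a))"
    "open M \<and> \<phi> x \<in> M \<and> M \<subseteq> \<phi> ` U \<and> smooth_on M (\<lambda>a. g (inv_into U \<phi> a))"
    using assms(2,3) unfolding smooth_real_at_iff[OF assms(1) U] by blast
  then show ?thesis
    using U by (intro that[of U \<phi> "N \<inter> M"]) (auto intro: smooth_on_subset[of N] smooth_on_subset[of M])
qed

lemma smooth_real_at_const:
  fixes A :: "('a, 'e::finite_dim_inner) chart set"
  assumes "smooth_atlas A" "x \<in> points A"
  shows "smooth_real_at A (\<lambda>x. c) x"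
proof -
  obtain U \<phi> where U: "(U, \<phi>) \<in> A" "x \<in> U" using points_obtain_chart[OF assms(2)] .
  then show ?thesis
    unfolding smooth_real_at_iff[OF assms(1) U] using smooth_atlasD(2)[OF assms(1) U(1)]
    by (auto intro!: exI[of _ "\<phi> ` U"] smooth_on_const)
qed

lemma
  fixes A :: "('a, 'e::finite_dim_inner) chart set"
  assumes A: "smooth_atlas A" and fg: "smooth_real_at A f x" "smooth_real_at A g x"
  shows smooth_real_at_add: "smooth_real_at A (\<lambda>x. f x + g x) x"
    and smooth_real_at_mult: "smooth_real_at A (\<lambda>x. f x * g x) x"
    and smooth_real_at_divide: "g x \<noteq> 0 \<Longrightarrow> smooth_real_at A (\<lambda>x. f x / g x) x"
proof -
  obtain U \<phi> N where U: "(U, \<phi>) \<in> A" "x \<in> U" and N: "open N" "\<phi> x \<in> N" "N \<subseteq> \<phi> ` U"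
    "smooth_on N (\<lambda>a. f (inv_into U \<phi> a))" "smooth_on N (\<lambda>a. g (inv_into U \<phi> a))"
    using smooth_real_atE[OF A fg] by metis
  show "smooth_real_at A (\<lambda>x. f x + g x) x"
    unfolding smooth_real_at_iff[OF A U]
    by (intro exI[of _ N] conjI N(1-3) smooth_on_add[OF N(1,4,5)])
  show "smooth_real_at A (\<lambda>x. f x * g x) x"
    unfolding smooth_real_at_iff[OF A U]
    by (intro exI[of _ N] conjI N(1-3) smooth_on_mult[OF N(1,4,5)])
  assume "g x \<noteq> 0"
  let ?N = "{a \<in> N. g (inv_into U \<phi> a) \<in> - {0}}"
  have "open ?N" by (rule open_preimage_smooth[OF N(5,1)]) auto
  moreover from this have "smooth_on ?N (\<lambda>a. f (inv_into U \<phi> a) / g (inv_into U \<phi> a))"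
    by (intro smooth_on_divide smooth_on_subset[OF N(4)] smooth_on_subset[OF N(5)]) auto
  ultimately show "smooth_real_at A (\<lambda>x. f x / g x) x"
    unfolding smooth_real_at_iff[OF A U] using N U smooth_atlasD(1)[OF A U(1)] \<open>g x \<noteq> 0\<close>
    by (intro exI[of _ ?N]) auto
qed

lemma smooth_map_sub_atlas_iff:
  fixes A :: "('a, 'e::finite_dim_inner) chart set"
  assumes A: "smooth_atlas A" and W: "open_in A W"
  shows "smooth_map (sub_atlas A W) real_atlas f \<longleftrightarrow> (\<forall>x\<in>W. smooth_real_at A f x)"
proof -
  have inv: "inv_into (U \<inter> W) \<phi> a = inv_into U \<phi> a" if U: "(U, \<phi>) \<in> A" and a: "a \<in> \<phi> ` (U \<inter> W)" for U \<phi> a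
  proof -
    obtain z where z: "z \<in> U \<inter> W" "a = \<phi> z" using a by blast
    have "inj_on \<phi> U" by (rule smooth_atlasD(1)[OF A U])
    then have "inj_on \<phi> (U \<inter> W)" by (rule inj_on_subset) simp
    then show ?thesis using z \<open>inj_on \<phi> U\<close> by simp
  qed
  have o: "open (\<phi> ` (U \<inter> W))" if "(U, \<phi>) \<in> A" for U \<phi>
    using open_chart_image[OF A W that] by (simp add: Int_commute)
  have sm: "smooth_on (\<phi> ` (U \<inter> W)) (\<lambda>a. f (inv_into (U \<inter> W) \<phi> a)) \<longleftrightarrow>
      smooth_on (\<phi> ` (U \<inter> W)) (\<lambda>a. f (inv_into U \<phi> a))" if "(U, \<phi>) \<in> A" for U \<phi>
    using smooth_on_cong[OF _ o[OF that], of "\<lambda>a. f (inv_into U \<phi> a)" "\<lambda>a. f (inv_into (U \<inter> W) \<phi> a)"]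
      smooth_on_cong[OF _ o[OF that], of "\<lambda>a. f (inv_into (U \<inter> W) \<phi> a)" "\<lambda>a. f (inv_into U \<phi> a)"]
      inv[OF that] by metis
  have "smooth_map (sub_atlas A W) real_atlas f \<longleftrightarrow>
      (\<forall>(U, \<phi>)\<in>A. open (\<phi> ` (U \<inter> W)) \<and> smooth_on (\<phi> ` (U \<inter> W)) (\<lambda>a. f (inv_into (U \<inter> W) \<phi> a)))"
    by (auto simp: smooth_map_def sub_atlas_def real_atlas_def points_def comp_def)
  also have "\<dots> \<longleftrightarrow> (\<forall>(U, \<phi>)\<in>A. smooth_on (\<phi> ` (U \<inter> W)) (\<lambda>a. f (inv_into U \<phi> a)))"
    using sm o by (intro ball_cong refl) auto
  also have "\<dots> \<longleftrightarrow> (\<forall>x\<in>W. smooth_real_at A f x)"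
  proof (intro iffI ballI)
    fix x assume S: "\<forall>(U, \<phi>)\<in>A. smooth_on (\<phi> ` (U \<inter> W)) (\<lambda>a. f (inv_into U \<phi> a))" and x: "x \<in> W"
    then have "x \<in> points A" using W by (auto simp: openin_atlas_topology[OF A])
    then obtain U \<phi> where U: "(U, \<phi>) \<in> A" "x \<in> U" by (rule points_obtain_chart)
    then show "smooth_real_at A f x"
      unfolding smooth_real_at_iff[OF A U] using S o x by (intro exI[of _ "\<phi> ` (U \<inter> W)"]) auto
  next
    fix C assume S: "\<forall>x\<in>W. smooth_real_at A f x" and C: "C \<in> A"
    obtain U \<phi> where [simp]: "C = (U, \<phi>)" by (cases C)
    have "smooth_on (\<phi> ` (U \<inter> W)) (\<lambda>a. f (inv_into U \<phi> a))"
    proof (rule smooth_on_local)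
      fix a assume "a \<in> \<phi> ` (U \<inter> W)"
      then obtain x where x: "x \<in> U" "x \<in> W" "a = \<phi> x" by blast
      show "\<exists>T. open T \<and> a \<in> T \<and> smooth_on T (\<lambda>a. f (inv_into U \<phi> a))"
        using S x C smooth_real_at_iff[OF A, of U \<phi> x f] by auto
    qed
    then show "case C of (U, \<phi>) \<Rightarrow> smooth_on (\<phi> ` (U \<inter> W)) (\<lambda>a. f (inv_into U \<phi> a))" by simp
  qed
  finally show ?thesis .
qed

lemma smooth_functions_iff:
  fixes A :: "('a, 'e::finite_dim_inner) chart set"
  assumes A: "smooth_atlas A"
  shows "f \<in> smooth_functions A \<longleftrightarrow> f \<in> extensional (points A) \<and> (\<forall>x\<in>points A. smooth_real_at A f x)"
  by (simp add: smooth_functions_def smooth_map_iff[OF A smooth_atlas_real])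

subsection \<open>Submersions\<close>

text \<open>
  In charts this is a local right inverse of a map with surjective derivative; its domain is
  shrunk to the image of the chart \<open>\<psi>\<close> so that it can be read on \<open>B\<close>.
\<close>

lemma submersion_local_section:
  fixes A :: "('a, 'e::finite_dim_inner) chart set" and B :: "('b, 'f::finite_dim_inner) chart set"
  assumes A: "smooth_atlas A" and B: "smooth_atlas B" and p: "submersion A B p" and x: "x \<in> points A"
  obtains W s where "open_in B W" "p x \<in> W" "s (p x) = x"
    "\<And>y. y \<in> W \<Longrightarrow> s y \<in> points A" "\<And>y. y \<in> W \<Longrightarrow> p (s y) = y" "\<And>y. y \<in> W \<Longrightarrow> smooth_at B A s y"
proof -
  have sp: "smooth_map A B p" using p by (simp add: submersion_def)
  then have "p x \<in> points B" using x by (auto simp: smooth_map_def)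
  then obtain V \<psi> where V: "(V, \<psi>) \<in> B" "p x \<in> V" by (rule points_obtain_chart)
  obtain U \<phi> where U: "(U, \<phi>) \<in> A" "x \<in> U" using x by (rule points_obtain_chart)
  note injA = smooth_atlasD(1)[OF A U(1)] and injB = smooth_atlasD(1)[OF B V(1)]
  let ?P = "\<psi> \<circ> p \<circ> inv_into U \<phi>" and ?N = "\<phi> ` (U \<inter> p -` V)"
  have N: "open ?N" "smooth_on ?N ?P" using sp U V by (fastforce simp: smooth_map_def)+
  have surj: "surj (frechet_derivative ?P (at (\<phi> x)))"
    using p U V by (fastforce simp: submersion_def)
  have xN: "\<phi> x \<in> ?N" using U V by blast
  have Px: "?P (\<phi> x) = \<psi> (p x)" using U injA by simp
  obtain W' s' where s': "open W'" "\<psi> (p x) \<in> W'" "s' (\<psi> (p x)) = \<phi> x" "s' ` W' \<subseteq> ?N"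
      "\<And>y. y \<in> W' \<Longrightarrow> ?P (s' y) = y" "smooth_on W' s'"
    using smooth_local_right_inverse[OF N(1) xN N(2) surj] Px by metis
  define W'' where "W'' = W' \<inter> \<psi> ` V"
  have W'': "open W''" "W'' \<subseteq> \<psi> ` V" using s'(1) smooth_atlasD(2)[OF B V(1)] by (auto simp: W''_def)
  define s where "s y = inv_into U \<phi> (s' (\<psi> y))" for y
  have s: "s y \<in> U" "p (s y) \<in> V" "p (s y) = y" "\<phi> (s y) = s' (\<psi> y)" "y \<in> V" "\<psi> y \<in> W''"
    if y: "y \<in> inv_into V \<psi> ` W''" for y
  proof -
    obtain b where b: "b \<in> W'" "b \<in> \<psi> ` V" "y = inv_into V \<psi> b" using y by (auto simp: W''_def)
    then have yb: "\<psi> y = b" by (simp add: f_inv_into_f)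
    show yV: "y \<in> V" using b by (simp add: inv_into_into)
    show "\<psi> y \<in> W''" using yb b by (simp add: W''_def)
    obtain z where z: "z \<in> U" "p z \<in> V" "s' b = \<phi> z" using s'(4) b(1) by blast
    then have sz: "s y = z" using injA by (simp add: s_def yb)
    then show "s y \<in> U" "p (s y) \<in> V" "\<phi> (s y) = s' (\<psi> y)" using z yb by auto
    have "\<psi> (p (s y)) = \<psi> y" using s'(5)[OF b(1)] by (simp add: s_def yb)
    then show "p (s y) = y" using injB yV \<open>p (s y) \<in> V\<close> by (meson inj_onD)
  qed
  show thesis
  proof (rule that[of "inv_into V \<psi> ` W''" s])
    show "open_in B (inv_into V \<psi> ` W'')" by (rule openin_chart_image[OF B V(1) W''])
    have "\<psi> (p x) \<in> W''" using s'(2) V(2) by (simp add: W''_def)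
    moreover have "inv_into V \<psi> (\<psi> (p x)) = p x" using V(2) injB by simp
    ultimately show "p x \<in> inv_into V \<psi> ` W''" by (metis image_eqI)
    show "s (p x) = x" using s'(3) U(2) injA by (simp add: s_def)
    fix y assume y: "y \<in> inv_into V \<psi> ` W''"
    show "s y \<in> points A" using s(1)[OF y] chart_in_points[OF U(1)] by blast
    show "p (s y) = y" by (rule s(3)[OF y])
    have "smooth_on W'' (\<lambda>b. \<phi> (s (inv_into V \<psi> b)))"
      by (rule smooth_on_cong[OF smooth_on_subset[OF s'(6)] W''(1)])
        (use s(4) W''(2) in \<open>auto simp: W''_def f_inv_into_f\<close>)
    then have "smooth_in V \<psi> U \<phi> s y"
      unfolding smooth_in_def using W'' s(1) s(6)[OF y] by (intro exI[of _ W'']) auto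
    then show "smooth_at B A s y"
      by (rule smooth_atI[where F=s, OF V(1) U(1) s(5)[OF y] s(1)[OF y]])
  qed
qed

text \<open>
  Along a local section \<open>s\<close> through \<open>x\<close>, \<open>F\<close> equals \<open>(F \<circ> p) \<circ> s\<close>.
\<close>

lemma smooth_at_descends:
  fixes A :: "('a, 'e::finite_dim_inner) chart set" and B :: "('b, 'f::finite_dim_inner) chart set"
    and C :: "('c, 'g::finite_dim_inner) chart set"
  assumes at: "smooth_atlas A" "smooth_atlas B" "smooth_atlas C" and p: "submersion A B p"
    and x: "x \<in> points A" and F: "smooth_at A C (\<lambda>x. F (p x)) x"
  shows "smooth_at B C F (p x)"
proof -
  obtain W s where s: "open_in B W" "p x \<in> W" "s (p x) = x"
    "\<And>y. y \<in> W \<Longrightarrow> p (s y) = y" "\<And>y. y \<in> W \<Longrightarrow> smooth_at B A s y"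
    using submersion_local_section[OF at(1,2) p x] by metis
  have "smooth_at B C (\<lambda>y. F (p (s y))) (p x)"
    using smooth_at_compose[OF s(5)[OF s(2)], of C "\<lambda>x. F (p x)"] F s(3) at by simp
  then show ?thesis
    by (rule smooth_at_cong[OF at(2) _ s(1,2)]) (simp add: s(4))
qed

text \<open>
  A local section through a point of \<open>W\<close> is continuous, so it lifts all nearby points into \<open>W\<close>.
\<close>

lemma openin_submersion_image:
  fixes A :: "('a, 'e::finite_dim_inner) chart set" and B :: "('b, 'f::finite_dim_inner) chart set"
  assumes A: "smooth_atlas A" and B: "smooth_atlas B" and p: "submersion A B p"
    and W: "open_in A W"
  shows "open_in B (p ` W)"
proof (subst openin_subopen, intro ballI)
  fix y assume "y \<in> p ` W"
  then obtain x where x: "x \<in> W" "y = p x" by blast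
  then have "x \<in> points A" using W by (auto simp: openin_atlas_topology[OF A])
  then obtain V s where s: "open_in B V" "p x \<in> V" "s (p x) = x"
    "\<And>y. y \<in> V \<Longrightarrow> p (s y) = y" "\<And>y. y \<in> V \<Longrightarrow> smooth_at B A s y"
    using submersion_local_section[OF A B p] by metis
  obtain Z where Z: "open_in B Z" "p x \<in> Z" "\<And>y. y \<in> Z \<Longrightarrow> s y \<in> W"
    using smooth_at_neighbourhood[OF B A s(5)[OF s(2)] W] s(3) x(1) by metis
  have "Z \<inter> V \<subseteq> p ` W" using Z(3) s(4) by (metis IntD1 IntD2 image_eqI subsetI)
  then show "\<exists>T. open_in B T \<and> y \<in> T \<and> T \<subseteq> p ` W"
    using Z s x(2) by (intro exI[of _ "Z \<inter> V"]) auto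
qed

section \<open>Line bundles\<close>

lemma mem_fibre: "l \<in> fibre M x \<longleftrightarrow> l \<in> total_space M \<and> bproj M l = x"
  by (auto simp: fibre_def)

text \<open>
  A linear isomorphism from a single fibre onto \<open>\<real>\<close>. Identities between elements of the fibre are
  proved below by applying it, which replaces vector space axioms for the fibre operations.
\<close>

definition fibre_coord :: "('k, 'l) pre_bundle \<Rightarrow> 'k \<Rightarrow> ('l \<Rightarrow> real) \<Rightarrow> bool" where
  "fibre_coord M x \<tau> \<longleftrightarrow> linear_on_fibre M x \<tau> \<and> bij_betw \<tau> (fibre M x) UNIV"

lemma fibre_coord_inj: "fibre_coord M x \<tau> \<Longrightarrow> a \<in> fibre M x \<Longrightarrow> b \<in> fibre M x \<Longrightarrow> \<tau> a = \<tau> b \<Longrightarrow> a = b"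
  unfolding fibre_coord_def bij_betw_def inj_on_def by blast

lemma frame_in_fibre: "fibre_coord M x \<tau> \<Longrightarrow> frame M \<tau> x \<in> fibre M x"
  unfolding fibre_coord_def frame_def bij_betw_def by (metis UNIV_I inv_into_into)

lemma coord_frame: "fibre_coord M x \<tau> \<Longrightarrow> \<tau> (frame M \<tau> x) = 1"
  unfolding fibre_coord_def frame_def bij_betw_def by (metis UNIV_I f_inv_into_f)

lemma frame_unique: "fibre_coord M x \<tau> \<Longrightarrow> a \<in> fibre M x \<Longrightarrow> \<tau> a = 1 \<Longrightarrow> a = frame M \<tau> x"
  using fibre_coord_inj frame_in_fibre coord_frame by metis

lemma coord_add: "fibre_coord M x \<tau> \<Longrightarrow> a \<in> fibre M x \<Longrightarrow> b \<in> fibre M x \<Longrightarrow> \<tau> (fadd M a b) = \<tau> a + \<tau> b"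
  and coord_scale: "fibre_coord M x \<tau> \<Longrightarrow> a \<in> fibre M x \<Longrightarrow> \<tau> (fscale M c a) = c * \<tau> a"
  by (auto simp: fibre_coord_def linear_on_fibre_def)

locale smooth_line_bundle =
  fixes A :: "('k, 'e::finite_dim_inner) chart set" and M :: "('k, 'l) pre_bundle"
  assumes atlas: "smooth_atlas A" and is_bundle: "line_bundle A M"
begin

lemma bproj_in_points: "l \<in> total_space M \<Longrightarrow> bproj M l \<in> points A"
  using is_bundle by (auto simp: line_bundle_def)

lemma fadd_in_fibre: "a \<in> fibre M x \<Longrightarrow> b \<in> fibre M x \<Longrightarrow> fadd M a b \<in> fibre M x"
  and fscale_in_fibre: "a \<in> fibre M x \<Longrightarrow> fscale M c a \<in> fibre M x"
  using is_bundle by (auto simp: line_bundle_def)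

lemma triv_local_triv: "(U, \<tau>) \<in> triv M \<Longrightarrow> local_triv A M U \<tau>"
  using is_bundle by (auto simp: line_bundle_def)

lemma obtain_triv:
  assumes "x \<in> points A" obtains U \<tau> where "(U, \<tau>) \<in> triv M" "x \<in> U"
  using is_bundle assms by (auto simp: line_bundle_def)

lemma local_triv_open: "local_triv A M U \<tau> \<Longrightarrow> open_in A U"
  by (simp add: local_triv_def)

lemma local_triv_subset: "local_triv A M U \<tau> \<Longrightarrow> U \<subseteq> points A"
  using openin_atlas_subset[OF atlas] by (auto simp: local_triv_def)

lemma local_triv_coord: "local_triv A M U \<tau> \<Longrightarrow> x \<in> U \<Longrightarrow> fibre_coord M x \<tau>"
  by (simp add: local_triv_def fibre_coord_def)

lemma fibre_nonempty:
  assumes "x \<in> points A" shows "fibre M x \<noteq> {}"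
proof -
  obtain U \<tau> where U: "(U, \<tau>) \<in> triv M" "x \<in> U" using obtain_triv[OF assms] .
  have "frame M \<tau> x \<in> fibre M x"
    by (rule frame_in_fibre[OF local_triv_coord[OF triv_local_triv[OF U(1)] U(2)]])
  then show ?thesis by blast
qed

lemma local_triv_iff:
  "local_triv A M U \<tau> \<longleftrightarrow> open_in A U \<and> (\<forall>x\<in>U. fibre_coord M x \<tau>) \<and>
    (\<forall>(V, \<sigma>)\<in>triv M. \<forall>x\<in>U \<inter> V. smooth_real_at A (\<lambda>x. \<tau> (frame M \<sigma> x)) x)"
proof -
  have "(\<forall>(V, \<sigma>)\<in>triv M. smooth_map (sub_atlas A (U \<inter> V)) real_atlas (\<lambda>x. \<tau> (frame M \<sigma> x))) \<longleftrightarrow>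
      (\<forall>(V, \<sigma>)\<in>triv M. \<forall>x\<in>U \<inter> V. smooth_real_at A (\<lambda>x. \<tau> (frame M \<sigma> x)) x)"
    if U: "open_in A U"
  proof (intro ball_cong refl, clarify)
    fix V \<sigma> assume "(V, \<sigma>) \<in> triv M"
    then have "open_in A (U \<inter> V)"
      using U local_triv_open[OF triv_local_triv] by blast
    then show "smooth_map (sub_atlas A (U \<inter> V)) real_atlas (\<lambda>x. \<tau> (frame M \<sigma> x)) =
        (\<forall>x\<in>U \<inter> V. smooth_real_at A (\<lambda>x. \<tau> (frame M \<sigma> x)) x)"
      by (rule smooth_map_sub_atlas_iff[OF atlas])
  qed
  then show ?thesis unfolding local_triv_def fibre_coord_def by blast
qed

lemma fibre_expansion:
  assumes "fibre_coord M x \<tau>" "a \<in> fibre M x"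
  shows "a = fscale M (\<tau> a) (frame M \<tau> x)"
  using assms frame_in_fibre[OF assms(1)]
  by (intro fibre_coord_inj[OF assms(1)] fscale_in_fibre) (auto simp: coord_scale coord_frame)

lemma linear_functional_eq:
  assumes "fibre_coord M x \<tau>" "linear_on_fibre M x \<alpha>" "a \<in> fibre M x"
  shows "\<alpha> a = \<tau> a * \<alpha> (frame M \<tau> x)"
proof -
  have "\<alpha> a = \<alpha> (fscale M (\<tau> a) (frame M \<tau> x))" using fibre_expansion[OF assms(1,3)] by simp
  then show ?thesis
    using assms(2) frame_in_fibre[OF assms(1)] unfolding linear_on_fibre_def by metis
qed

lemma coord_change:
  "fibre_coord M x \<tau> \<Longrightarrow> fibre_coord M x \<sigma> \<Longrightarrow> a \<in> fibre M x \<Longrightarrow> \<sigma> a = \<tau> a * \<sigma> (frame M \<tau> x)"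
  using linear_functional_eq fibre_coord_def by metis

lemma coord_change_inverse:
  assumes "fibre_coord M x \<tau>" "fibre_coord M x \<sigma>"
  shows "\<sigma> (frame M \<tau> x) * \<tau> (frame M \<sigma> x) = 1" "\<sigma> (frame M \<tau> x) \<noteq> 0"
proof -
  show "\<sigma> (frame M \<tau> x) * \<tau> (frame M \<sigma> x) = 1"
    using coord_change[OF assms frame_in_fibre[OF assms(2)]] coord_frame[OF assms(2)] by (simp add: mult.commute)
  then show "\<sigma> (frame M \<tau> x) \<noteq> 0" by auto
qed

lemma fadd_left_cancel:
  assumes "x \<in> points A" "a \<in> fibre M x" "b \<in> fibre M x" "c \<in> fibre M x" "fadd M a b = fadd M a c"
  shows "b = c"
proof -
  obtain U \<tau> where "(U, \<tau>) \<in> triv M" "x \<in> U" using obtain_triv[OF assms(1)] .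
  then have t: "fibre_coord M x \<tau>" using local_triv_coord[OF triv_local_triv] by blast
  then have "\<tau> a + \<tau> b = \<tau> a + \<tau> c" using coord_add[OF t] assms by metis
  then show ?thesis using fibre_coord_inj[OF t] assms by simp
qed

text \<open>
  \<^const>\<open>local_triv\<close> compares a trivialization with those of \<^term>\<open>triv M\<close> only. The transition
  function between two arbitrary ones is a quotient of two such comparisons.
\<close>

lemma transition_smooth:
  assumes U: "local_triv A M U \<tau>" and V: "local_triv A M V \<sigma>" and x: "x \<in> U" "x \<in> V"
  shows "smooth_real_at A (\<lambda>y. \<tau> (frame M \<sigma> y)) x"
proof -
  have "x \<in> points A" using local_triv_subset[OF U] x by blast
  then obtain W \<rho> where W: "(W, \<rho>) \<in> triv M" "x \<in> W" by (rule obtain_triv)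
  have s: "smooth_real_at A (\<lambda>y. \<tau> (frame M \<rho> y)) x" "smooth_real_at A (\<lambda>y. \<sigma> (frame M \<rho> y)) x"
    using U V W x unfolding local_triv_iff by fast+
  note cW = local_triv_coord[OF triv_local_triv[OF W(1)]]
  have "smooth_real_at A (\<lambda>y. \<tau> (frame M \<rho> y) / \<sigma> (frame M \<rho> y)) x"
    by (rule smooth_real_at_divide[OF atlas s])
      (rule coord_change_inverse(2)[OF cW[OF W(2)] local_triv_coord[OF V x(2)]])
  then show ?thesis
  proof (rule smooth_at_cong[OF atlas])
    show "open_in A (U \<inter> V \<inter> W)"
      using local_triv_open U V triv_local_triv[OF W(1)] by blast
    show "x \<in> U \<inter> V \<inter> W" using x W by blast
    fix y assume y: "y \<in> U \<inter> V \<inter> W"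
    then have c: "fibre_coord M y \<tau>" "fibre_coord M y \<sigma>" "fibre_coord M y \<rho>"
      using local_triv_coord[OF U] local_triv_coord[OF V] cW by auto
    have "\<tau> (frame M \<sigma> y) = \<rho> (frame M \<sigma> y) * \<tau> (frame M \<rho> y)"
      by (rule coord_change[OF c(3,1) frame_in_fibre[OF c(2)]])
    then show "\<tau> (frame M \<rho> y) / \<sigma> (frame M \<rho> y) = \<tau> (frame M \<sigma> y)"
      using coord_change_inverse[OF c(3,2)] by (simp add: field_simps)
  qed
qed

lemma local_triv_cong:
  assumes U: "local_triv A M U \<tau>" and eq: "\<And>l. l \<in> total_space M \<Longrightarrow> bproj M l \<in> U \<Longrightarrow> \<tau>' l = \<tau> l"
  shows "local_triv A M U \<tau>'"
  unfolding local_triv_iff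
proof (intro conjI ballI; (clarify)?)
  show "open_in A U" by (rule local_triv_open[OF U])
  have eqf: "\<tau>' l = \<tau> l" if "x \<in> U" "l \<in> fibre M x" for x l
    using that eq by (auto simp: mem_fibre)
  show "fibre_coord M x \<tau>'" if x: "x \<in> U" for x
  proof -
    have "bij_betw \<tau>' (fibre M x) UNIV = bij_betw \<tau> (fibre M x) UNIV"
      using eqf[OF x] by (intro bij_betw_cong) auto
    then show ?thesis
      using local_triv_coord[OF U x] eqf[OF x] fadd_in_fibre[of _ x] fscale_in_fibre[of _ x]
      by (simp add: fibre_coord_def linear_on_fibre_def)
  qed
  fix V \<sigma> x assume V: "(V, \<sigma>) \<in> triv M" and x: "x \<in> U" "x \<in> V"
  have "smooth_real_at A (\<lambda>y. \<tau> (frame M \<sigma> y)) x"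
    by (rule transition_smooth[OF U triv_local_triv[OF V] x])
  then show "smooth_real_at A (\<lambda>y. \<tau>' (frame M \<sigma> y)) x"
  proof (rule smooth_at_cong[OF atlas])
    show "open_in A (U \<inter> V)"
      using local_triv_open U triv_local_triv[OF V] by blast
    show "\<tau> (frame M \<sigma> y) = \<tau>' (frame M \<sigma> y)" if "y \<in> U \<inter> V" for y
      using that eqf[of y "frame M \<sigma> y"] frame_in_fibre[OF local_triv_coord[OF triv_local_triv[OF V]]]
      by auto
  qed (use x in auto)
qed

subsection \<open>The manifold structure of the total space\<close>

lemma total_chart:
  assumes U: "(U, \<phi>) \<in> A" and V: "(V, \<tau>) \<in> triv M"
    and W: "open_in A W" "W \<subseteq> U \<inter> V"
  shows "inj_on (\<lambda>l. (\<phi> (bproj M l), \<tau> l)) {l \<in> total_space M. bproj M l \<in> U \<inter> V}"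
    and "(\<lambda>l. (\<phi> (bproj M l), \<tau> l)) ` {l \<in> total_space M. bproj M l \<in> W} = \<phi> ` W \<times> UNIV"
    and "a \<in> \<phi> ` (U \<inter> V) \<Longrightarrow>
      inv_into {l \<in> total_space M. bproj M l \<in> U \<inter> V} (\<lambda>l. (\<phi> (bproj M l), \<tau> l)) (a, r) =
        fscale M r (frame M \<tau> (inv_into U \<phi> a))"
proof -
  note inj = smooth_atlasD(1)[OF atlas U] and c = local_triv_coord[OF triv_local_triv[OF V]]
  let ?C = "{l \<in> total_space M. bproj M l \<in> U \<inter> V}" and ?\<kappa> = "\<lambda>l. (\<phi> (bproj M l), \<tau> l)"
  show I: "inj_on ?\<kappa> ?C"
  proof (rule inj_onI)
    fix l l' assume l: "l \<in> ?C" "l' \<in> ?C" "?\<kappa> l = ?\<kappa> l'"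
    then have "bproj M l = bproj M l'" using inj by (auto dest: inj_onD)
    then show "l = l'" using l c fibre_coord_inj[of M "bproj M l" \<tau> l l'] by (auto simp: mem_fibre)
  qed
  have lift: "fscale M r (frame M \<tau> x) \<in> total_space M \<and> bproj M (fscale M r (frame M \<tau> x)) = x \<and>
      \<tau> (fscale M r (frame M \<tau> x)) = r" if "x \<in> V" for x r
    using c[OF that] fscale_in_fibre[OF frame_in_fibre] coord_scale[OF _ frame_in_fibre] coord_frame
    by (fastforce simp: mem_fibre)
  show "?\<kappa> ` {l \<in> total_space M. bproj M l \<in> W} = \<phi> ` W \<times> UNIV"
  proof (intro equalityI subsetI)
    fix z assume "z \<in> \<phi> ` W \<times> (UNIV :: real set)"
    then obtain x r where x: "x \<in> W" "z = (\<phi> x, r)" by auto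
    then show "z \<in> ?\<kappa> ` {l \<in> total_space M. bproj M l \<in> W}"
      using lift[of x r] W(2) by (intro image_eqI[of _ _ "fscale M r (frame M \<tau> x)"]) auto
  qed auto
  assume a: "a \<in> \<phi> ` (U \<inter> V)"
  then have x: "inv_into U \<phi> a \<in> U \<inter> V" "\<phi> (inv_into U \<phi> a) = a" using inj by auto
  show "inv_into ?C ?\<kappa> (a, r) = fscale M r (frame M \<tau> (inv_into U \<phi> a))"
    by (rule inv_into_f_eq[OF I]) (use x lift[of "inv_into U \<phi> a" r] in auto)
qed

text \<open>
  The change of charts is \<open>(a, r) \<mapsto> (\<phi>' (\<phi>\<^sup>-\<^sup>1 a), r t(a))\<close>, where \<open>t\<close> is the transition function
  of the two trivializations in the chart \<open>\<phi>\<close>.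
\<close>

lemma smooth_atlas_total: "smooth_atlas (total_atlas A M)"
proof -
  have op: "open_in A (U \<inter> V)" if "(U, \<phi>) \<in> A" "(V, \<tau>) \<in> triv M" for U \<phi> V \<tau>
    using openin_chart[OF atlas that(1)] local_triv_open[OF triv_local_triv[OF that(2)]] by blast
  have chart: "inj_on \<kappa> C \<and> open (\<kappa> ` C)" if CK: "(C, \<kappa>) \<in> total_atlas A M" for C \<kappa>
  proof -
    obtain U \<phi> V \<tau> where U: "(U, \<phi>) \<in> A" and V: "(V, \<tau>) \<in> triv M"
      and C: "C = {l \<in> total_space M. bproj M l \<in> U \<inter> V}" "\<kappa> = (\<lambda>l. (\<phi> (bproj M l), \<tau> l))"
      using CK unfolding total_atlas_def by blast
    have "open (\<phi> ` (U \<inter> V))"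
      using open_chart_image[OF atlas op[OF U V] U] by (simp add: Int_commute inf_left_commute)
    then show ?thesis
      using total_chart(1,2)[OF U V op[OF U V] subset_refl] by (simp add: C open_Times)
  qed
  have trans: "open (\<kappa> ` (C \<inter> C')) \<and> smooth_on (\<kappa> ` (C \<inter> C')) (\<kappa>' \<circ> inv_into C \<kappa>)"
    if CC: "(C, \<kappa>) \<in> total_atlas A M" "(C', \<kappa>') \<in> total_atlas A M" for C \<kappa> C' \<kappa>'
  proof -
    obtain U \<phi> V \<tau> where U: "(U, \<phi>) \<in> A" and V: "(V, \<tau>) \<in> triv M"
      and C: "C = {l \<in> total_space M. bproj M l \<in> U \<inter> V}" "\<kappa> = (\<lambda>l. (\<phi> (bproj M l), \<tau> l))"
      using CC(1) unfolding total_atlas_def by blast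
    obtain U' \<phi>' V' \<tau>' where U': "(U', \<phi>') \<in> A" and V': "(V', \<tau>') \<in> triv M"
      and C': "C' = {l \<in> total_space M. bproj M l \<in> U' \<inter> V'}" "\<kappa>' = (\<lambda>l. (\<phi>' (bproj M l), \<tau>' l))"
      using CC(2) unfolding total_atlas_def by blast
    note inj = smooth_atlasD(1)[OF atlas U]
    define W where "W = (U \<inter> V) \<inter> (U' \<inter> V')"
    have W: "open_in A W" "W \<subseteq> U \<inter> V" "W \<subseteq> U \<inter> U'"
      using op[OF U V] op[OF U' V'] by (auto simp: W_def)
    have "C \<inter> C' = {l \<in> total_space M. bproj M l \<in> W}" by (auto simp: C C' W_def)
    then have im: "\<kappa> ` (C \<inter> C') = \<phi> ` W \<times> UNIV" using total_chart(2)[OF U V W(1,2)] by (simp add: C)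
    have "W \<inter> U = W" using W by blast
    then have oW: "open (\<phi> ` W)" using open_chart_image[OF atlas W(1) U] by simp
    have "smooth_on (\<phi> ` W) (\<lambda>a. \<tau>' (frame M \<tau> (inv_into U \<phi> a)))"
    proof (rule smooth_on_local)
      fix a assume "a \<in> \<phi> ` W"
      then obtain x where x: "x \<in> W" "a = \<phi> x" by blast
      have "smooth_real_at A (\<lambda>y. \<tau>' (frame M \<tau> y)) x"
        using x by (intro transition_smooth[OF triv_local_triv[OF V'] triv_local_triv[OF V]]) (auto simp: W_def)
      moreover have "x \<in> U" using x W by blast
      ultimately obtain N where "open N" "\<phi> x \<in> N" "smooth_on N (\<lambda>a. \<tau>' (frame M \<tau> (inv_into U \<phi> a)))"
        unfolding smooth_real_at_iff[OF atlas U \<open>x \<in> U\<close>] by blast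
      then show "\<exists>T. open T \<and> a \<in> T \<and> smooth_on T (\<lambda>a. \<tau>' (frame M \<tau> (inv_into U \<phi> a)))"
        using x by blast
    qed
    then have s1: "smooth_on (\<phi> ` W \<times> UNIV) (\<lambda>z. \<tau>' (frame M \<tau> (inv_into U \<phi> (fst z :: 'e))))"
      using oW by (intro smooth_on_compose[OF smooth_on_bounded_linear[OF bounded_linear_fst]])
        (auto intro: open_Times)
    have s2: "smooth_on (\<phi> ` W \<times> UNIV) (\<lambda>z. \<phi>' (inv_into U \<phi> (fst z :: 'e)))"
      using oW smooth_on_subset[OF smooth_atlas_transition(2)[OF atlas U U'] image_mono[OF W(3)]]
      by (intro smooth_on_compose[OF smooth_on_bounded_linear[OF bounded_linear_fst]])
        (auto intro: open_Times)
    have s3: "smooth_on (\<phi> ` W \<times> UNIV) (\<lambda>z :: 'e \<times> real. snd z)"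
      using oW by (intro smooth_on_bounded_linear[OF bounded_linear_snd] open_Times) auto
    have o: "open (\<phi> ` W \<times> (UNIV :: real set))" using oW by (intro open_Times) auto
    have "smooth_on (\<phi> ` W \<times> UNIV)
        (\<lambda>z. (\<phi>' (inv_into U \<phi> (fst z)), snd z * \<tau>' (frame M \<tau> (inv_into U \<phi> (fst z)))))"
      by (intro smooth_on_Pair smooth_on_mult s1 s2 s3 o)
    then have "smooth_on (\<phi> ` W \<times> UNIV) (\<kappa>' \<circ> inv_into C \<kappa>)"
    proof (rule smooth_on_cong[OF _ o])
      fix z assume "z \<in> \<phi> ` W \<times> (UNIV :: real set)"
      then obtain x r where z: "z = (\<phi> x, r)" "x \<in> W" by auto
      then have x: "inv_into U \<phi> (\<phi> x) = x" "x \<in> V" "x \<in> V'" using W inj by (auto simp: W_def)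
      have c: "fibre_coord M x \<tau>" "fibre_coord M x \<tau>'"
        using local_triv_coord[OF triv_local_triv] V V' x by blast+
      have "inv_into C \<kappa> z = fscale M r (frame M \<tau> x)"
        using total_chart(3)[OF U V W(1,2), of "\<phi> x" r] z W(2) x by (auto simp: C)
      then show "(\<phi>' (inv_into U \<phi> (fst z)), snd z * \<tau>' (frame M \<tau> (inv_into U \<phi> (fst z)))) =
          (\<kappa>' \<circ> inv_into C \<kappa>) z"
        using z x coord_scale[OF c(2) frame_in_fibre[OF c(1)]] fscale_in_fibre[OF frame_in_fibre[OF c(1)]]
        by (simp add: C' mem_fibre)
    qed
    then show ?thesis using im o by simp
  qed
  show ?thesis unfolding smooth_atlas_def using chart trans by blast
qed

lemma points_total_atlas: "points (total_atlas A M) = total_space M"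
proof (intro equalityI subsetI)
  fix l assume l: "l \<in> total_space M"
  obtain U \<phi> where "(U, \<phi>) \<in> A" "bproj M l \<in> U" using points_obtain_chart[OF bproj_in_points[OF l]] .
  moreover obtain V \<tau> where "(V, \<tau>) \<in> triv M" "bproj M l \<in> V" using obtain_triv[OF bproj_in_points[OF l]] .
  ultimately show "l \<in> points (total_atlas A M)"
    using l unfolding points_def total_atlas_def by blast
qed (auto simp: points_def total_atlas_def)

lemma obtain_total_chart:
  assumes "l \<in> total_space M" "(V, \<tau>) \<in> triv M" "bproj M l \<in> V"
  obtains U \<phi> where "(U, \<phi>) \<in> A" "bproj M l \<in> U"
    "({l \<in> total_space M. bproj M l \<in> U \<inter> V}, \<lambda>l. (\<phi> (bproj M l), \<tau> l)) \<in> total_atlas A M"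
proof -
  obtain U \<phi> where "(U, \<phi>) \<in> A" "bproj M l \<in> U" using points_obtain_chart[OF bproj_in_points[OF assms(1)]] .
  then show ?thesis using that[of U \<phi>] assms unfolding total_atlas_def by blast
qed

lemma smooth_at_bproj:
  assumes l: "l \<in> total_space M"
  shows "smooth_at (total_atlas A M) A (bproj M) l"
proof -
  obtain V \<tau> where V: "(V, \<tau>) \<in> triv M" "bproj M l \<in> V" using obtain_triv[OF bproj_in_points[OF l]] .
  obtain U \<phi> where U: "(U, \<phi>) \<in> A" "bproj M l \<in> U"
    and C: "({l \<in> total_space M. bproj M l \<in> U \<inter> V}, \<lambda>l. (\<phi> (bproj M l), \<tau> l)) \<in> total_atlas A M"
    using obtain_total_chart[OF l V] .
  let ?C = "{l \<in> total_space M. bproj M l \<in> U \<inter> V}" and ?\<kappa> = "\<lambda>l. (\<phi> (bproj M l), \<tau> l)"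
  have o: "open (?\<kappa> ` ?C)" by (rule smooth_atlasD(2)[OF smooth_atlas_total C])
  have "smooth_on (?\<kappa> ` ?C) (\<lambda>z. fst z)" by (rule smooth_on_bounded_linear[OF bounded_linear_fst o])
  then have "smooth_on (?\<kappa> ` ?C) (\<lambda>z. \<phi> (bproj M (inv_into ?C ?\<kappa> z)))"
    by (rule smooth_on_cong[OF _ o]) (metis (no_types, lifting) f_inv_into_f fst_conv)
  moreover have "bproj M (inv_into ?C ?\<kappa> z) \<in> U" if "z \<in> ?\<kappa> ` ?C" for z
    using inv_into_into[OF that] by blast
  ultimately have "smooth_in ?C ?\<kappa> U \<phi> (bproj M) l"
    unfolding smooth_in_def using l U V o by (intro exI[of _ "?\<kappa> ` ?C"]) auto
  then show ?thesis using l U V by (intro smooth_atI[where F="bproj M", OF C U(1)]) auto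
qed

lemma smooth_at_triv:
  assumes l: "l \<in> total_space M" and V: "(V, \<tau>) \<in> triv M" "bproj M l \<in> V"
  shows "smooth_real_at (total_atlas A M) \<tau> l"
proof -
  obtain U \<phi> where U: "(U, \<phi>) \<in> A" "bproj M l \<in> U"
    and C: "({l \<in> total_space M. bproj M l \<in> U \<inter> V}, \<lambda>l. (\<phi> (bproj M l), \<tau> l)) \<in> total_atlas A M"
    using obtain_total_chart[OF l V] .
  let ?C = "{l \<in> total_space M. bproj M l \<in> U \<inter> V}" and ?\<kappa> = "\<lambda>l. (\<phi> (bproj M l), \<tau> l)"
  have o: "open (?\<kappa> ` ?C)" by (rule smooth_atlasD(2)[OF smooth_atlas_total C])
  have "smooth_on (?\<kappa> ` ?C) (\<lambda>z. snd z)" by (rule smooth_on_bounded_linear[OF bounded_linear_snd o])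
  then have "smooth_on (?\<kappa> ` ?C) (\<lambda>z. \<tau> (inv_into ?C ?\<kappa> z))"
    by (rule smooth_on_cong[OF _ o]) (metis (no_types, lifting) f_inv_into_f snd_conv)
  then show ?thesis
    using l U V o by (subst smooth_real_at_iff[OF smooth_atlas_total C]) (auto intro!: exI[of _ "?\<kappa> ` ?C"])
qed

text \<open>
  The two components of a chart of the total space are a chart of the base point and the fibre
  coordinate, so it suffices to test these. Only a neighbourhood of \<open>x\<close> has to map into the total
  space.
\<close>

lemma smooth_at_totalI:
  fixes B :: "('b, 'f::finite_dim_inner) chart set"
  assumes B: "smooth_atlas B" and W: "open_in B W" "x \<in> W" "\<And>y. y \<in> W \<Longrightarrow> F y \<in> total_space M"
    and base: "smooth_at B A (\<lambda>y. bproj M (F y)) x"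
    and V: "(V, \<tau>) \<in> triv M" "bproj M (F x) \<in> V" and fib: "smooth_real_at B (\<lambda>y. \<tau> (F y)) x"
  shows "smooth_at B (total_atlas A M) F x"
proof -
  have Fx: "F x \<in> total_space M" by (rule W(3)[OF W(2)])
  obtain U \<phi> where U: "(U, \<phi>) \<in> A" "bproj M (F x) \<in> U"
    and C: "({l \<in> total_space M. bproj M l \<in> U \<inter> V}, \<lambda>l. (\<phi> (bproj M l), \<tau> l)) \<in> total_atlas A M"
    using obtain_total_chart[OF Fx V] .
  let ?C = "{l \<in> total_space M. bproj M l \<in> U \<inter> V}" and ?\<kappa> = "\<lambda>l. (\<phi> (bproj M l), \<tau> l)"
  have "x \<in> points B" using W openin_atlas_subset[OF B] by blast
  then obtain X \<xi> where X: "(X, \<xi>) \<in> B" "x \<in> X" by (rule points_obtain_chart)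
  obtain Z where Z: "open_in B Z" "x \<in> Z" "\<And>y. y \<in> Z \<Longrightarrow> bproj M (F y) \<in> V"
    using smooth_at_neighbourhood[OF B atlas base local_triv_open[OF triv_local_triv[OF V(1)]] V(2)] by blast
  have o: "open (\<xi> ` ((W \<inter> Z) \<inter> X))" using open_chart_image[OF B _ X(1)] W(1) Z(1) by blast
  have "smooth_in X \<xi> U \<phi> (\<lambda>y. bproj M (F y)) x"
    using base U by (intro smooth_atD[OF _ B atlas X(1) U(1) X(2)]) auto
  then obtain N1 where N1: "open N1" "\<xi> x \<in> N1" "N1 \<subseteq> \<xi> ` X"
    "\<And>a. a \<in> N1 \<Longrightarrow> bproj M (F (inv_into X \<xi> a)) \<in> U"
    "smooth_on N1 (\<lambda>a. \<phi> (bproj M (F (inv_into X \<xi> a))))"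
    unfolding smooth_in_def by blast
  obtain N2 where N2: "open N2" "\<xi> x \<in> N2" "smooth_on N2 (\<lambda>a. \<tau> (F (inv_into X \<xi> a)))"
    using fib unfolding smooth_real_at_iff[OF B X] by blast
  define N where "N = N1 \<inter> N2 \<inter> \<xi> ` ((W \<inter> Z) \<inter> X)"
  have N: "open N" using o N1 N2 by (auto simp: N_def)
  have "smooth_on N (\<lambda>a. (\<phi> (bproj M (F (inv_into X \<xi> a))), \<tau> (F (inv_into X \<xi> a))))"
    by (intro smooth_on_Pair N smooth_on_subset[OF N1(5)] smooth_on_subset[OF N2(3)]) (auto simp: N_def)
  moreover have "F (inv_into X \<xi> a) \<in> ?C" if "a \<in> N" for a
  proof -
    have "inv_into X \<xi> a \<in> W \<inter> Z" using that smooth_atlasD(1)[OF B X(1)] by (auto simp: N_def)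
    then show ?thesis using W(3) Z(3) N1(4) that by (auto simp: N_def)
  qed
  moreover have "\<xi> x \<in> N" using N1 N2 W(2) Z(2) X(2) by (auto simp: N_def)
  moreover have "N \<subseteq> \<xi> ` X" using N1(3) by (auto simp: N_def)
  ultimately have "smooth_in X \<xi> ?C ?\<kappa> F x" unfolding smooth_in_def using N by blast
  then show ?thesis
    using Fx U V by (intro smooth_atI[where F=F, OF X(1) C X(2)]) auto
qed

subsection \<open>Sections\<close>

lemma sections_in_fibre: "s \<in> sections A M \<Longrightarrow> x \<in> points A \<Longrightarrow> s x \<in> fibre M x"
  by (auto simp: sections_def smooth_map_def points_total_atlas mem_fibre)

lemma sections_smooth_at: "s \<in> sections A M \<Longrightarrow> x \<in> points A \<Longrightarrow> smooth_at A (total_atlas A M) s x"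
  by (simp add: sections_def smooth_map_iff[OF atlas smooth_atlas_total])

lemma sections_coord_smooth:
  assumes s: "s \<in> sections A M" and U: "local_triv A M U \<tau>" and x: "x \<in> U"
  shows "smooth_real_at A (\<lambda>y. \<tau> (s y)) x"
proof -
  have xA: "x \<in> points A" using local_triv_subset[OF U] x by blast
  then obtain V \<sigma> where V: "(V, \<sigma>) \<in> triv M" "x \<in> V" by (rule obtain_triv)
  have sx: "s x \<in> total_space M" "bproj M (s x) = x"
    using sections_in_fibre[OF s xA] by (auto simp: mem_fibre)
  have "smooth_real_at A (\<lambda>y. \<sigma> (s y)) x"
    using smooth_at_compose[OF sections_smooth_at[OF s xA] smooth_at_triv[OF sx(1) V(1)]]
      atlas smooth_atlas_total smooth_atlas_real sx(2) V(2) by simp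
  then have "smooth_real_at A (\<lambda>y. \<sigma> (s y) * \<tau> (frame M \<sigma> y)) x"
    by (rule smooth_real_at_mult[OF atlas _ transition_smooth[OF U triv_local_triv[OF V(1)] x V(2)]])
  then show ?thesis
  proof (rule smooth_at_cong[OF atlas])
    show "open_in A (U \<inter> V)"
      using local_triv_open U triv_local_triv[OF V(1)] by blast
    show "x \<in> U \<inter> V" using x V by blast
    show "\<sigma> (s y) * \<tau> (frame M \<sigma> y) = \<tau> (s y)" if "y \<in> U \<inter> V" for y
      using coord_change[OF local_triv_coord[OF triv_local_triv[OF V(1)]] local_triv_coord[OF U], of y "s y"]
        that sections_in_fibre[OF s] local_triv_subset[OF U] by auto
  qed
qed

text \<open>
  The trivialization may be chosen for each point and need not belong to \<^term>\<open>triv M\<close>; for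
  quotient bundles the invariant ones are convenient.
\<close>

lemma sectionsI:
  assumes ext: "s \<in> extensional (points A)" and fib: "\<And>x. x \<in> points A \<Longrightarrow> s x \<in> fibre M x"
    and sm: "\<And>x. x \<in> points A \<Longrightarrow> \<exists>U \<tau>. local_triv A M U \<tau> \<and> x \<in> U \<and> smooth_real_at A (\<lambda>y. \<tau> (s y)) x"
  shows "s \<in> sections A M"
proof -
  have "smooth_at A (total_atlas A M) s x" if x: "x \<in> points A" for x
  proof -
    obtain U \<tau> where U: "local_triv A M U \<tau>" "x \<in> U" "smooth_real_at A (\<lambda>y. \<tau> (s y)) x"
      using sm[OF x] by blast
    obtain V \<sigma> where V: "(V, \<sigma>) \<in> triv M" "x \<in> V" using obtain_triv[OF x] .
    have "smooth_real_at A (\<lambda>y. \<tau> (s y) * \<sigma> (frame M \<tau> y)) x"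
      by (rule smooth_real_at_mult[OF atlas U(3) transition_smooth[OF triv_local_triv[OF V(1)] U(1) V(2) U(2)]])
    then have s1: "smooth_real_at A (\<lambda>y. \<sigma> (s y)) x"
    proof (rule smooth_at_cong[OF atlas])
      show "open_in A (U \<inter> V)"
        using local_triv_open U triv_local_triv[OF V(1)] by blast
      show "x \<in> U \<inter> V" using U V by blast
      show "\<tau> (s y) * \<sigma> (frame M \<tau> y) = \<sigma> (s y)" if "y \<in> U \<inter> V" for y
        using coord_change[OF local_triv_coord[OF U(1)] local_triv_coord[OF triv_local_triv[OF V(1)]], of y "s y"]
          that fib local_triv_subset[OF U(1)] by auto
    qed
    note opA = openin_points[OF atlas]
    have "smooth_at A A (\<lambda>y. y) x" by (rule smooth_at_ident[OF atlas x])
    then have "smooth_at A A (\<lambda>y. bproj M (s y)) x"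
      by (rule smooth_at_cong[OF atlas _ opA x]) (use fib in \<open>auto simp: mem_fibre\<close>)
    then show ?thesis
      using fib x V s1
      by (intro smooth_at_totalI[OF atlas opA x, where V=V and \<tau>=\<sigma>]) (auto simp: mem_fibre)
  qed
  then show ?thesis
    using ext fib by (auto simp: sections_def smooth_map_iff[OF atlas smooth_atlas_total] points_total_atlas mem_fibre)
qed

lemma sec_add_in_sections:
  assumes s: "s \<in> sections A M" and t: "t \<in> sections A M"
  shows "sec_add A M s t \<in> sections A M"
proof (rule sectionsI)
  fix x assume x: "x \<in> points A"
  show "sec_add A M s t x \<in> fibre M x"
    using x sections_in_fibre[OF s] sections_in_fibre[OF t] fadd_in_fibre by (simp add: sec_add_def)
  obtain V \<sigma> where V: "(V, \<sigma>) \<in> triv M" "x \<in> V" using obtain_triv[OF x] .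
  note V' = triv_local_triv[OF V(1)]
  have "smooth_real_at A (\<lambda>y. \<sigma> (s y) + \<sigma> (t y)) x"
    by (rule smooth_real_at_add[OF atlas sections_coord_smooth[OF s V' V(2)] sections_coord_smooth[OF t V' V(2)]])
  then have "smooth_real_at A (\<lambda>y. \<sigma> (sec_add A M s t y)) x"
  proof (rule smooth_at_cong[OF atlas _ local_triv_open[OF V'] V(2)])
    fix y assume y: "y \<in> V"
    then have "y \<in> points A" using local_triv_subset[OF V'] by blast
    then show "\<sigma> (s y) + \<sigma> (t y) = \<sigma> (sec_add A M s t y)"
      using coord_add[OF local_triv_coord[OF V' y]] sections_in_fibre[OF s] sections_in_fibre[OF t]
      by (simp add: sec_add_def)
  qed
  then show "\<exists>U \<tau>. local_triv A M U \<tau> \<and> x \<in> U \<and> smooth_real_at A (\<lambda>y. \<tau> (sec_add A M s t y)) x"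
    using V V' by blast
qed (simp add: sec_add_def)

lemma sec_scale_in_sections:
  assumes s: "s \<in> sections A M" and f: "\<And>x. x \<in> points A \<Longrightarrow> smooth_real_at A f x"
  shows "sec_scale A M f s \<in> sections A M"
proof (rule sectionsI)
  fix x assume x: "x \<in> points A"
  show "sec_scale A M f s x \<in> fibre M x"
    using x sections_in_fibre[OF s] fscale_in_fibre by (simp add: sec_scale_def)
  obtain V \<sigma> where V: "(V, \<sigma>) \<in> triv M" "x \<in> V" using obtain_triv[OF x] .
  note V' = triv_local_triv[OF V(1)]
  have "smooth_real_at A (\<lambda>y. f y * \<sigma> (s y)) x"
    by (rule smooth_real_at_mult[OF atlas f[OF x] sections_coord_smooth[OF s V' V(2)]])
  then have "smooth_real_at A (\<lambda>y. \<sigma> (sec_scale A M f s y)) x"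
  proof (rule smooth_at_cong[OF atlas _ local_triv_open[OF V'] V(2)])
    fix y assume y: "y \<in> V"
    then have "y \<in> points A" using local_triv_subset[OF V'] by blast
    then show "f y * \<sigma> (s y) = \<sigma> (sec_scale A M f s y)"
      using coord_scale[OF local_triv_coord[OF V' y]] sections_in_fibre[OF s]
      by (simp add: sec_scale_def)
  qed
  then show "\<exists>U \<tau>. local_triv A M U \<tau> \<and> x \<in> U \<and> smooth_real_at A (\<lambda>y. \<tau> (sec_scale A M f s y)) x"
    using V V' by blast
qed (simp add: sec_scale_def)

end

section \<open>Sections that do not vanish at a point\<close>

lemma compactin_chart_cball:
  fixes A :: "('a, 'e::finite_dim_inner) chart set"
  assumes A: "smooth_atlas A" "(U, \<phi>) \<in> A" and c: "cball c r \<subseteq> \<phi> ` U"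
  shows "compactin (atlas_topology A) (inv_into U \<phi> ` cball c r)"
proof (rule image_compactin)
  show "compactin (top_of_set (\<phi> ` U)) (cball c r)"
    using c compact_cball_finite_dim by (simp add: compactin_subtopology)
  show "continuous_map (top_of_set (\<phi> ` U)) (atlas_topology A) (inv_into U \<phi>)"
  proof (subst continuous_map_def, intro conjI allI impI)
    show "inv_into U \<phi> \<in> topspace (top_of_set (\<phi> ` U)) \<rightarrow> topspace (atlas_topology A)"
      using chart_in_points[OF A(2)] A by (auto simp: inv_into_into)
    fix W assume W: "open_in A W"
    have "{a \<in> topspace (top_of_set (\<phi> ` U)). inv_into U \<phi> a \<in> W} = \<phi> ` (W \<inter> U)"
      using smooth_atlasD(1)[OF A] by auto
    then show "openin (top_of_set (\<phi> ` U)) {a \<in> topspace (top_of_set (\<phi> ` U)). inv_into U \<phi> a \<in> W}"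
      using open_chart_image[OF A(1) W A(2)] by (auto intro!: open_openin_trans simp: smooth_atlasD(2)[OF A])
  qed
qed

context smooth_line_bundle
begin

text \<open>
  A bump function times a local frame, extended by zero. The support of the bump function is a
  compact set \<open>C\<close>, which is closed as the manifold is Hausdorff; outside \<open>V \<inter> U\<close> the section is
  smooth because it vanishes on the open complement of \<open>C\<close>. That it does not vanish at \<open>x0\<close> is
  stated as injectivity of scalar multiplication, the form in which it is used for division.
\<close>

lemma ex_nonvanishing_section:
  assumes haus: "Hausdorff_space (atlas_topology A)" and x0: "x0 \<in> points A"
  shows "\<exists>s\<in>sections A M. \<forall>a b. fscale M a (s x0) = fscale M b (s x0) \<longrightarrow> a = b"
proof -
  obtain V \<tau> where V: "(V, \<tau>) \<in> triv M" "x0 \<in> V" using obtain_triv[OF x0] .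
  note V' = triv_local_triv[OF V(1)]
  obtain U \<phi> where U: "(U, \<phi>) \<in> A" "x0 \<in> U" using points_obtain_chart[OF x0] .
  note inj = smooth_atlasD(1)[OF atlas U(1)]
  have "open (\<phi> ` (V \<inter> U))" by (rule open_chart_image[OF atlas local_triv_open[OF V'] U(1)])
  then obtain r where r: "r > 0" "cball (\<phi> x0) r \<subseteq> \<phi> ` (V \<inter> U)"
    using U V open_contains_cball by (metis IntI image_eqI)
  define C where "C = inv_into U \<phi> ` cball (\<phi> x0) r"
  have "compactin (atlas_topology A) C"
    unfolding C_def using r by (intro compactin_chart_cball[OF atlas U(1)]) auto
  then have "closedin (atlas_topology A) C" using haus by (rule compactin_imp_closedin[rotated])
  then have opC: "open_in A (points A - C)"
    by (simp add: closedin_def atlas)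
  have opUV: "open_in A (V \<inter> U)"
    using local_triv_open[OF V'] openin_chart[OF atlas U(1)] by blast
  have CV: "C \<subseteq> V \<inter> U" unfolding C_def using r(2) inj by auto
  define \<rho> where "\<rho> x = bump (\<phi> x0) r (\<phi> x)" for x
  define s where "s = (\<lambda>x\<in>points A. if x \<in> V \<inter> U then fscale M (\<rho> x) (frame M \<tau> x)
    else fscale M 0 (SOME l. l \<in> fibre M x))"
  have ex: "\<exists>l. l \<in> fibre M x" if "x \<in> points A" for x
    using fibre_nonempty[OF that] by blast
  note c = local_triv_coord[OF V']
  have sfib: "s x \<in> fibre M x" if x: "x \<in> points A" for x
    using x frame_in_fibre[OF c, of x] someI_ex[OF ex[OF x]] fscale_in_fibre by (auto simp: s_def)
  have s_in: "\<tau> (s x) = \<rho> x" if "x \<in> V \<inter> U" for x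
    using that local_triv_subset[OF V'] coord_scale[OF c frame_in_fibre[OF c], of x] coord_frame[OF c, of x]
    by (auto simp: s_def)
  have s_out: "\<sigma> (s x) = 0" if x: "x \<in> points A - C" and \<sigma>: "fibre_coord M x \<sigma>" for x \<sigma>
  proof (cases "x \<in> V \<inter> U")
    case True
    have "\<phi> x \<notin> ball (\<phi> x0) r"
    proof
      assume "\<phi> x \<in> ball (\<phi> x0) r"
      then have "\<phi> x \<in> cball (\<phi> x0) r" by simp
      moreover have "x = inv_into U \<phi> (\<phi> x)" using True inj by simp
      ultimately show False using x unfolding C_def by blast
    qed
    then have "\<rho> x = 0" unfolding \<rho>_def by (rule bump_eq_0[OF r(1)])
    then show ?thesis
      using True x coord_scale[OF \<sigma> frame_in_fibre[OF c], of 0] by (simp add: s_def)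
  next
    case False
    then show ?thesis
      using x coord_scale[OF \<sigma> someI_ex[OF ex], of 0] by (auto simp: s_def)
  qed
  have "s \<in> sections A M"
  proof (rule sectionsI)
    fix x assume x: "x \<in> points A"
    show "s x \<in> fibre M x" by (rule sfib[OF x])
    show "\<exists>U \<tau>. local_triv A M U \<tau> \<and> x \<in> U \<and> smooth_real_at A (\<lambda>y. \<tau> (s y)) x"
    proof (cases "x \<in> V \<inter> U")
      case True
      have "smooth_on (\<phi> ` U) (\<lambda>a. bump (\<phi> x0) r a)"
        by (rule smooth_on_bump[OF smooth_atlasD(2)[OF atlas U(1)]])
      then have "smooth_on (\<phi> ` U) (\<lambda>a. \<rho> (inv_into U \<phi> a))"
        by (rule smooth_on_cong[OF _ smooth_atlasD(2)[OF atlas U(1)]]) (use inj in \<open>auto simp: \<rho>_def\<close>)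
      then have "smooth_real_at A \<rho> x"
        using True smooth_atlasD(2)[OF atlas U(1)]
        by (subst smooth_real_at_iff[OF atlas U(1)]) (auto intro!: exI[of _ "\<phi> ` U"])
      then have "smooth_real_at A (\<lambda>y. \<tau> (s y)) x"
        by (rule smooth_at_cong[OF atlas _ opUV True]) (use s_in in auto)
      then show ?thesis using V' True by blast
    next
      case False
      obtain W \<sigma> where W: "(W, \<sigma>) \<in> triv M" "x \<in> W" using obtain_triv[OF x] .
      note W' = triv_local_triv[OF W(1)]
      have "smooth_real_at A (\<lambda>y. \<sigma> (s y)) x"
      proof (rule smooth_at_cong[OF atlas smooth_real_at_const[OF atlas x]])
        show "open_in A ((points A - C) \<inter> W)" using opC local_triv_open[OF W'] by blast
        show "x \<in> (points A - C) \<inter> W" using x W False CV by blast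
        show "0 = \<sigma> (s y)" if "y \<in> (points A - C) \<inter> W" for y
          using s_out[of y \<sigma>] local_triv_coord[OF W', of y] that by auto
      qed
      then show ?thesis using W' W by blast
    qed
  qed (simp add: s_def)
  moreover have "a = b" if "fscale M a (s x0) = fscale M b (s x0)" for a b
  proof -
    have "\<rho> x0 > 0" unfolding \<rho>_def by (rule bump_center[OF r(1)])
    moreover have "a * \<rho> x0 = b * \<rho> x0"
      using that coord_scale[OF c[OF V(2)] sfib[OF x0]] s_in U V by (metis IntI)
    ultimately show ?thesis by simp
  qed
  ultimately show ?thesis by blast
qed

section \<open>The dual bundle\<close>

definition dual_coord :: "('l \<Rightarrow> real) \<Rightarrow> 'k \<times> ('l \<Rightarrow> real) \<Rightarrow> real" where
  "dual_coord \<tau> = (\<lambda>(x, \<alpha>). \<alpha> (frame M \<tau> x))"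

lemma total_dual:
  "(x, \<alpha>) \<in> total_space (dual_bundle M) \<longleftrightarrow>
    x \<in> points A \<and> \<alpha> \<in> extensional (fibre M x) \<and> linear_on_fibre M x \<alpha>"
proof -
  have "bproj M ` total_space M = points A"
  proof (intro equalityI subsetI)
    fix x assume "x \<in> points A"
    then obtain l where "l \<in> fibre M x" using fibre_nonempty by blast
    then show "x \<in> bproj M ` total_space M" by (auto simp: mem_fibre)
  qed (use bproj_in_points in auto)
  then show ?thesis by (simp add: dual_bundle_def)
qed

lemma fibre_dual:
  "d \<in> fibre (dual_bundle M) x \<longleftrightarrow>
    x \<in> points A \<and> (\<exists>\<alpha>. d = (x, \<alpha>) \<and> \<alpha> \<in> extensional (fibre M x) \<and> linear_on_fibre M x \<alpha>)"
proof -
  have "bproj (dual_bundle M) = fst" by (simp add: dual_bundle_def)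
  then show ?thesis using total_dual[of "fst d" "snd d"] by (cases d) (auto simp: mem_fibre)
qed

lemma dual_ops:
  "bproj (dual_bundle M) = fst"
  "fadd (dual_bundle M) (x, \<alpha>) (y, \<beta>) = (x, \<lambda>l\<in>fibre M x. \<alpha> l + \<beta> l)"
  "fscale (dual_bundle M) c (x, \<alpha>) = (x, \<lambda>l\<in>fibre M x. c * \<alpha> l)"
  by (simp_all add: dual_bundle_def)

text \<open>
  The functional with coordinate \<open>r\<close> is \<open>r \<tau>\<close>; in particular the dual frame is \<open>\<tau>\<close> itself.
\<close>

lemma dual_coord_fibre:
  assumes x: "x \<in> points A" and c: "fibre_coord M x \<tau>"
  shows "fibre_coord (dual_bundle M) x (dual_coord \<tau>)"
    and "frame (dual_bundle M) (dual_coord \<tau>) x = (x, \<lambda>l\<in>fibre M x. \<tau> l)"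
proof -
  note f = frame_in_fibre[OF c]
  have bij: "bij_betw (dual_coord \<tau>) (fibre (dual_bundle M) x) UNIV"
    unfolding bij_betw_def
  proof
    show "inj_on (dual_coord \<tau>) (fibre (dual_bundle M) x)"
    proof (rule inj_onI)
      fix d e assume "d \<in> fibre (dual_bundle M) x" "e \<in> fibre (dual_bundle M) x" "dual_coord \<tau> d = dual_coord \<tau> e"
      then obtain \<alpha> \<beta> where d: "d = (x, \<alpha>)" "\<alpha> \<in> extensional (fibre M x)" "linear_on_fibre M x \<alpha>"
        and e: "e = (x, \<beta>)" "\<beta> \<in> extensional (fibre M x)" "linear_on_fibre M x \<beta>"
        and eq: "\<alpha> (frame M \<tau> x) = \<beta> (frame M \<tau> x)"
        by (auto simp: fibre_dual dual_coord_def)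
      have "\<alpha> = \<beta>"
        by (rule extensionalityI[OF d(2) e(2)])
          (simp add: linear_functional_eq[OF c d(3)] linear_functional_eq[OF c e(3)] eq)
      then show "d = e" by (simp add: d e)
    qed
    show "dual_coord \<tau> ` fibre (dual_bundle M) x = UNIV"
    proof (intro equalityI subsetI UNIV_I)
      fix r :: real
      have "(x, \<lambda>l\<in>fibre M x. r * \<tau> l) \<in> fibre (dual_bundle M) x"
        using x coord_add[OF c] coord_scale[OF c] fadd_in_fibre fscale_in_fibre
        by (auto simp: fibre_dual linear_on_fibre_def algebra_simps)
      moreover have "dual_coord \<tau> (x, \<lambda>l\<in>fibre M x. r * \<tau> l) = r"
        using f coord_frame[OF c] by (simp add: dual_coord_def)
      ultimately show "r \<in> dual_coord \<tau> ` fibre (dual_bundle M) x" by (metis image_eqI)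
    qed
  qed
  have "linear_on_fibre (dual_bundle M) x (dual_coord \<tau>)"
    unfolding linear_on_fibre_def
    using f by (auto simp: fibre_dual dual_coord_def dual_ops)
  then show c': "fibre_coord (dual_bundle M) x (dual_coord \<tau>)" using bij by (simp add: fibre_coord_def)
  show "frame (dual_bundle M) (dual_coord \<tau>) x = (x, \<lambda>l\<in>fibre M x. \<tau> l)"
  proof (rule frame_unique[OF c', symmetric])
    show "(x, \<lambda>l\<in>fibre M x. \<tau> l) \<in> fibre (dual_bundle M) x"
      using x coord_add[OF c] coord_scale[OF c] fadd_in_fibre fscale_in_fibre
      by (auto simp: fibre_dual linear_on_fibre_def)
    show "dual_coord \<tau> (x, \<lambda>l\<in>fibre M x. \<tau> l) = 1"
      using f coord_frame[OF c] by (simp add: dual_coord_def)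
  qed
qed

lemma triv_dual: "triv (dual_bundle M) = {(U, dual_coord \<tau>) | U \<tau>. (U, \<tau>) \<in> triv M}"
  by (simp add: dual_bundle_def dual_coord_def)

lemma dual_transition:
  assumes "x \<in> points A" "fibre_coord M x \<sigma>" "fibre_coord M x \<tau>"
  shows "dual_coord \<tau> (frame (dual_bundle M) (dual_coord \<sigma>) x) = \<sigma> (frame M \<tau> x)"
  using dual_coord_fibre(2)[OF assms(1,2)] frame_in_fibre[OF assms(3)] by (simp add: dual_coord_def)

text \<open>
  Since the dual frame of \<open>\<sigma>\<close> is \<open>\<sigma>\<close>, transition functions of the dual bundle are those of \<open>M\<close>
  with the two trivializations interchanged.
\<close>

lemma local_triv_dual:
  assumes U: "local_triv A M U \<tau>"
  shows "local_triv A (dual_bundle M) U (dual_coord \<tau>)"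
  unfolding local_triv_def
proof (intro conjI ballI; (clarify)?)
  show "open_in A U" by (rule local_triv_open[OF U])
  have c: "fibre_coord (dual_bundle M) x (dual_coord \<tau>)" if "x \<in> U" for x
    using that local_triv_subset[OF U] local_triv_coord[OF U] by (intro dual_coord_fibre) auto
  show "linear_on_fibre (dual_bundle M) x (dual_coord \<tau>)"
    "bij_betw (dual_coord \<tau>) (fibre (dual_bundle M) x) UNIV" if "x \<in> U" for x
    using c[OF that] by (auto simp: fibre_coord_def)
  fix V \<sigma>' assume "(V, \<sigma>') \<in> triv (dual_bundle M)"
  then obtain \<sigma> where V: "(V, \<sigma>) \<in> triv M" and \<sigma>': "\<sigma>' = dual_coord \<sigma>" by (auto simp: triv_dual)
  note V' = triv_local_triv[OF V]
  have o: "open_in A (U \<inter> V)" using local_triv_open[OF U] local_triv_open[OF V'] by blast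
  show "smooth_map (sub_atlas A (U \<inter> V)) real_atlas (\<lambda>x. dual_coord \<tau> (frame (dual_bundle M) \<sigma>' x))"
    unfolding smooth_map_sub_atlas_iff[OF atlas o]
  proof
    fix x assume x: "x \<in> U \<inter> V"
    then have "smooth_real_at A (\<lambda>y. \<sigma> (frame M \<tau> y)) x"
      by (intro transition_smooth[OF V' U]) auto
    then show "smooth_real_at A (\<lambda>x. dual_coord \<tau> (frame (dual_bundle M) \<sigma>' x)) x"
    proof (rule smooth_at_cong[OF atlas _ o x])
      fix y assume y: "y \<in> U \<inter> V"
      then have "y \<in> points A" using local_triv_subset[OF U] by blast
      then show "\<sigma> (frame M \<tau> y) = dual_coord \<tau> (frame (dual_bundle M) \<sigma>' y)"
        using dual_transition[of y \<sigma> \<tau>] local_triv_coord[OF U] local_triv_coord[OF V'] y by (simp add: \<sigma>')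
    qed
  qed
qed

lemma line_bundle_dual: "line_bundle A (dual_bundle M)"
  unfolding line_bundle_def
proof (intro conjI)
  show "bproj (dual_bundle M) \<in> total_space (dual_bundle M) \<rightarrow> points A"
    using total_dual by (auto simp: dual_ops)
  show "\<forall>x. \<forall>a\<in>fibre (dual_bundle M) x. \<forall>b\<in>fibre (dual_bundle M) x.
      fadd (dual_bundle M) a b \<in> fibre (dual_bundle M) x"
    using fadd_in_fibre fscale_in_fibre
    by (auto simp: fibre_dual dual_ops linear_on_fibre_def algebra_simps)
  show "\<forall>x c. \<forall>a\<in>fibre (dual_bundle M) x. fscale (dual_bundle M) c a \<in> fibre (dual_bundle M) x"
    using fadd_in_fibre fscale_in_fibre
    by (auto simp: fibre_dual dual_ops linear_on_fibre_def algebra_simps)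
  show "points A = (\<Union>(U, \<tau>)\<in>triv (dual_bundle M). U)"
    using is_bundle unfolding line_bundle_def triv_dual by auto
  show "\<forall>(U, \<tau>)\<in>triv (dual_bundle M). local_triv A (dual_bundle M) U \<tau>"
    using local_triv_dual[OF triv_local_triv] unfolding triv_dual by blast
qed

end

section \<open>Isomorphisms of line bundles over the identity\<close>

lemma inv_into_on_points:
  assumes "bij_betw F S T" "y \<in> T" shows "inv_into S F y \<in> S" "F (inv_into S F y) = y"
  using assms by (auto simp: bij_betw_def inv_into_into f_inv_into_f)

text \<open>
  If \<open>F\<close> is the identity in suitable trivializations, all requirements on an isomorphism can be
  read off in fibre coordinates: linearity and bijectivity fibre by fibre, and smoothness of \<open>F\<close>
  and its inverse because both preserve base point and coordinate.
\<close>

lemma line_bundle_iso_of_trivs: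
  fixes A :: "('k, 'e::finite_dim_inner) chart set" and M :: "('k, 'l) pre_bundle" and N :: "('k, 'n) pre_bundle"
  assumes M: "smooth_line_bundle A M" and N: "smooth_line_bundle A N"
    and F: "\<And>x l. l \<in> fibre M x \<Longrightarrow> F l \<in> fibre N x"
    and triv: "\<And>x. x \<in> points A \<Longrightarrow> \<exists>U \<tau> \<sigma>. (U, \<tau>) \<in> triv M \<and> (U, \<sigma>) \<in> triv N \<and> x \<in> U \<and>
      (\<forall>l\<in>total_space M. bproj M l \<in> U \<longrightarrow> \<sigma> (F l) = \<tau> l)"
  shows "line_bundle_iso A M A N F (\<lambda>y. y)"
proof -
  interpret M: smooth_line_bundle A M by (rule M)
  interpret N: smooth_line_bundle A N by (rule N)
  note A = M.atlas
  have Ft: "F l \<in> total_space N" "bproj N (F l) = bproj M l" if "l \<in> total_space M" for l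
    using F[of l "bproj M l"] that by (auto simp: mem_fibre)
  have coord: "\<exists>\<tau> \<sigma>. fibre_coord M x \<tau> \<and> fibre_coord N x \<sigma> \<and> (\<forall>l\<in>fibre M x. \<sigma> (F l) = \<tau> l)"
    if x: "x \<in> points A" for x
    using triv[OF x] M.local_triv_coord[OF M.triv_local_triv] N.local_triv_coord[OF N.triv_local_triv]
    by (fastforce simp: mem_fibre)
  have add: "F (fadd M a b) = fadd N (F a) (F b)" if ab: "a \<in> fibre M x" "b \<in> fibre M x" for a b x
  proof -
    have "x \<in> points A" using ab M.bproj_in_points by (auto simp: mem_fibre)
    then obtain \<tau> \<sigma> where c: "fibre_coord M x \<tau>" "fibre_coord N x \<sigma>" "\<forall>l\<in>fibre M x. \<sigma> (F l) = \<tau> l"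
      using coord by blast
    show ?thesis
      using ab F M.fadd_in_fibre N.fadd_in_fibre c(3) coord_add[OF c(1)] coord_add[OF c(2)]
      by (intro fibre_coord_inj[OF c(2)]) auto
  qed
  have scale: "F (fscale M r a) = fscale N r (F a)" if a: "a \<in> fibre M x" for a r x
  proof -
    have "x \<in> points A" using a M.bproj_in_points by (auto simp: mem_fibre)
    then obtain \<tau> \<sigma> where c: "fibre_coord M x \<tau>" "fibre_coord N x \<sigma>" "\<forall>l\<in>fibre M x. \<sigma> (F l) = \<tau> l"
      using coord by blast
    show ?thesis
      using a F M.fscale_in_fibre N.fscale_in_fibre c(3) coord_scale[OF c(1)] coord_scale[OF c(2)]
      by (intro fibre_coord_inj[OF c(2)]) auto
  qed
  have bij: "bij_betw F (total_space M) (total_space N)"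
    unfolding bij_betw_def
  proof
    show "inj_on F (total_space M)"
    proof (rule inj_onI)
      fix l l' assume l: "l \<in> total_space M" "l' \<in> total_space M" "F l = F l'"
      then have b: "bproj M l' = bproj M l" using Ft by metis
      obtain \<tau> \<sigma> where c: "fibre_coord M (bproj M l) \<tau>" "\<forall>l'\<in>fibre M (bproj M l). \<sigma> (F l') = \<tau> l'"
        using coord[OF M.bproj_in_points[OF l(1)]] by blast
      have m: "l \<in> fibre M (bproj M l)" "l' \<in> fibre M (bproj M l)" using l b by (auto simp: mem_fibre)
      have "\<tau> l = \<tau> l'" using c(2) m l(3) by metis
      then show "l = l'" using fibre_coord_inj[OF c(1) m] by blast
    qed
    show "F ` total_space M = total_space N"
    proof (intro equalityI subsetI)
      fix n assume n: "n \<in> total_space N"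
      define x where "x = bproj N n"
      obtain \<tau> \<sigma> where c: "fibre_coord M x \<tau>" "fibre_coord N x \<sigma>" "\<forall>l\<in>fibre M x. \<sigma> (F l) = \<tau> l"
        using coord N.bproj_in_points[OF n] unfolding x_def by blast
      obtain l where l: "l \<in> fibre M x" "\<tau> l = \<sigma> n"
        using c(1) unfolding fibre_coord_def bij_betw_def by (metis UNIV_I image_iff)
      have "F l = n"
        using c(3) l F n by (intro fibre_coord_inj[OF c(2)]) (auto simp: mem_fibre x_def)
      then show "n \<in> F ` total_space M" using l by (auto simp: mem_fibre)
    qed (use Ft in auto)
  qed
  let ?G = "inv_into (total_space M) F"
  have G: "?G n \<in> total_space M" "F (?G n) = n" "bproj M (?G n) = bproj N n" if n: "n \<in> total_space N" for n
    using inv_into_on_points[OF bij n] Ft by metis+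
  have opM: "open_in (total_atlas A M) (total_space M)"
    using openin_points[OF M.smooth_atlas_total] by (simp add: M.points_total_atlas)
  have opN: "open_in (total_atlas A N) (total_space N)"
    using openin_points[OF N.smooth_atlas_total] by (simp add: N.points_total_atlas)
  have smF: "smooth_at (total_atlas A M) (total_atlas A N) F l" if l: "l \<in> total_space M" for l
  proof -
    obtain U \<tau> \<sigma> where U: "(U, \<tau>) \<in> triv M" "(U, \<sigma>) \<in> triv N" "bproj M l \<in> U"
      and eq: "\<forall>l\<in>total_space M. bproj M l \<in> U \<longrightarrow> \<sigma> (F l) = \<tau> l"
      using triv[OF M.bproj_in_points[OF l]] by blast
    obtain Z where Z: "open_in (total_atlas A M) Z" "l \<in> Z" "\<And>l. l \<in> Z \<Longrightarrow> bproj M l \<in> U"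
      using smooth_at_neighbourhood[OF M.smooth_atlas_total A M.smooth_at_bproj[OF l]
        M.local_triv_open[OF M.triv_local_triv[OF U(1)]] U(3)] by blast
    show ?thesis
    proof (rule N.smooth_at_totalI[OF M.smooth_atlas_total opM l Ft(1) _ U(2)])
      show "smooth_at (total_atlas A M) A (\<lambda>l. bproj N (F l)) l"
        by (rule smooth_at_cong[OF M.smooth_atlas_total M.smooth_at_bproj[OF l] opM l]) (simp add: Ft)
      show "bproj N (F l) \<in> U" using U(3) Ft(2)[OF l] by simp
      show "smooth_real_at (total_atlas A M) (\<lambda>l. \<sigma> (F l)) l"
      proof (rule smooth_at_cong[OF M.smooth_atlas_total M.smooth_at_triv[OF l U(1,3)]])
        show "open_in (total_atlas A M) (total_space M \<inter> Z)" using opM Z by blast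
      qed (use Z l eq in auto)
    qed
  qed
  have smG: "smooth_at (total_atlas A N) (total_atlas A M) ?G n" if n: "n \<in> total_space N" for n
  proof -
    obtain U \<tau> \<sigma> where U: "(U, \<tau>) \<in> triv M" "(U, \<sigma>) \<in> triv N" "bproj N n \<in> U"
      and eq: "\<forall>l\<in>total_space M. bproj M l \<in> U \<longrightarrow> \<sigma> (F l) = \<tau> l"
      using triv[OF N.bproj_in_points[OF n]] by blast
    obtain Z where Z: "open_in (total_atlas A N) Z" "n \<in> Z" "\<And>n. n \<in> Z \<Longrightarrow> bproj N n \<in> U"
      using smooth_at_neighbourhood[OF N.smooth_atlas_total A N.smooth_at_bproj[OF n]
        N.local_triv_open[OF N.triv_local_triv[OF U(2)]] U(3)] by blast
    show ?thesis
    proof (rule M.smooth_at_totalI[OF N.smooth_atlas_total opN n G(1) _ U(1)])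
      show "smooth_at (total_atlas A N) A (\<lambda>n. bproj M (?G n)) n"
        by (rule smooth_at_cong[OF N.smooth_atlas_total N.smooth_at_bproj[OF n] opN n]) (simp add: G)
      show "bproj M (?G n) \<in> U" using U(3) G(3)[OF n] by simp
      show "smooth_real_at (total_atlas A N) (\<lambda>n. \<tau> (?G n)) n"
      proof (rule smooth_at_cong[OF N.smooth_atlas_total N.smooth_at_triv[OF n U(2,3)]])
        show "open_in (total_atlas A N) (total_space N \<inter> Z)" using opN Z by blast
        show "\<sigma> n' = \<tau> (?G n')" if "n' \<in> total_space N \<inter> Z" for n'
          using that eq G[of n'] Z(3)[of n'] by (metis IntE)
      qed (use Z n in auto)
    qed
  qed
  have "diffeo (total_atlas A M) (total_atlas A N) F"
    unfolding diffeo_def smooth_map_iff[OF M.smooth_atlas_total N.smooth_atlas_total]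
      smooth_map_iff[OF N.smooth_atlas_total M.smooth_atlas_total] M.points_total_atlas N.points_total_atlas
    using bij smF smG Ft G by auto
  moreover have "diffeo A A (\<lambda>y. y)"
  proof -
    have "smooth_at A A (inv_into (points A) (\<lambda>y. y)) x" if x: "x \<in> points A" for x
    proof (rule smooth_at_cong[OF A smooth_at_ident[OF A x] openin_points[OF A] x])
      show "y = inv_into (points A) (\<lambda>y. y) y" if "y \<in> points A" for y
        using that by (metis f_inv_into_f image_ident)
    qed
    moreover have "inv_into (points A) (\<lambda>y. y) x \<in> points A" if "x \<in> points A" for x
      using that by (metis image_ident inv_into_into)
    ultimately show ?thesis
      unfolding diffeo_def smooth_map_iff[OF A A] using smooth_at_ident[OF A] by (auto simp: bij_betw_def)
  qed
  ultimately show ?thesis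
    unfolding line_bundle_iso_def using Ft add scale by blast
qed

section \<open>Group actions and orbits\<close>

text \<open>
  The pointwise laws of \<^const>\<open>group_action\<close>, which are easier to verify for the dual action than
  a homomorphism into a group of bijections.
\<close>

definition acts_on :: "('g, 'm) monoid_scheme \<Rightarrow> 'a set \<Rightarrow> ('g \<Rightarrow> 'a \<Rightarrow> 'a) \<Rightarrow> bool" where
  "acts_on G S \<Phi> \<longleftrightarrow> group G \<and> (\<forall>g\<in>carrier G. \<forall>x\<in>S. \<Phi> g x \<in> S) \<and> (\<forall>x\<in>S. \<Phi> \<one>\<^bsub>G\<^esub> x = x) \<and>
    (\<forall>g\<in>carrier G. \<forall>h\<in>carrier G. \<forall>x\<in>S. \<Phi> (g \<otimes>\<^bsub>G\<^esub> h) x = \<Phi> g (\<Phi> h x))"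

lemma group_action_acts_on:
  assumes "group_action G S \<Phi>" shows "acts_on G S \<Phi>"
proof -
  interpret group_action G S \<Phi> by (rule assms)
  interpret gr: group G using group_hom by (rule group_hom.axioms(1))
  have "\<Phi> \<one>\<^bsub>G\<^esub> x = x" if "x \<in> S" for x using id_eq_one that by (metis restrict_apply')
  moreover have "\<Phi> g x \<in> S" if "g \<in> carrier G" "x \<in> S" for g x
    by (rule element_image[OF that refl])
  ultimately show ?thesis
    unfolding acts_on_def using gr.is_group composition_rule by blast
qed

context
  fixes G :: "('g, 'm) monoid_scheme" and S :: "'a set" and \<Phi>
  assumes act: "acts_on G S \<Phi>"
begin

lemma act_closed: "g \<in> carrier G \<Longrightarrow> x \<in> S \<Longrightarrow> \<Phi> g x \<in> S"
  and act_one: "x \<in> S \<Longrightarrow> \<Phi> \<one>\<^bsub>G\<^esub> x = x"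
  and act_mult: "g \<in> carrier G \<Longrightarrow> h \<in> carrier G \<Longrightarrow> x \<in> S \<Longrightarrow> \<Phi> (g \<otimes>\<^bsub>G\<^esub> h) x = \<Phi> g (\<Phi> h x)"
  and act_group: "group G"
  using act by (auto simp: acts_on_def)

lemma act_inv: "g \<in> carrier G \<Longrightarrow> x \<in> S \<Longrightarrow> \<Phi> (inv\<^bsub>G\<^esub> g) (\<Phi> g x) = x"
  and act_inv': "g \<in> carrier G \<Longrightarrow> x \<in> S \<Longrightarrow> \<Phi> g (\<Phi> (inv\<^bsub>G\<^esub> g) x) = x"
  using act_mult[of "inv\<^bsub>G\<^esub> g" g x] act_mult[of g "inv\<^bsub>G\<^esub> g" x] act_one act_group
  by (simp_all add: group.inv_closed group.l_inv group.r_inv)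

lemma orbit_image: "orbit G \<Phi> x = (\<lambda>g. \<Phi> g x) ` carrier G"
  by (auto simp: orbit_def)

lemma mem_orbit: "y \<in> orbit G \<Phi> x \<longleftrightarrow> (\<exists>g\<in>carrier G. y = \<Phi> g x)"
  by (auto simp: orbit_def)

lemma orbit_act: assumes g: "g \<in> carrier G" and x: "x \<in> S" shows "orbit G \<Phi> (\<Phi> g x) = orbit G \<Phi> x"
proof (intro equalityI subsetI)
  interpret group G by (rule act_group)
  fix y
  { assume "y \<in> orbit G \<Phi> (\<Phi> g x)"
    then obtain h where "h \<in> carrier G" "y = \<Phi> h (\<Phi> g x)" by (auto simp: mem_orbit)
    then have "y = \<Phi> (h \<otimes>\<^bsub>G\<^esub> g) x" "h \<otimes>\<^bsub>G\<^esub> g \<in> carrier G" using act_mult g x by auto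
    then show "y \<in> orbit G \<Phi> x" by (auto simp: mem_orbit) }
  { assume "y \<in> orbit G \<Phi> x"
    then obtain h where h: "h \<in> carrier G" "y = \<Phi> h x" by (auto simp: mem_orbit)
    have "\<Phi> (h \<otimes>\<^bsub>G\<^esub> inv\<^bsub>G\<^esub> g) (\<Phi> g x) = \<Phi> h (\<Phi> (inv\<^bsub>G\<^esub> g) (\<Phi> g x))"
      using h g act_closed[OF g x] by (intro act_mult) auto
    then have "y = \<Phi> (h \<otimes>\<^bsub>G\<^esub> inv\<^bsub>G\<^esub> g) (\<Phi> g x)" "h \<otimes>\<^bsub>G\<^esub> inv\<^bsub>G\<^esub> g \<in> carrier G"
      using act_inv[OF g x] h g by auto
    then show "y \<in> orbit G \<Phi> (\<Phi> g x)" by (auto simp: mem_orbit) }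
qed

lemma orbit_self: "x \<in> S \<Longrightarrow> x \<in> orbit G \<Phi> x"
  using act_one[of x] monoid.one_closed[OF group.is_monoid[OF act_group]] unfolding mem_orbit
  by (intro bexI[of _ "\<one>\<^bsub>G\<^esub>"]) auto

lemma orbit_eqD: "x \<in> S \<Longrightarrow> orbit G \<Phi> x = orbit G \<Phi> y \<Longrightarrow> \<exists>g\<in>carrier G. x = \<Phi> g y"
  using orbit_self by (auto simp flip: mem_orbit)

end

section \<open>Quotients of line bundles\<close>

text \<open>
  The assumption \<open>cover\<close> asks for enough invariant trivializations. The locale is used twice: for
  \<open>L\<close>, where they come from the line bundle \<open>L/G\<close>, and for \<open>L\<^sup>*\<close>, where they are obtained by
  dualizing those of \<open>L\<close>.
\<close>

locale quotient_line_bundle = smooth_line_bundle A M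
  for A :: "('k, 'e::finite_dim_inner) chart set" and M :: "('k, 'l) pre_bundle" +
  fixes G :: "('g, 'm) monoid_scheme" and AQ :: "('k set, 'f::finite_dim_inner) chart set"
    and \<Phi>M :: "'g \<Rightarrow> 'l \<Rightarrow> 'l" and \<Phi>K :: "'g \<Rightarrow> 'k \<Rightarrow> 'k"
  assumes act_base: "acts_on G (points A) \<Phi>K" and act_total: "acts_on G (total_space M) \<Phi>M"
    and equivariant_bproj: "g \<in> carrier G \<Longrightarrow> l \<in> total_space M \<Longrightarrow> bproj M (\<Phi>M g l) = \<Phi>K g (bproj M l)"
    and act_fadd: "g \<in> carrier G \<Longrightarrow> a \<in> fibre M x \<Longrightarrow> b \<in> fibre M x \<Longrightarrow>
      \<Phi>M g (fadd M a b) = fadd M (\<Phi>M g a) (\<Phi>M g b)"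
    and act_fscale: "g \<in> carrier G \<Longrightarrow> a \<in> fibre M x \<Longrightarrow> \<Phi>M g (fscale M c a) = fscale M c (\<Phi>M g a)"
    and atlasQ: "smooth_atlas AQ" and points_AQ: "points AQ = orbits G (points A) \<Phi>K"
    and submersion: "submersion A AQ (orbit G \<Phi>K)"
    and cover: "x \<in> points A \<Longrightarrow>
      \<exists>U \<tau>. (U, \<tau>) \<in> triv (quotient_bundle G A M \<Phi>M \<Phi>K) \<and> orbit G \<Phi>K x \<in> U"
begin

abbreviation "p \<equiv> orbit G \<Phi>K"
abbreviation "\<pi> \<equiv> orbit G \<Phi>M"
abbreviation "MQ \<equiv> quotient_bundle G A M \<Phi>M \<Phi>K"
abbreviation "E \<equiv> equivariant_sections G A M \<Phi>M \<Phi>K"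
abbreviation "qs \<equiv> quotient_section G A \<Phi>K"

lemma p_in_points: "x \<in> points A \<Longrightarrow> p x \<in> points AQ"
  by (auto simp: points_AQ orbits_def)

lemma points_AQ_cases: "y \<in> points AQ \<Longrightarrow> \<exists>x\<in>points A. y = p x"
  by (auto simp: points_AQ orbits_def)

lemma p_act: "g \<in> carrier G \<Longrightarrow> x \<in> points A \<Longrightarrow> p (\<Phi>K g x) = p x"
  by (rule orbit_act[OF act_base])

lemma pi_act: "g \<in> carrier G \<Longrightarrow> l \<in> total_space M \<Longrightarrow> \<pi> (\<Phi>M g l) = \<pi> l"
  by (rule orbit_act[OF act_total])

lemma act_fibre: "g \<in> carrier G \<Longrightarrow> l \<in> fibre M x \<Longrightarrow> \<Phi>M g l \<in> fibre M (\<Phi>K g x)"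
  using act_closed[OF act_total] equivariant_bproj by (auto simp: mem_fibre)

lemma bproj_pi: assumes l: "l \<in> total_space M" shows "bproj MQ (\<pi> l) = p (bproj M l)"
proof -
  have "bproj M ` \<pi> l = p (bproj M l)"
    unfolding orbit_image[OF act_total] orbit_image[OF act_base] image_image
    using equivariant_bproj[OF _ l] by (rule image_cong[OF refl])
  then show ?thesis by (simp add: quotient_bundle_def)
qed

lemma total_MQ: "total_space MQ = \<pi> ` total_space M"
  by (auto simp: quotient_bundle_def orbits_def)

lemma quotient_triv:
  "(U, \<tau>) \<in> triv MQ \<longleftrightarrow> U \<subseteq> points AQ \<and> local_triv A M {x \<in> points A. p x \<in> U} (\<lambda>l. \<tau> (\<pi> l))"
  by (simp add: quotient_bundle_def points_AQ comp_def)

lemma obtain_quotient_triv: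
  assumes "x \<in> points A"
  obtains U \<tau> where "(U, \<tau>) \<in> triv MQ" "p x \<in> U" "local_triv A M {x \<in> points A. p x \<in> U} (\<lambda>l. \<tau> (\<pi> l))"
  using cover[OF assms] quotient_triv by blast

text \<open>
  An invariant trivialization is constant on orbits and injective on the fibre. In other words, the
  isotropy groups act trivially on fibres.
\<close>

lemma pi_inj:
  assumes l: "l \<in> fibre M x" "l' \<in> fibre M x" "\<pi> l = \<pi> l'" shows "l = l'"
proof -
  have x: "x \<in> points A" using l(1) bproj_in_points by (auto simp: mem_fibre)
  obtain U \<tau> where "p x \<in> U" "local_triv A M {x \<in> points A. p x \<in> U} (\<lambda>l. \<tau> (\<pi> l))"
    using obtain_quotient_triv[OF x] by blast
  then have "fibre_coord M x (\<lambda>l. \<tau> (\<pi> l))" using x local_triv_coord by blast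
  then show ?thesis using l fibre_coord_inj by fastforce
qed

lemma fibre_MQ:
  assumes x: "x \<in> points A" shows "fibre MQ (p x) = \<pi> ` fibre M x"
proof (intro equalityI subsetI)
  fix q assume "q \<in> fibre MQ (p x)"
  then obtain l where l: "l \<in> total_space M" "q = \<pi> l" "p (bproj M l) = p x"
    using bproj_pi by (auto simp: mem_fibre total_MQ)
  then obtain g where g: "g \<in> carrier G" "x = \<Phi>K g (bproj M l)"
    using orbit_eqD[OF act_base x] by metis
  then have "\<Phi>M g l \<in> fibre M x" using act_fibre[of g l] l by (auto simp: mem_fibre)
  moreover have "q = \<pi> (\<Phi>M g l)" using pi_act g l by simp
  ultimately show "q \<in> \<pi> ` fibre M x" by blast
qed (use bproj_pi in \<open>auto simp: mem_fibre total_MQ\<close>)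

text \<open>
  Representatives \<open>g a\<close> and \<open>h b\<close> of the two orbits in a common fibre can come from different
  group elements, but then \<open>h b = g b\<close> by \<open>pi_inj\<close>, and the sum is \<open>g (a + b)\<close>.
\<close>

lemma fadd_MQ:
  assumes ab: "a \<in> fibre M x" "b \<in> fibre M x" shows "fadd MQ (\<pi> a) (\<pi> b) = \<pi> (fadd M a b)"
proof -
  have t: "a \<in> total_space M" "b \<in> total_space M" using ab by (auto simp: mem_fibre)
  have "fadd MQ (\<pi> a) (\<pi> b) = {fadd M a' b' | a' b'. a' \<in> \<pi> a \<and> b' \<in> \<pi> b \<and> bproj M a' = bproj M b'}"
    by (simp add: quotient_bundle_def)
  also have "\<dots> = \<pi> (fadd M a b)"
  proof (intro equalityI subsetI)
    fix c assume "c \<in> {fadd M a' b' | a' b'. a' \<in> \<pi> a \<and> b' \<in> \<pi> b \<and> bproj M a' = bproj M b'}"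
    then obtain g h where g: "g \<in> carrier G" "h \<in> carrier G" "bproj M (\<Phi>M g a) = bproj M (\<Phi>M h b)"
      and c: "c = fadd M (\<Phi>M g a) (\<Phi>M h b)"
      by (auto simp: mem_orbit[OF act_total])
    have "\<Phi>M h b = \<Phi>M g b"
    proof (rule pi_inj)
      show "\<Phi>M g b \<in> fibre M (\<Phi>K g x)" by (rule act_fibre[OF g(1) ab(2)])
      show "\<Phi>M h b \<in> fibre M (\<Phi>K g x)"
        using g(3) act_fibre[OF g(1) ab(1)] act_fibre[OF g(2) ab(2)] by (auto simp: mem_fibre)
      show "\<pi> (\<Phi>M h b) = \<pi> (\<Phi>M g b)" using pi_act g t by simp
    qed
    then show "c \<in> \<pi> (fadd M a b)" using c act_fadd[OF g(1) ab]
      unfolding mem_orbit[OF act_total] by (intro bexI[OF _ g(1)]) simp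
  next
    fix c assume "c \<in> \<pi> (fadd M a b)"
    then obtain g where g: "g \<in> carrier G" "c = \<Phi>M g (fadd M a b)" by (auto simp: mem_orbit[OF act_total])
    have "bproj M (\<Phi>M g a) = bproj M (\<Phi>M g b)"
      using act_fibre[OF g(1)] ab by (auto simp: mem_fibre)
    then show "c \<in> {fadd M a' b' | a' b'. a' \<in> \<pi> a \<and> b' \<in> \<pi> b \<and> bproj M a' = bproj M b'}"
      using g act_fadd[OF g(1) ab] by (auto simp: mem_orbit[OF act_total])
  qed
  finally show ?thesis .
qed

lemma fscale_MQ:
  assumes a: "a \<in> fibre M x" shows "fscale MQ c (\<pi> a) = \<pi> (fscale M c a)"
proof -
  have "fscale MQ c (\<pi> a) = fscale M c ` \<pi> a" by (simp add: quotient_bundle_def)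
  also have "\<dots> = \<pi> (fscale M c a)"
    using act_fscale[OF _ a] by (auto simp: orbit_def image_iff) metis+
  finally show ?thesis .
qed

lemma fibre_coord_MQ:
  assumes x: "x \<in> points A" shows "fibre_coord MQ (p x) \<tau> \<longleftrightarrow> fibre_coord M x (\<lambda>l. \<tau> (\<pi> l))"
proof -
  have "bij_betw \<pi> (fibre M x) (fibre MQ (p x))"
    using pi_inj fibre_MQ[OF x] by (auto simp: bij_betw_def inj_on_def)
  then have "bij_betw \<tau> (fibre MQ (p x)) UNIV \<longleftrightarrow> bij_betw (\<tau> \<circ> \<pi>) (fibre M x) UNIV"
    by (rule bij_betw_comp_iff)
  moreover have "linear_on_fibre MQ (p x) \<tau> \<longleftrightarrow> linear_on_fibre M x (\<lambda>l. \<tau> (\<pi> l))"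
    unfolding linear_on_fibre_def fibre_MQ[OF x] using fadd_MQ fscale_MQ by auto
  ultimately show ?thesis by (simp add: fibre_coord_def comp_def)
qed

lemma frame_MQ:
  assumes x: "x \<in> points A" and c: "fibre_coord MQ (p x) \<tau>"
  shows "frame MQ \<tau> (p x) = \<pi> (frame M (\<lambda>l. \<tau> (\<pi> l)) x)"
proof -
  have c': "fibre_coord M x (\<lambda>l. \<tau> (\<pi> l))" using c fibre_coord_MQ[OF x] by simp
  show ?thesis
    by (rule frame_unique[OF c, symmetric])
      (use frame_in_fibre[OF c'] coord_frame[OF c'] fibre_MQ[OF x] in auto)
qed

lemma quotient_triv_coord:
  assumes "(U, \<tau>) \<in> triv MQ" "x \<in> points A" "p x \<in> U"
  shows "fibre_coord M x (\<lambda>l. \<tau> (\<pi> l))" "fibre_coord MQ (p x) \<tau>"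
  using assms local_triv_coord quotient_triv fibre_coord_MQ by blast+

lemma smooth_at_p: "x \<in> points A \<Longrightarrow> smooth_at A AQ p x"
  using submersion by (simp add: submersion_def smooth_map_iff[OF atlas atlasQ])

lemma smooth_real_at_p_iff:
  assumes x: "x \<in> points A"
  shows "smooth_real_at AQ f (p x) \<longleftrightarrow> smooth_real_at A (\<lambda>x. f (p x)) x"
  using smooth_at_descends[OF atlas atlasQ smooth_atlas_real submersion x]
    smooth_at_compose[OF smooth_at_p[OF x] _ atlas atlasQ smooth_atlas_real] by blast

text \<open>
  The transition function between two trivializations of the quotient pulls back to the one between
  the corresponding invariant trivializations of \<open>M\<close> and is smooth by descent; their domains are
  open as images of open sets under a submersion.
\<close>

lemma line_bundle_MQ: "line_bundle AQ MQ"
  unfolding line_bundle_def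
proof (intro conjI allI ballI)
  show "bproj MQ \<in> total_space MQ \<rightarrow> points AQ"
    using bproj_pi p_in_points bproj_in_points by (auto simp: total_MQ)
  have base: "\<exists>x\<in>points A. y = p x" if q: "q \<in> fibre MQ y" for q y
  proof -
    obtain l where "l \<in> total_space M" "q = \<pi> l" using q by (auto simp: mem_fibre total_MQ)
    then show ?thesis using q bproj_pi bproj_in_points by (auto simp: mem_fibre)
  qed
  show "fadd MQ a b \<in> fibre MQ y" if ab: "a \<in> fibre MQ y" "b \<in> fibre MQ y" for y a b
  proof -
    obtain x where x: "x \<in> points A" "y = p x" using base[OF ab(1)] by blast
    then show ?thesis using ab fadd_MQ fadd_in_fibre by (auto simp: fibre_MQ)
  qed
  show "fscale MQ c a \<in> fibre MQ y" if a: "a \<in> fibre MQ y" for y c a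
  proof -
    obtain x where x: "x \<in> points A" "y = p x" using base[OF a] by blast
    then show ?thesis using a fscale_MQ fscale_in_fibre by (auto simp: fibre_MQ)
  qed
  show "points AQ = (\<Union>(U, \<tau>)\<in>triv MQ. U)"
  proof (intro equalityI subsetI)
    fix y assume "y \<in> points AQ"
    then obtain x where x: "x \<in> points A" "y = p x" using points_AQ_cases by blast
    then show "y \<in> (\<Union>(U, \<tau>)\<in>triv MQ. U)" using cover by blast
  qed (use quotient_triv in auto)
  fix T assume T: "T \<in> triv MQ"
  obtain U \<tau> where [simp]: "T = (U, \<tau>)" by (cases T)
  have U: "(U, \<tau>) \<in> triv MQ" using T by simp
  have open_triv: "open_in AQ V" if V: "(V, \<sigma>) \<in> triv MQ" for V \<sigma>
  proof -
    have sub: "V \<subseteq> points AQ" and lt: "local_triv A M {x \<in> points A. p x \<in> V} (\<lambda>l. \<sigma> (\<pi> l))"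
      using V by (simp_all add: quotient_triv)
    have "p ` {x \<in> points A. p x \<in> V} = V" using sub points_AQ_cases by auto
    then show ?thesis
      using openin_submersion_image[OF atlas atlasQ submersion local_triv_open[OF lt]] by simp
  qed
  have "local_triv AQ MQ U \<tau>"
    unfolding local_triv_def
  proof (intro conjI ballI; (clarify)?)
    show "open_in AQ U" by (rule open_triv[OF U])
    have UQ: "U \<subseteq> points AQ" using U by (simp add: quotient_triv)
    have "fibre_coord MQ y \<tau>" if y: "y \<in> U" for y
    proof -
      obtain x where "x \<in> points A" "y = p x" using y UQ points_AQ_cases by blast
      then show ?thesis using quotient_triv_coord(2)[OF U] y by simp
    qed
    then show "linear_on_fibre MQ y \<tau>" "bij_betw \<tau> (fibre MQ y) UNIV" if "y \<in> U" for y
      using that by (auto simp: fibre_coord_def)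
    fix V \<sigma> assume V: "(V, \<sigma>) \<in> triv MQ"
    have o: "open_in AQ (U \<inter> V)" using open_triv U V by blast
    show "smooth_map (sub_atlas AQ (U \<inter> V)) real_atlas (\<lambda>y. \<tau> (frame MQ \<sigma> y))"
      unfolding smooth_map_sub_atlas_iff[OF atlasQ o]
    proof
      fix y assume y: "y \<in> U \<inter> V"
      then obtain x where x: "x \<in> points A" "y = p x"
        using UQ points_AQ_cases by blast
      have lt: "local_triv A M {x \<in> points A. p x \<in> U} (\<lambda>l. \<tau> (\<pi> l))"
        "local_triv A M {x \<in> points A. p x \<in> V} (\<lambda>l. \<sigma> (\<pi> l))" using U V by (simp_all add: quotient_triv)
      have "smooth_real_at A (\<lambda>x. \<tau> (\<pi> (frame M (\<lambda>l. \<sigma> (\<pi> l)) x))) x"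
        using x y by (intro transition_smooth[OF lt]) auto
      then have "smooth_real_at A (\<lambda>x. \<tau> (frame MQ \<sigma> (p x))) x"
        by (rule smooth_at_cong[OF atlas _ local_triv_open[OF lt(2)]])
          (use x y frame_MQ quotient_triv_coord(2)[OF V] in auto)
      then show "smooth_real_at AQ (\<lambda>y. \<tau> (frame MQ \<sigma> y)) y"
        using smooth_real_at_p_iff[OF x(1)] x(2) by simp
    qed
  qed
  then show "case T of (U, \<tau>) \<Rightarrow> local_triv AQ MQ U \<tau>" by simp
qed

sublocale Q: smooth_line_bundle AQ MQ
  by unfold_locales (rule atlasQ, rule line_bundle_MQ)

subsection \<open>Equivariant sections\<close>

lemma E_section: "h \<in> E \<Longrightarrow> h \<in> sections A M"
  and E_equivariant: "h \<in> E \<Longrightarrow> g \<in> carrier G \<Longrightarrow> x \<in> points A \<Longrightarrow> h (\<Phi>K g x) = \<Phi>M g (h x)"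
  by (auto simp: equivariant_sections_def)

lemma E_fibre: "h \<in> E \<Longrightarrow> x \<in> points A \<Longrightarrow> h x \<in> fibre M x"
  using E_section sections_in_fibre by blast

lemma E_I: "h \<in> sections A M \<Longrightarrow> (\<And>g x. g \<in> carrier G \<Longrightarrow> x \<in> points A \<Longrightarrow> h (\<Phi>K g x) = \<Phi>M g (h x)) \<Longrightarrow> h \<in> E"
  by (auto simp: equivariant_sections_def)

lemma qs_p:
  assumes h: "h \<in> E" and x: "x \<in> points A" shows "qs h (p x) = \<pi> (h x)"
proof -
  have "p x \<in> orbits G (points A) \<Phi>K" using p_in_points[OF x] points_AQ by simp
  then have "qs h (p x) = h ` p x" by (simp add: quotient_section_def)
  also have "\<dots> = \<pi> (h x)" using E_equivariant[OF h _ x] by (auto simp: orbit_def image_iff) metis+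
  finally show ?thesis .
qed

text \<open>
  The coordinate of \<open>qs h\<close> pulls back to the coordinate of \<open>h\<close> in the invariant trivialization.
\<close>

lemma qs_in_sections:
  assumes h: "h \<in> E" shows "qs h \<in> sections AQ MQ"
proof (rule Q.sectionsI)
  show "qs h \<in> extensional (points AQ)" by (simp add: quotient_section_def points_AQ)
  fix y assume "y \<in> points AQ"
  then obtain x where x: "x \<in> points A" "y = p x" using points_AQ_cases by blast
  show "qs h y \<in> fibre MQ y" using x qs_p[OF h] E_fibre[OF h] fibre_MQ by simp
  obtain U \<tau> where U: "(U, \<tau>) \<in> triv MQ" "p x \<in> U" and lt: "local_triv A M {x \<in> points A. p x \<in> U} (\<lambda>l. \<tau> (\<pi> l))"
    using obtain_quotient_triv[OF x(1)] .
  have "smooth_real_at A (\<lambda>x. \<tau> (\<pi> (h x))) x"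
    using x U by (intro sections_coord_smooth[OF E_section[OF h] lt]) auto
  then have "smooth_real_at A (\<lambda>x. \<tau> (qs h (p x))) x"
    by (rule smooth_at_cong[OF atlas _ openin_points[OF atlas] x(1)]) (simp add: qs_p[OF h])
  then have "smooth_real_at AQ (\<lambda>y. \<tau> (qs h y)) y" using smooth_real_at_p_iff[OF x(1)] x(2) by simp
  then show "\<exists>U \<tau>. local_triv AQ MQ U \<tau> \<and> y \<in> U \<and> smooth_real_at AQ (\<lambda>y. \<tau> (qs h y)) y"
    using Q.triv_local_triv[OF U(1)] U(2) x(2) by blast
qed

lemma E_eqI:
  assumes "h1 \<in> E" "h2 \<in> E" "\<And>x. x \<in> points A \<Longrightarrow> \<pi> (h1 x) = \<pi> (h2 x)" shows "h1 = h2"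
proof (rule extensionalityI)
  show "h1 \<in> extensional (points A)" "h2 \<in> extensional (points A)"
    using assms E_section by (auto simp: sections_def)
  show "h1 x = h2 x" if "x \<in> points A" for x
    using pi_inj[OF E_fibre[OF assms(1) that] E_fibre[OF assms(2) that]] assms(3)[OF that] .
qed

text \<open>
  Over \<open>x\<close> the lift takes the only element of the orbit \<open>s (p x)\<close> in the fibre at \<open>x\<close>. As
  \<open>h (g x)\<close> and \<open>g (h x)\<close> both satisfy this description at \<open>g x\<close>, the lift is equivariant.
\<close>

lemma ex_lift:
  assumes s: "s \<in> sections AQ MQ" shows "\<exists>h\<in>E. qs h = s"
proof -
  define h where "h = (\<lambda>x\<in>points A. inv_into (fibre M x) \<pi> (s (p x)))"
  have h: "h x \<in> fibre M x" "\<pi> (h x) = s (p x)" if x: "x \<in> points A" for x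
  proof -
    have "s (p x) \<in> \<pi> ` fibre M x"
      using Q.sections_in_fibre[OF s p_in_points[OF x]] fibre_MQ[OF x] by simp
    then show "h x \<in> fibre M x" "\<pi> (h x) = s (p x)"
      using x by (auto simp: h_def inv_into_into f_inv_into_f)
  qed
  have "h \<in> E"
  proof (rule E_I)
    show "h \<in> sections A M"
    proof (rule sectionsI)
      fix x assume x: "x \<in> points A"
      show "h x \<in> fibre M x" by (rule h(1)[OF x])
      obtain U \<tau> where U: "(U, \<tau>) \<in> triv MQ" "p x \<in> U" and lt: "local_triv A M {x \<in> points A. p x \<in> U} (\<lambda>l. \<tau> (\<pi> l))"
        using obtain_quotient_triv[OF x] .
      have "smooth_real_at AQ (\<lambda>y. \<tau> (s y)) (p x)"
        by (rule Q.sections_coord_smooth[OF s Q.triv_local_triv[OF U(1)] U(2)])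
      then have "smooth_real_at A (\<lambda>x. \<tau> (s (p x))) x" using smooth_real_at_p_iff[OF x] by simp
      then have "smooth_real_at A (\<lambda>x. \<tau> (\<pi> (h x))) x"
        by (rule smooth_at_cong[OF atlas _ openin_points[OF atlas] x]) (simp add: h(2))
      then show "\<exists>U \<tau>. local_triv A M U \<tau> \<and> x \<in> U \<and> smooth_real_at A (\<lambda>y. \<tau> (h y)) x"
        using lt x U(2) by (intro exI[of _ "{x \<in> points A. p x \<in> U}"] exI[of _ "\<lambda>l. \<tau> (\<pi> l)"]) auto
    qed (simp add: h_def)
    fix g x assume g: "g \<in> carrier G" and x: "x \<in> points A"
    have gx: "\<Phi>K g x \<in> points A" by (rule act_closed[OF act_base g x])
    have "h x \<in> total_space M" using h(1)[OF x] by (simp add: mem_fibre)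
    then show "h (\<Phi>K g x) = \<Phi>M g (h x)"
      using h(2)[OF gx] h(2)[OF x] p_act[OF g x] pi_act[OF g]
      by (intro pi_inj[OF h(1)[OF gx] act_fibre[OF g h(1)[OF x]]]) simp
  qed
  moreover have "qs h = s"
  proof (rule extensionalityI)
    show "qs h \<in> extensional (points AQ)" by (simp add: quotient_section_def points_AQ)
    show "s \<in> extensional (points AQ)" using s by (simp add: sections_def)
    fix y assume "y \<in> points AQ"
    then obtain x where "x \<in> points A" "y = p x" using points_AQ_cases by blast
    then show "qs h y = s y" using qs_p[OF \<open>h \<in> E\<close>] h(2) by simp
  qed
  ultimately show ?thesis by blast
qed

lemma bij_betw_qs: "bij_betw qs E (sections AQ MQ)"
  unfolding bij_betw_def
proof
  show "inj_on qs E"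
  proof (rule inj_onI)
    fix h1 h2 assume h: "h1 \<in> E" "h2 \<in> E" "qs h1 = qs h2"
    show "h1 = h2" by (rule E_eqI[OF h(1,2)]) (use h qs_p in metis)
  qed
  show "qs ` E = sections AQ MQ" using qs_in_sections ex_lift by blast
qed

lemma quotient_section_eqI:
  assumes "s \<in> extensional (points AQ)" "t \<in> extensional (points AQ)"
    "\<And>x. x \<in> points A \<Longrightarrow> s (p x) = t (p x)"
  shows "s = t"
  using assms points_AQ_cases by (intro extensionalityI[OF assms(1,2)]) auto

lemma sec_add_in_E:
  assumes h: "h1 \<in> E" "h2 \<in> E" shows "sec_add A M h1 h2 \<in> E"
proof (rule E_I)
  show "sec_add A M h1 h2 \<in> sections A M" using h E_section sec_add_in_sections by blast
  fix g x assume g: "g \<in> carrier G" and x: "x \<in> points A"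
  show "sec_add A M h1 h2 (\<Phi>K g x) = \<Phi>M g (sec_add A M h1 h2 x)"
    using act_closed[OF act_base g x] x act_fadd[OF g E_fibre[OF h(1) x] E_fibre[OF h(2) x]]
      E_equivariant[OF h(1) g x] E_equivariant[OF h(2) g x] by (simp add: sec_add_def)
qed

lemma sec_scale_in_E:
  assumes h: "h \<in> E" and f: "\<And>x. x \<in> points A \<Longrightarrow> smooth_real_at A f x"
    and inv: "\<And>g x. g \<in> carrier G \<Longrightarrow> x \<in> points A \<Longrightarrow> f (\<Phi>K g x) = f x"
  shows "sec_scale A M f h \<in> E"
proof (rule E_I)
  show "sec_scale A M f h \<in> sections A M" by (rule sec_scale_in_sections[OF E_section[OF h] f])
  fix g x assume g: "g \<in> carrier G" and x: "x \<in> points A"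
  show "sec_scale A M f h (\<Phi>K g x) = \<Phi>M g (sec_scale A M f h x)"
    using act_closed[OF act_base g x] x act_fscale[OF g E_fibre[OF h x]] inv[OF g x]
      E_equivariant[OF h g x] by (simp add: sec_scale_def)
qed

lemma qs_add:
  assumes h: "h1 \<in> E" "h2 \<in> E"
  shows "qs (sec_add A M h1 h2) = sec_add AQ MQ (qs h1) (qs h2)"
proof (rule quotient_section_eqI)
  fix x assume x: "x \<in> points A"
  show "qs (sec_add A M h1 h2) (p x) = sec_add AQ MQ (qs h1) (qs h2) (p x)"
    using qs_p[OF sec_add_in_E[OF h] x] qs_p[OF h(1) x] qs_p[OF h(2) x] x p_in_points[OF x]
      fadd_MQ[OF E_fibre[OF h(1) x] E_fibre[OF h(2) x]] by (simp add: sec_add_def)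
qed (simp_all add: quotient_section_def points_AQ sec_add_def)

lemma qs_scale:
  assumes h: "h \<in> E" and F: "sec_scale A M F h \<in> E" and f: "\<And>x. x \<in> points A \<Longrightarrow> F x = f (p x)"
  shows "qs (sec_scale A M F h) = sec_scale AQ MQ f (qs h)"
proof (rule quotient_section_eqI)
  fix x assume x: "x \<in> points A"
  show "qs (sec_scale A M F h) (p x) = sec_scale AQ MQ f (qs h) (p x)"
    using qs_p[OF F x] qs_p[OF h x] x p_in_points[OF x] f[OF x]
      fscale_MQ[OF E_fibre[OF h x]] by (simp add: sec_scale_def)
qed (simp_all add: quotient_section_def points_AQ sec_scale_def)

lemma sec_scale_const_in_E: "h \<in> E \<Longrightarrow> sec_scale A M (\<lambda>_. c) h \<in> E"
  by (rule sec_scale_in_E) (auto intro: smooth_real_at_const[OF atlas])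

lemma ex_nonvanishing_equivariant_section:
  assumes haus: "Hausdorff_space (atlas_topology AQ)" and x: "x \<in> points A"
  shows "\<exists>h\<in>E. \<forall>g\<in>carrier G. \<forall>a b. fscale M a (h (\<Phi>K g x)) = fscale M b (h (\<Phi>K g x)) \<longrightarrow> a = b"
proof -
  obtain s where s: "s \<in> sections AQ MQ"
    "\<And>a b. fscale MQ a (s (p x)) = fscale MQ b (s (p x)) \<Longrightarrow> a = b"
    using Q.ex_nonvanishing_section[OF haus p_in_points[OF x]] by blast
  obtain h where h: "h \<in> E" "qs h = s" using ex_lift[OF s(1)] by blast
  have "a = b" if g: "g \<in> carrier G" and eq: "fscale M a (h (\<Phi>K g x)) = fscale M b (h (\<Phi>K g x))" for g a b
  proof (rule s(2))
    have gx: "\<Phi>K g x \<in> points A" by (rule act_closed[OF act_base g x])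
    have "s (p x) = \<pi> (h (\<Phi>K g x))" using qs_p[OF h(1) gx] h(2) p_act[OF g x] by simp
    then show "fscale MQ a (s (p x)) = fscale MQ b (s (p x))"
      using fscale_MQ[OF E_fibre[OF h(1) gx]] eq by simp
  qed
  then show ?thesis using h(1) by blast
qed

section \<open>Reduction of Kirillov brackets\<close>

definition pullback :: "('k set \<Rightarrow> real) \<Rightarrow> 'k \<Rightarrow> real" where
  "pullback f = (\<lambda>x\<in>points A. f (p x))"

lemma pullback_smooth: assumes f: "f \<in> smooth_functions AQ" shows "pullback f \<in> smooth_functions A"
proof -
  have "smooth_real_at A (pullback f) x" if x: "x \<in> points A" for x
  proof (rule smooth_at_cong[OF atlas _ openin_points[OF atlas] x])
    have "smooth_real_at AQ f (p x)"
      using f p_in_points[OF x] by (simp add: smooth_functions_iff[OF atlasQ])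
    then show "smooth_real_at A (\<lambda>x. f (p x)) x" by (simp only: smooth_real_at_p_iff[OF x])
  qed (simp add: pullback_def)
  then show ?thesis by (simp add: smooth_functions_iff[OF atlas] pullback_def)
qed

lemma pullback_invariant:
  "g \<in> carrier G \<Longrightarrow> x \<in> points A \<Longrightarrow> pullback f (\<Phi>K g x) = pullback f x"
  using act_closed[OF act_base] p_act by (simp add: pullback_def)

lemma pullback_G_invariant: "f \<in> smooth_functions AQ \<Longrightarrow> pullback f \<in> G_invariant_functions G A \<Phi>K"
  using pullback_smooth pullback_invariant by (simp add: G_invariant_functions_def)

lemma invariant_scale_in_E: "f \<in> G_invariant_functions G A \<Phi>K \<Longrightarrow> h \<in> E \<Longrightarrow> sec_scale A M f h \<in> E"
  by (rule sec_scale_in_E) (auto simp: G_invariant_functions_def smooth_functions_iff[OF atlas])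

definition lift :: "('k set \<Rightarrow> 'l set) \<Rightarrow> 'k \<Rightarrow> 'l" where
  "lift = inv_into E qs"

lemma lift_in_E: "s \<in> sections AQ MQ \<Longrightarrow> lift s \<in> E"
  and qs_lift: "s \<in> sections AQ MQ \<Longrightarrow> qs (lift s) = s"
  unfolding lift_def using inv_into_on_points[OF bij_betw_qs] by blast+

lemma lift_qs: "h \<in> E \<Longrightarrow> lift (qs h) = h"
  unfolding lift_def using bij_betw_qs by (simp add: bij_betw_def)

lemma lift_add: "s \<in> sections AQ MQ \<Longrightarrow> t \<in> sections AQ MQ \<Longrightarrow>
    lift (sec_add AQ MQ s t) = sec_add A M (lift s) (lift t)"
  using qs_add[OF lift_in_E lift_in_E] lift_qs[OF sec_add_in_E[OF lift_in_E lift_in_E]]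
  by (metis qs_lift)

lemma lift_scale_const: "s \<in> sections AQ MQ \<Longrightarrow>
    lift (sec_scale AQ MQ (\<lambda>_. c) s) = sec_scale A M (\<lambda>_. c) (lift s)"
  using qs_scale[OF lift_in_E sec_scale_const_in_E[OF lift_in_E], where f="\<lambda>_. c"]
    lift_qs[OF sec_scale_const_in_E[OF lift_in_E]]
  by (metis qs_lift)

lemma lift_scale:
  assumes f: "f \<in> smooth_functions AQ" and s: "s \<in> sections AQ MQ"
  shows "lift (sec_scale AQ MQ f s) = sec_scale A M (pullback f) (lift s)"
proof -
  have E: "sec_scale A M (pullback f) (lift s) \<in> E"
    by (rule invariant_scale_in_E[OF pullback_G_invariant[OF f] lift_in_E[OF s]])
  have "qs (sec_scale A M (pullback f) (lift s)) = sec_scale AQ MQ f s"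
    using qs_scale[OF lift_in_E[OF s] E, of f] qs_lift[OF s] by (simp add: pullback_def)
  then show ?thesis using lift_qs[OF E] by simp
qed

end

locale bracket_reduction = quotient_line_bundle A M G AQ \<Phi>M \<Phi>K
  for A :: "('k, 'e::finite_dim_inner) chart set" and M :: "('k, 'l) pre_bundle"
    and G :: "('g, 'm) monoid_scheme" and AQ :: "('k set, 'f::finite_dim_inner) chart set"
    and \<Phi>M :: "'g \<Rightarrow> 'l \<Rightarrow> 'l" and \<Phi>K :: "'g \<Rightarrow> 'k \<Rightarrow> 'k" +
  fixes B :: "('k \<Rightarrow> 'l) \<Rightarrow> ('k \<Rightarrow> 'l) \<Rightarrow> 'k \<Rightarrow> 'l"
  assumes haus: "Hausdorff_space (atlas_topology AQ)"
    and kirillov: "kirillov_bracket A M B"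
    and closed: "h1 \<in> E \<Longrightarrow> h2 \<in> E \<Longrightarrow> B h1 h2 \<in> E"
begin

definition BQ :: "('k set \<Rightarrow> 'l set) \<Rightarrow> ('k set \<Rightarrow> 'l set) \<Rightarrow> 'k set \<Rightarrow> 'l set" where
  "BQ s t = qs (B (lift s) (lift t))"

lemma BQ_qs: "h1 \<in> E \<Longrightarrow> h2 \<in> E \<Longrightarrow> BQ (qs h1) (qs h2) = qs (B h1 h2)"
  by (simp add: BQ_def lift_qs)

lemma BQ_in_sections: "s \<in> sections AQ MQ \<Longrightarrow> t \<in> sections AQ MQ \<Longrightarrow> BQ s t \<in> sections AQ MQ"
  by (simp add: BQ_def qs_in_sections closed lift_in_E)

lemma lift_BQ: "s \<in> sections AQ MQ \<Longrightarrow> t \<in> sections AQ MQ \<Longrightarrow> lift (BQ s t) = B (lift s) (lift t)"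
  by (simp add: BQ_def lift_qs closed lift_in_E)

lemma quotient_eq_by_lift:
  "s \<in> sections AQ MQ \<Longrightarrow> t \<in> sections AQ MQ \<Longrightarrow> lift s = lift t \<Longrightarrow> s = t"
  by (metis qs_lift)

text \<open>
  \<^const>\<open>lift\<close> is injective and linear and intertwines \<open>BQ\<close> with \<open>B\<close>, so every identity for
  \<open>BQ\<close> becomes the same identity for \<open>B\<close> after lifting.
\<close>

lemma lie_bracket_BQ: "lie_bracket AQ MQ BQ"
proof -
  have const: "sec_scale AQ MQ (\<lambda>_. c) s \<in> sections AQ MQ" if "s \<in> sections AQ MQ" for c s
    by (rule Q.sec_scale_in_sections[OF that smooth_real_at_const[OF atlasQ]])
  note cl = const Q.sec_add_in_sections BQ_in_sections
  note li = lift_add lift_scale_const lift_BQ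
  have "lie_bracket A M B" using kirillov by (simp add: kirillov_bracket_def)
  then have anti: "B s t = sec_scale A M (\<lambda>_. - 1) (B t s)"
    and scale: "B (sec_scale A M (\<lambda>_. c) s) t = sec_scale A M (\<lambda>_. c) (B s t)"
      "B s (sec_scale A M (\<lambda>_. c) t) = sec_scale A M (\<lambda>_. c) (B s t)"
    and add: "B (sec_add A M s u) t = sec_add A M (B s t) (B u t)"
      "B s (sec_add A M t u) = sec_add A M (B s t) (B s u)"
    and jacobi: "sec_add A M (sec_add A M (B s (B t u)) (B t (B u s))) (B u (B s t)) = sec_scale A M (\<lambda>_. 0) s"
    if "s \<in> sections A M" "t \<in> sections A M" "u \<in> sections A M" for s t u c
    using that unfolding lie_bracket_def by blast+
  show ?thesis
    unfolding lie_bracket_def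
  proof (intro ballI conjI allI)
    fix s t assume st: "s \<in> sections AQ MQ" "t \<in> sections AQ MQ"
    note S = E_section[OF lift_in_E[OF st(1)]] and T = E_section[OF lift_in_E[OF st(2)]]
    show "BQ s t \<in> sections AQ MQ" by (rule BQ_in_sections[OF st])
    show "BQ s t = sec_scale AQ MQ (\<lambda>_. - 1) (BQ t s)"
      by (rule quotient_eq_by_lift) (simp_all add: st cl li anti[OF S T S])
    show "BQ (sec_scale AQ MQ (\<lambda>_. c) s) t = sec_scale AQ MQ (\<lambda>_. c) (BQ s t)" for c
      by (rule quotient_eq_by_lift) (simp_all add: st cl li scale[OF S T S])
    show "BQ s (sec_scale AQ MQ (\<lambda>_. c) t) = sec_scale AQ MQ (\<lambda>_. c) (BQ s t)" for c
      by (rule quotient_eq_by_lift) (simp_all add: st cl li scale[OF S T S])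
    fix u assume u: "u \<in> sections AQ MQ"
    note U = E_section[OF lift_in_E[OF u]]
    show "BQ (sec_add AQ MQ s u) t = sec_add AQ MQ (BQ s t) (BQ u t)"
      by (rule quotient_eq_by_lift) (simp_all add: st u cl li add[OF S T U])
    show "BQ s (sec_add AQ MQ t u) = sec_add AQ MQ (BQ s t) (BQ s u)"
      by (rule quotient_eq_by_lift) (simp_all add: st u cl li add[OF S T U])
    show "sec_add AQ MQ (sec_add AQ MQ (BQ s (BQ t u)) (BQ t (BQ u s))) (BQ u (BQ s t)) =
        sec_scale AQ MQ (\<lambda>_. 0) s"
      by (rule quotient_eq_by_lift) (simp_all add: st u cl li jacobi[OF S T U])
  qed
qed

lemma symbol_eq:
  assumes "is_symbol A M B h X" "h1 \<in> sections A M" "f \<in> smooth_functions A" "x \<in> points A"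
  shows "B (sec_scale A M f h1) h x = fadd M (fscale M (f x) (B h1 h x)) (fscale M (X x f) (h1 x))"
proof -
  have "B (sec_scale A M f h1) h =
      sec_add A M (sec_scale A M f (B h1 h)) (sec_scale A M (vf_apply A X f) h1)"
    using assms by (simp add: is_symbol_def)
  then show ?thesis using assms(4) by (simp add: sec_add_def sec_scale_def vf_apply_def)
qed

text \<open>
  Compare \<open>[f h\<^sub>1, h] = f [h\<^sub>1, h] + X(f) h\<^sub>1\<close> at \<open>g x\<close> with its image under \<open>g\<close> from \<open>x\<close>, where \<open>h\<^sub>1\<close>
  is equivariant and does not vanish at \<open>g x\<close>. The two brackets are equivariant, so the last terms
  agree and \<open>h\<^sub>1\<close> can be cancelled.
\<close>

lemma symbol_preserves_invariance:
  assumes h: "h \<in> E" and X: "is_symbol A M B h X"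
  shows "preserves_G_invariance G A \<Phi>K X"
  unfolding preserves_G_invariance_def
proof
  fix f assume f: "f \<in> G_invariant_functions G A \<Phi>K"
  then have fs: "f \<in> smooth_functions A" and inv: "\<And>g x. g \<in> carrier G \<Longrightarrow> x \<in> points A \<Longrightarrow> f (\<Phi>K g x) = f x"
    by (auto simp: G_invariant_functions_def)
  have "vf_apply A X f \<in> smooth_functions A" using X fs by (simp add: is_symbol_def vector_fields_def)
  moreover have "vf_apply A X f (\<Phi>K g x) = vf_apply A X f x" if g: "g \<in> carrier G" and x: "x \<in> points A" for g x
  proof -
    obtain h1 where h1: "h1 \<in> E"
      and nz: "\<And>a b. fscale M a (h1 (\<Phi>K g x)) = fscale M b (h1 (\<Phi>K g x)) \<Longrightarrow> a = b"
      using ex_nonvanishing_equivariant_section[OF haus x] g by blast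
    have gx: "\<Phi>K g x \<in> points A" by (rule act_closed[OF act_base g x])
    have B1: "B h1 h \<in> E" by (rule closed[OF h1 h])
    have B2: "B (sec_scale A M f h1) h \<in> E" by (rule closed[OF invariant_scale_in_E[OF f h1] h])
    note sy = symbol_eq[OF X E_section[OF h1] fs]
    have f1: "fscale M c (B h1 h y) \<in> fibre M y" "fscale M c (h1 y) \<in> fibre M y" if "y \<in> points A" for c y
      using E_fibre[OF B1 that] E_fibre[OF h1 that] fscale_in_fibre by auto
    have "fadd M (fscale M (f x) (B h1 h (\<Phi>K g x))) (fscale M (X (\<Phi>K g x) f) (h1 (\<Phi>K g x))) =
        B (sec_scale A M f h1) h (\<Phi>K g x)"
      using sy[OF gx] inv[OF g x] by simp
    also have "\<dots> = \<Phi>M g (B (sec_scale A M f h1) h x)" by (rule E_equivariant[OF B2 g x])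
    also have "\<dots> = fadd M (\<Phi>M g (fscale M (f x) (B h1 h x))) (\<Phi>M g (fscale M (X x f) (h1 x)))"
      unfolding sy[OF x] by (rule act_fadd[OF g f1(1)[OF x] f1(2)[OF x]])
    also have "\<dots> = fadd M (fscale M (f x) (B h1 h (\<Phi>K g x))) (fscale M (X x f) (h1 (\<Phi>K g x)))"
      using act_fscale[OF g E_fibre[OF B1 x]] act_fscale[OF g E_fibre[OF h1 x]]
        E_equivariant[OF B1 g x] E_equivariant[OF h1 g x] by simp
    finally have "fscale M (X (\<Phi>K g x) f) (h1 (\<Phi>K g x)) = fscale M (X x f) (h1 (\<Phi>K g x))"
      by (rule fadd_left_cancel[OF gx f1(1)[OF gx] f1(2)[OF gx] f1(2)[OF gx]])
    then have "X (\<Phi>K g x) f = X x f" by (rule nz)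
    then show ?thesis using x gx by (simp add: vf_apply_def)
  qed
  ultimately show "vf_apply A X f \<in> G_invariant_functions G A \<Phi>K" by (simp add: G_invariant_functions_def)
qed

text \<open>
  For \<open>f\<close> on the quotient, the Leibniz rules of \<open>B\<close> for \<open>f \<circ> p\<close> and of \<open>BQ'\<close> for \<open>f\<close> express the
  same element of the fibre over \<open>p x\<close>; cancelling a section that does not vanish at \<open>x\<close> leaves
  \<open>X\<^sub>x (f \<circ> p) = Y\<^sub>p\<^sub>x (f)\<close>.
\<close>

lemma symbol_projects:
  assumes h: "h \<in> E" and X: "is_symbol A M B h X"
    and BQ': "\<And>h1 h2. h1 \<in> E \<Longrightarrow> h2 \<in> E \<Longrightarrow> BQ' (qs h1) (qs h2) = qs (B h1 h2)"
    and Y: "is_symbol AQ MQ BQ' (qs h) Y"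
  shows "projects_to A AQ p X Y"
  unfolding projects_to_def
proof
  fix x assume x: "x \<in> points A"
  have px: "p x \<in> points AQ" by (rule p_in_points[OF x])
  have "Y (p x) \<in> extensional (smooth_functions AQ)"
    using Y px by (simp add: is_symbol_def vector_fields_def tangent_space_def)
  then show "tangent_map A AQ p (X x) = Y (p x)"
  proof (rule extensionalityI[rotated])
    fix f assume f: "f \<in> smooth_functions AQ"
    obtain h1 where h1: "h1 \<in> E"
      and nz: "\<forall>g\<in>carrier G. \<forall>a b. fscale M a (h1 (\<Phi>K g x)) = fscale M b (h1 (\<Phi>K g x)) \<longrightarrow> a = b"
      using ex_nonvanishing_equivariant_section[OF haus x] by blast
    have nzx: "a = b" if "fscale M a (h1 x) = fscale M b (h1 x)" for a b
      using nz act_one[OF act_base x] that monoid.one_closed[OF group.is_monoid[OF act_group[OF act_base]]] by metis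
    note pf = pullback_smooth[OF f]
    have fh1: "sec_scale A M (pullback f) h1 \<in> E"
      by (rule invariant_scale_in_E[OF pullback_G_invariant[OF f] h1])
    have B1: "B h1 h \<in> E" by (rule closed[OF h1 h])
    have f1: "fscale M c (B h1 h x) \<in> fibre M x" "fscale M c (h1 x) \<in> fibre M x" for c
      using E_fibre[OF B1 x] E_fibre[OF h1 x] fscale_in_fibre by auto
    have qf: "sec_scale AQ MQ f (qs h1) = qs (sec_scale A M (pullback f) h1)"
      by (rule qs_scale[OF h1 fh1, symmetric]) (simp add: pullback_def)
    have "\<pi> (fadd M (fscale M (f (p x)) (B h1 h x)) (fscale M (X x (pullback f)) (h1 x))) =
        \<pi> (B (sec_scale A M (pullback f) h1) h x)"
      using symbol_eq[OF X E_section[OF h1] pf x] x by (simp add: pullback_def)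
    also have "\<dots> = BQ' (sec_scale AQ MQ f (qs h1)) (qs h) (p x)"
      unfolding qf BQ'[OF fh1 h] by (rule qs_p[OF closed[OF fh1 h] x, symmetric])
    also have "\<dots> = fadd MQ (fscale MQ (f (p x)) (BQ' (qs h1) (qs h) (p x))) (fscale MQ (Y (p x) f) (qs h1 (p x)))"
    proof -
      have "BQ' (sec_scale AQ MQ f (qs h1)) (qs h) = sec_add AQ MQ (sec_scale AQ MQ f (BQ' (qs h1) (qs h)))
          (sec_scale AQ MQ (vf_apply AQ Y f) (qs h1))"
        using Y f qs_in_sections[OF h1] by (simp add: is_symbol_def)
      then show ?thesis using px by (simp add: sec_add_def sec_scale_def vf_apply_def)
    qed
    also have "\<dots> = \<pi> (fadd M (fscale M (f (p x)) (B h1 h x)) (fscale M (Y (p x) f) (h1 x)))"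
      using BQ'[OF h1 h] qs_p[OF B1 x] qs_p[OF h1 x] fscale_MQ[OF E_fibre[OF B1 x]]
        fscale_MQ[OF E_fibre[OF h1 x]] fadd_MQ[OF f1] by simp
    finally have "fadd M (fscale M (f (p x)) (B h1 h x)) (fscale M (X x (pullback f)) (h1 x)) =
        fadd M (fscale M (f (p x)) (B h1 h x)) (fscale M (Y (p x) f) (h1 x))"
      by (rule pi_inj[OF fadd_in_fibre[OF f1] fadd_in_fibre[OF f1]])
    then have "X x (pullback f) = Y (p x) f"
      using fadd_left_cancel[OF x f1(1) f1(2) f1(2)] nzx by blast
    then show "tangent_map A AQ p (X x) f = Y (p x) f"
      using f by (simp add: tangent_map_def pullback_def)
  qed (simp add: tangent_map_def)
qed

text \<open>
  The symbol downstairs is \<open>f \<mapsto> X (f \<circ> p)\<close>. This function is invariant by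
  \<open>symbol_preserves_invariance\<close>, so its value does not depend on the chosen point of the orbit, and
  it is smooth on the quotient by descent.
\<close>

lemma ex_projected_symbol:
  assumes h: "h \<in> E" and X: "is_symbol A M B h X"
  shows "\<exists>Y. is_symbol AQ MQ BQ (qs h) Y"
proof -
  define Y where "Y = (\<lambda>y\<in>points AQ. tangent_map A AQ p (X (SOME x. x \<in> points A \<and> p x = y)))"
  have Yp: "Y (p x) f = X x (pullback f)" if x: "x \<in> points A" and f: "f \<in> smooth_functions AQ" for x f
  proof -
    define x0 where "x0 = (SOME x'. x' \<in> points A \<and> p x' = p x)"
    have x': "x0 \<in> points A \<and> p x0 = p x" unfolding x0_def by (rule someI[where x=x]) (simp add: x)
    then obtain g where g: "g \<in> carrier G" "x0 = \<Phi>K g x" using orbit_eqD[OF act_base, of x0 x] by blast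
    have "vf_apply A X (pullback f) \<in> G_invariant_functions G A \<Phi>K"
      using symbol_preserves_invariance[OF h X] pullback_G_invariant[OF f]
      by (simp add: preserves_G_invariance_def)
    then have "vf_apply A X (pullback f) x0 = vf_apply A X (pullback f) x"
      using g x by (simp add: G_invariant_functions_def)
    then have "X x0 (pullback f) = X x (pullback f)" using x x' by (simp add: vf_apply_def)
    then show ?thesis using p_in_points[OF x] f by (simp add: Y_def tangent_map_def pullback_def x0_def)
  qed
  have Xt: "X x \<in> tangent_space A x" if "x \<in> points A" for x
    using X that by (simp add: is_symbol_def vector_fields_def)
  have plus: "(\<lambda>y\<in>points AQ. f y + g y) \<in> smooth_functions AQ" (is ?plus)
    and times: "(\<lambda>y\<in>points AQ. f y * g y) \<in> smooth_functions AQ" (is ?times)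
    if f: "f \<in> smooth_functions AQ" and g: "g \<in> smooth_functions AQ" for f g
  proof -
    have both: "smooth_real_at AQ (\<lambda>y. f y + g y) y" "smooth_real_at AQ (\<lambda>y. f y * g y) y"
      if "y \<in> points AQ" for y
      using f g that by (auto simp: smooth_functions_iff[OF atlasQ]
          intro: smooth_real_at_add[OF atlasQ] smooth_real_at_mult[OF atlasQ])
    have "smooth_real_at AQ (\<lambda>y\<in>points AQ. f y + g y) y" if y: "y \<in> points AQ" for y
      by (rule smooth_at_cong[OF atlasQ both(1)[OF y] openin_points[OF atlasQ] y]) simp
    then show ?plus by (simp add: smooth_functions_iff[OF atlasQ])
    have "smooth_real_at AQ (\<lambda>y\<in>points AQ. f y * g y) y" if y: "y \<in> points AQ" for y
      by (rule smooth_at_cong[OF atlasQ both(2)[OF y] openin_points[OF atlasQ] y]) simp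
    then show ?times by (simp add: smooth_functions_iff[OF atlasQ])
  qed
  have cmult: "(\<lambda>y\<in>points AQ. c * f y) \<in> smooth_functions AQ" if f: "f \<in> smooth_functions AQ" for f c
  proof -
    have "(\<lambda>y\<in>points AQ. (\<lambda>y\<in>points AQ. c) y * f y) = (\<lambda>y\<in>points AQ. c * f y)" by auto
    moreover have "(\<lambda>y\<in>points AQ. c) \<in> smooth_functions AQ"
      using smooth_at_cong[OF atlasQ smooth_real_at_const[OF atlasQ] openin_points[OF atlasQ]]
      by (auto simp: smooth_functions_iff[OF atlasQ])
    ultimately show ?thesis using times f by metis
  qed
  have pb: "pullback (\<lambda>y\<in>points AQ. f y + g y) = (\<lambda>x\<in>points A. pullback f x + pullback g x)"
    "pullback (\<lambda>y\<in>points AQ. f y * g y) = (\<lambda>x\<in>points A. pullback f x * pullback g x)"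
    "pullback (\<lambda>y\<in>points AQ. c * f y) = (\<lambda>x\<in>points A. c * pullback f x)" for f g c
    using p_in_points by (auto simp: pullback_def)
  have tan: "Y (p x) \<in> tangent_space AQ (p x)" if x: "x \<in> points A" for x
    unfolding tangent_space_def
  proof (intro CollectI conjI ballI allI)
    show "Y (p x) \<in> extensional (smooth_functions AQ)"
      using p_in_points[OF x] by (simp add: Y_def tangent_map_def)
    fix f assume f: "f \<in> smooth_functions AQ"
    note F = pullback_smooth[OF f]
    show "Y (p x) (\<lambda>y\<in>points AQ. c * f y) = c * Y (p x) f" for c
      using Xt[OF x] F by (simp add: Yp[OF x] f cmult pb(3) tangent_space_def)
    fix g assume g: "g \<in> smooth_functions AQ"
    note G = pullback_smooth[OF g]
    show "Y (p x) (\<lambda>y\<in>points AQ. f y + g y) = Y (p x) f + Y (p x) g"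
      using Xt[OF x] F G by (simp add: Yp[OF x] f g plus pb(1) tangent_space_def)
    have "f (p x) = pullback f x" "g (p x) = pullback g x" using x by (simp_all add: pullback_def)
    then show "Y (p x) (\<lambda>y\<in>points AQ. f y * g y) = Y (p x) f * g (p x) + f (p x) * Y (p x) g"
      using Xt[OF x] F G by (simp add: Yp[OF x] f g times pb(2) tangent_space_def)
  qed
  have Yf: "vf_apply AQ Y f (p x) = vf_apply A X (pullback f) x"
    if "x \<in> points A" "f \<in> smooth_functions AQ" for x f
    using that Yp p_in_points by (simp add: vf_apply_def)
  have smY: "vf_apply AQ Y f \<in> smooth_functions AQ" if f: "f \<in> smooth_functions AQ" for f
    unfolding smooth_functions_iff[OF atlasQ]
  proof (intro conjI ballI)
    show "vf_apply AQ Y f \<in> extensional (points AQ)" by (simp add: vf_apply_def)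
    fix y assume "y \<in> points AQ"
    then obtain x where x: "x \<in> points A" "y = p x" using points_AQ_cases by blast
    have "vf_apply A X (pullback f) \<in> smooth_functions A"
      using X pullback_smooth[OF f] by (simp add: is_symbol_def vector_fields_def)
    then have "smooth_real_at A (vf_apply A X (pullback f)) x"
      using x by (simp add: smooth_functions_iff[OF atlas])
    then have "smooth_real_at A (\<lambda>x. vf_apply AQ Y f (p x)) x"
      by (rule smooth_at_cong[OF atlas _ openin_points[OF atlas] x(1)]) (simp add: Yf f)
    then show "smooth_real_at AQ (vf_apply AQ Y f) y" using smooth_real_at_p_iff[OF x(1)] x(2) by simp
  qed
  have "Y \<in> vector_fields AQ"
    unfolding vector_fields_def
  proof (intro CollectI conjI ballI)
    show "Y \<in> extensional (points AQ)" by (simp add: Y_def)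
    show "Y y \<in> tangent_space AQ y" if "y \<in> points AQ" for y
      using tan points_AQ_cases[OF that] by blast
  qed (rule smY)
  moreover have "BQ (sec_scale AQ MQ f s) (qs h) =
      sec_add AQ MQ (sec_scale AQ MQ f (BQ s (qs h))) (sec_scale AQ MQ (vf_apply AQ Y f) s)"
    if s: "s \<in> sections AQ MQ" and f: "f \<in> smooth_functions AQ" for s f
  proof -
    note ls = lift_in_E[OF s] and inv = pullback_G_invariant[OF f]
    have Xinv: "vf_apply A X (pullback f) \<in> G_invariant_functions G A \<Phi>K"
      using symbol_preserves_invariance[OF h X] inv by (simp add: preserves_G_invariance_def)
    note E1 = invariant_scale_in_E[OF inv closed[OF ls h]] and E2 = invariant_scale_in_E[OF Xinv ls]
    have "BQ (sec_scale AQ MQ f s) (qs h) = qs (B (sec_scale A M (pullback f) (lift s)) h)"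
      by (simp add: BQ_def lift_scale[OF f s] lift_qs[OF h])
    also have "B (sec_scale A M (pullback f) (lift s)) h =
        sec_add A M (sec_scale A M (pullback f) (B (lift s) h)) (sec_scale A M (vf_apply A X (pullback f)) (lift s))"
      using X E_section[OF ls] pullback_smooth[OF f] by (simp add: is_symbol_def)
    also have "qs \<dots> = sec_add AQ MQ (sec_scale AQ MQ f (qs (B (lift s) h)))
        (sec_scale AQ MQ (vf_apply AQ Y f) (qs (lift s)))"
      unfolding qs_add[OF E1 E2]
      using qs_scale[OF closed[OF ls h] E1, of f] qs_scale[OF ls E2, of "vf_apply AQ Y f"] Yf[OF _ f]
      by (simp add: pullback_def)
    finally show ?thesis by (simp add: BQ_def lift_qs[OF h] qs_lift[OF s])
  qed
  ultimately show ?thesis unfolding is_symbol_def by blast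
qed

lemma kirillov_bracket_BQ: "kirillov_bracket AQ MQ BQ"
  unfolding kirillov_bracket_def
proof (intro conjI ballI)
  show "lie_bracket AQ MQ BQ" by (rule lie_bracket_BQ)
  fix s assume s: "s \<in> sections AQ MQ"
  obtain X where "is_symbol A M B (lift s) X"
    using kirillov E_section[OF lift_in_E[OF s]] by (auto simp: kirillov_bracket_def)
  then show "\<exists>Y. is_symbol AQ MQ BQ s Y"
    using ex_projected_symbol[OF lift_in_E[OF s]] qs_lift[OF s] by metis
qed

text \<open>
  For arbitrary \<open>f\<close> and equivariant \<open>s\<close> and \<open>h\<close>, the group element \<open>g\<close> takes \<open>h\<close> to itself and
  \<open>(f \<circ> g) s\<close> to \<open>f s\<close>. The equivariance of the bracket applied to \<open>(f \<circ> g) s\<close>, which is not an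
  equivariant section, therefore compares \<open>X (f \<circ> g)\<close> at \<open>x\<close> with \<open>X f\<close> at \<open>g x\<close>.
\<close>

lemma symbol_invariant:
  assumes h: "h \<in> E" and X: "is_symbol A M B h X" and eq: "equivariant_bracket G A M \<Phi>M \<Phi>K B"
    and sm: "\<And>g. g \<in> carrier G \<Longrightarrow> smooth_map A A (\<Phi>K g)"
  shows "G_invariant_vector_field G A \<Phi>K X"
  unfolding G_invariant_vector_field_def
proof (intro ballI)
  fix g x assume g: "g \<in> carrier G" and x: "x \<in> points A"
  have gx: "\<Phi>K g x \<in> points A" by (rule act_closed[OF act_base g x])
  have ginv: "inv\<^bsub>G\<^esub> g \<in> carrier G" using group.inv_closed[OF act_group[OF act_base] g] .
  have "X (\<Phi>K g x) \<in> extensional (smooth_functions A)"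
    using X gx by (simp add: is_symbol_def vector_fields_def tangent_space_def)
  then show "tangent_map A A (\<Phi>K g) (X x) = X (\<Phi>K g x)"
  proof (rule extensionalityI[rotated])
    fix f assume f: "f \<in> smooth_functions A"
    define f' where "f' = (\<lambda>y\<in>points A. f (\<Phi>K g y))"
    have f': "f' \<in> smooth_functions A"
      unfolding smooth_functions_iff[OF atlas]
    proof (intro conjI ballI)
      fix y assume y: "y \<in> points A"
      have gy: "\<Phi>K g y \<in> points A" by (rule act_closed[OF act_base g y])
      have "smooth_at A A (\<Phi>K g) y" using sm[OF g] y by (simp add: smooth_map_iff[OF atlas atlas])
      then have "smooth_real_at A (\<lambda>y. f (\<Phi>K g y)) y"
        using smooth_at_compose[of A A "\<Phi>K g" y real_atlas f] f gy atlas smooth_atlas_real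
        by (simp add: smooth_functions_iff[OF atlas])
      then show "smooth_real_at A f' y"
        by (rule smooth_at_cong[OF atlas _ openin_points[OF atlas] y]) (simp add: f'_def)
    qed (simp add: f'_def)
    obtain s where s: "s \<in> E"
      and nz: "\<And>a b. fscale M a (s (\<Phi>K g x)) = fscale M b (s (\<Phi>K g x)) \<Longrightarrow> a = b"
      using ex_nonvanishing_equivariant_section[OF haus x] g by blast
    note sM = E_section[OF s]
    have B1: "B s h \<in> E" by (rule closed[OF s h])
    have ext: "t \<in> extensional (points A)" if "t \<in> sections A M" for t using that by (simp add: sections_def)
    have f's: "sec_scale A M f' s \<in> sections A M"
      using f' by (intro sec_scale_in_sections[OF sM]) (simp add: smooth_functions_iff[OF atlas])
    have acth: "section_action G A \<Phi>M \<Phi>K g h = h"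
    proof (rule extensionalityI[OF _ ext[OF E_section[OF h]]])
      fix y assume y: "y \<in> points A"
      have "\<Phi>M g (h (\<Phi>K (inv\<^bsub>G\<^esub> g) y)) = h (\<Phi>K g (\<Phi>K (inv\<^bsub>G\<^esub> g) y))"
        using E_equivariant[OF h g act_closed[OF act_base ginv y]] by simp
      then show "section_action G A \<Phi>M \<Phi>K g h y = h y"
        using y act_inv'[OF act_base g y] by (simp add: section_action_def)
    qed (simp add: section_action_def)
    have actfs: "section_action G A \<Phi>M \<Phi>K g (sec_scale A M f' s) = sec_scale A M f s"
    proof (rule extensionalityI)
      fix y assume y: "y \<in> points A"
      let ?z = "\<Phi>K (inv\<^bsub>G\<^esub> g) y"
      have z: "?z \<in> points A" "\<Phi>K g ?z = y"
        using act_closed[OF act_base ginv y] act_inv'[OF act_base g y] by auto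
      have "\<Phi>M g (fscale M (f y) (s ?z)) = fscale M (f y) (s y)"
        using act_fscale[OF g E_fibre[OF s z(1)]] E_equivariant[OF s g z(1)] z(2) by simp
      then show "section_action G A \<Phi>M \<Phi>K g (sec_scale A M f' s) y = sec_scale A M f s y"
        using y z by (simp add: section_action_def sec_scale_def f'_def)
    qed (simp_all add: section_action_def sec_scale_def)
    have f1: "fscale M c (B s h y) \<in> fibre M y" "fscale M c (s y) \<in> fibre M y" if "y \<in> points A" for c y
      using E_fibre[OF B1 that] E_fibre[OF s that] fscale_in_fibre by auto
    have "B (sec_scale A M f s) h = section_action G A \<Phi>M \<Phi>K g (B (sec_scale A M f' s) h)"
      using eq g f's E_section[OF h] acth actfs unfolding equivariant_bracket_def by metis
    then have "B (sec_scale A M f s) h (\<Phi>K g x) = \<Phi>M g (B (sec_scale A M f' s) h x)"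
      using gx act_inv[OF act_base g x] by (simp add: section_action_def)
    also have "\<dots> = fadd M (\<Phi>M g (fscale M (f (\<Phi>K g x)) (B s h x))) (\<Phi>M g (fscale M (X x f') (s x)))"
      using symbol_eq[OF X sM f' x] act_fadd[OF g f1(1)[OF x] f1(2)[OF x]] x by (simp add: f'_def)
    also have "\<dots> = fadd M (fscale M (f (\<Phi>K g x)) (B s h (\<Phi>K g x))) (fscale M (X x f') (s (\<Phi>K g x)))"
      using act_fscale[OF g E_fibre[OF B1 x]] act_fscale[OF g E_fibre[OF s x]]
        E_equivariant[OF B1 g x] E_equivariant[OF s g x] by simp
    finally have "fscale M (X (\<Phi>K g x) f) (s (\<Phi>K g x)) = fscale M (X x f') (s (\<Phi>K g x))"
      unfolding symbol_eq[OF X sM f gx]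
      by (rule fadd_left_cancel[OF gx f1(1)[OF gx] f1(2)[OF gx] f1(2)[OF gx]])
    then have "X (\<Phi>K g x) f = X x f'" by (rule nz)
    then show "tangent_map A A (\<Phi>K g) (X x) f = X (\<Phi>K g x) f"
      using f by (simp add: tangent_map_def f'_def)
  qed (simp add: tangent_map_def)
qed

end

section \<open>The dual representation\<close>

context quotient_line_bundle
begin

abbreviation "D \<equiv> dual_bundle M"
abbreviation "\<Phi>D \<equiv> dual_action G M \<Phi>M \<Phi>K"
abbreviation "DQ \<equiv> quotient_bundle G A D \<Phi>D \<Phi>K"

lemma act_inv_fibre: "g \<in> carrier G \<Longrightarrow> x \<in> points A \<Longrightarrow> l \<in> fibre M (\<Phi>K g x) \<Longrightarrow> \<Phi>M (inv\<^bsub>G\<^esub> g) l \<in> fibre M x"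
  using act_fibre[of "inv\<^bsub>G\<^esub> g" l "\<Phi>K g x"] act_inv[OF act_base] group.inv_closed[OF act_group[OF act_base]]
  by simp

lemma dual_action_apply:
  "(x, \<alpha>) \<in> total_space D \<Longrightarrow> \<Phi>D g (x, \<alpha>) = (\<Phi>K g x, \<lambda>l\<in>fibre M (\<Phi>K g x). \<alpha> (\<Phi>M (inv\<^bsub>G\<^esub> g) l))"
  by (simp add: dual_action_def)

lemma acts_on_dual: "acts_on G (total_space D) \<Phi>D"
proof -
  interpret group G by (rule act_group[OF act_base])
  have closed: "\<Phi>D g (x, \<alpha>) \<in> total_space D" if g: "g \<in> carrier G" and d: "(x, \<alpha>) \<in> total_space D" for g x \<alpha>
  proof -
    have x: "x \<in> points A" and lin: "linear_on_fibre M x \<alpha>" using d by (auto simp: total_dual)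
    note inv_fibre = act_inv_fibre[OF g x]
    have "\<Phi>M (inv\<^bsub>G\<^esub> g) (fadd M a b) = fadd M (\<Phi>M (inv\<^bsub>G\<^esub> g) a) (\<Phi>M (inv\<^bsub>G\<^esub> g) b)"
      "\<Phi>M (inv\<^bsub>G\<^esub> g) (fscale M c a) = fscale M c (\<Phi>M (inv\<^bsub>G\<^esub> g) a)"
      if "a \<in> fibre M (\<Phi>K g x)" "b \<in> fibre M (\<Phi>K g x)" for a b c
      using act_fadd[OF inv_closed[OF g] that] act_fscale[OF inv_closed[OF g] that(1)] by auto
    then show ?thesis
      using lin inv_fibre act_closed[OF act_base g x] fadd_in_fibre fscale_in_fibre
      by (auto simp: dual_action_apply[OF d] total_dual linear_on_fibre_def)
  qed
  have one: "\<Phi>D \<one>\<^bsub>G\<^esub> (x, \<alpha>) = (x, \<alpha>)" if d: "(x, \<alpha>) \<in> total_space D" for x \<alpha>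
  proof -
    have x: "x \<in> points A" and ext: "\<alpha> \<in> extensional (fibre M x)" using d by (auto simp: total_dual)
    have "(\<lambda>l\<in>fibre M x. \<alpha> (\<Phi>M \<one>\<^bsub>G\<^esub> l)) = \<alpha>"
      using act_one[OF act_total] by (intro extensionalityI[OF _ ext]) (auto simp: mem_fibre)
    then show ?thesis using act_one[OF act_base x] by (simp add: dual_action_apply[OF d])
  qed
  have mult: "\<Phi>D (g \<otimes>\<^bsub>G\<^esub> h) (x, \<alpha>) = \<Phi>D g (\<Phi>D h (x, \<alpha>))"
    if g: "g \<in> carrier G" and h: "h \<in> carrier G" and d: "(x, \<alpha>) \<in> total_space D" for g h x \<alpha>
  proof -
    have x: "x \<in> points A" using d by (auto simp: total_dual)
    have hx: "\<Phi>K h x \<in> points A" by (rule act_closed[OF act_base h x])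
    have d': "(\<Phi>K h x, \<lambda>l\<in>fibre M (\<Phi>K h x). \<alpha> (\<Phi>M (inv\<^bsub>G\<^esub> h) l)) \<in> total_space D"
      using closed[OF h d] by (simp add: dual_action_apply[OF d])
    have "\<alpha> (\<Phi>M (inv\<^bsub>G\<^esub> (g \<otimes>\<^bsub>G\<^esub> h)) l) = \<alpha> (\<Phi>M (inv\<^bsub>G\<^esub> h) (\<Phi>M (inv\<^bsub>G\<^esub> g) l)) \<and> \<Phi>M (inv\<^bsub>G\<^esub> g) l \<in> fibre M (\<Phi>K h x)"
      if l: "l \<in> fibre M (\<Phi>K g (\<Phi>K h x))" for l
      using act_mult[OF act_total inv_closed[OF h] inv_closed[OF g], of l] inv_mult_group[OF g h]
        l act_inv_fibre[OF g hx l] by (simp add: mem_fibre)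
    then show ?thesis
      using act_mult[OF act_base g h x]
      by (auto simp: dual_action_apply[OF d] dual_action_apply[OF d'] intro!: restrict_ext)
  qed
  show ?thesis
    unfolding acts_on_def using closed one mult is_group by auto
qed

text \<open>
  The frame \<open>e\<close> of an invariant trivialization satisfies \<open>g (e x) = e (g x)\<close>, and \<open>g \<cdot> \<alpha>\<close> takes on
  \<open>g (e x)\<close> the value of \<open>\<alpha>\<close> on \<open>e x\<close>.
\<close>

lemma dual_coord_invariant:
  assumes g: "g \<in> carrier G" and d: "(x, \<alpha>) \<in> total_space D"
    and c: "fibre_coord M x (\<lambda>l. \<tau> (\<pi> l))" "fibre_coord M (\<Phi>K g x) (\<lambda>l. \<tau> (\<pi> l))"
  shows "dual_coord (\<lambda>l. \<tau> (\<pi> l)) (\<Phi>D g (x, \<alpha>)) = dual_coord (\<lambda>l. \<tau> (\<pi> l)) (x, \<alpha>)"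
proof -
  let ?e = "frame M (\<lambda>l. \<tau> (\<pi> l))"
  note e = frame_in_fibre[OF c(1)]
  have et: "?e x \<in> total_space M" using e by (simp add: mem_fibre)
  have "\<Phi>M g (?e x) = ?e (\<Phi>K g x)"
    using coord_frame[OF c(1)] by (intro frame_unique[OF c(2) act_fibre[OF g e]]) (simp add: pi_act[OF g et])
  then have "\<Phi>M (inv\<^bsub>G\<^esub> g) (?e (\<Phi>K g x)) = ?e x" using act_inv[OF act_total g et] by simp
  then show ?thesis
    using frame_in_fibre[OF c(2)] by (simp add: dual_action_apply[OF d] dual_coord_def)
qed

text \<open>
  The dual of an invariant trivialization, evaluated on any representative of the orbit; by
  \<open>dual_coord_invariant\<close> the choice does not matter.
\<close>

definition quotient_dual_coord :: "('l set \<Rightarrow> real) \<Rightarrow> ('k \<times> ('l \<Rightarrow> real)) set \<Rightarrow> real" where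
  "quotient_dual_coord \<tau> q = dual_coord (\<lambda>l. \<tau> (\<pi> l)) (SOME d. d \<in> q)"

lemma quotient_dual_coord_orbit:
  assumes U: "(U, \<tau>) \<in> triv MQ" and d: "(x, \<alpha>) \<in> total_space D" and x: "p x \<in> U"
  shows "quotient_dual_coord \<tau> (orbit G \<Phi>D (x, \<alpha>)) = dual_coord (\<lambda>l. \<tau> (\<pi> l)) (x, \<alpha>)"
proof -
  have xA: "x \<in> points A" using d by (simp add: total_dual)
  have "(SOME d. d \<in> orbit G \<Phi>D (x, \<alpha>)) \<in> orbit G \<Phi>D (x, \<alpha>)"
    by (rule someI[where x="(x, \<alpha>)"]) (rule orbit_self[OF acts_on_dual d])
  then obtain g where g: "g \<in> carrier G" "(SOME d. d \<in> orbit G \<Phi>D (x, \<alpha>)) = \<Phi>D g (x, \<alpha>)"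
    unfolding mem_orbit[OF acts_on_dual] by auto
  have "fibre_coord M x (\<lambda>l. \<tau> (\<pi> l))" "fibre_coord M (\<Phi>K g x) (\<lambda>l. \<tau> (\<pi> l))"
    using quotient_triv_coord(1)[OF U] xA x act_closed[OF act_base g(1) xA] p_act[OF g(1) xA] by auto
  then show ?thesis
    unfolding quotient_dual_coord_def g(2) by (rule dual_coord_invariant[OF g(1) d])
qed

lemma quotient_dual_triv:
  assumes U: "(U, \<tau>) \<in> triv MQ"
  shows "(U, quotient_dual_coord \<tau>) \<in> triv DQ"
proof -
  interpret D: smooth_line_bundle A D by unfold_locales (rule atlas, rule line_bundle_dual)
  have lt: "local_triv A M {x \<in> points A. p x \<in> U} (\<lambda>l. \<tau> (\<pi> l))" and sub: "U \<subseteq> points AQ"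
    using U by (simp_all add: quotient_triv)
  have "local_triv A D {x \<in> points A. p x \<in> U} (quotient_dual_coord \<tau> \<circ> orbit G \<Phi>D)"
  proof (rule D.local_triv_cong[OF local_triv_dual[OF lt]])
    fix d assume "d \<in> total_space D" "bproj D d \<in> {x \<in> points A. p x \<in> U}"
    then show "(quotient_dual_coord \<tau> \<circ> orbit G \<Phi>D) d = dual_coord (\<lambda>l. \<tau> (\<pi> l)) d"
      using quotient_dual_coord_orbit[OF U] by (cases d) (auto simp: dual_ops)
  qed
  then show ?thesis using sub by (simp add: quotient_bundle_def points_AQ)
qed

lemma quotient_line_bundle_dual: "quotient_line_bundle A D G AQ \<Phi>D \<Phi>K"
proof
  show "line_bundle A D" by (rule line_bundle_dual)
  show "acts_on G (total_space D) \<Phi>D" by (rule acts_on_dual)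
  show "bproj D (\<Phi>D g d) = \<Phi>K g (bproj D d)" if "g \<in> carrier G" "d \<in> total_space D" for g d
    using that by (cases d) (simp add: dual_action_apply dual_ops)
  show "\<exists>U \<tau>. (U, \<tau>) \<in> triv DQ \<and> p x \<in> U" if "x \<in> points A" for x
    using cover[OF that] quotient_dual_triv by blast
  fix g x assume g: "g \<in> carrier G"
  have tot: "d \<in> total_space D" if "d \<in> fibre D x" for d x using that by (simp add: mem_fibre)
  have inv_fibre: "\<Phi>M (inv\<^bsub>G\<^esub> g) l \<in> fibre M x" if "x \<in> points A" "l \<in> fibre M (\<Phi>K g x)" for l
    using act_inv_fibre[OF g that] .
  interpret D: smooth_line_bundle A D by unfold_locales (rule atlas, rule line_bundle_dual)
  show "\<Phi>D g (fadd D a b) = fadd D (\<Phi>D g a) (\<Phi>D g b)" if ab: "a \<in> fibre D x" "b \<in> fibre D x" for a b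
  proof -
    obtain \<alpha> \<beta> where d: "a = (x, \<alpha>)" "b = (x, \<beta>)" and x: "x \<in> points A" using ab by (auto simp: fibre_dual)
    have "(x, \<lambda>l\<in>fibre M x. \<alpha> l + \<beta> l) \<in> total_space D"
      using tot[OF D.fadd_in_fibre[OF ab]] by (simp add: d dual_ops)
    then show ?thesis
      using tot[OF ab(1)] tot[OF ab(2)] inv_fibre[OF x]
      by (auto simp: d dual_ops dual_action_apply intro!: restrict_ext)
  qed
  show "\<Phi>D g (fscale D c a) = fscale D c (\<Phi>D g a)" if a: "a \<in> fibre D x" for a c
  proof -
    obtain \<alpha> where d: "a = (x, \<alpha>)" and x: "x \<in> points A" using a by (auto simp: fibre_dual)
    have "(x, \<lambda>l\<in>fibre M x. c * \<alpha> l) \<in> total_space D"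
      using tot[OF D.fscale_in_fibre[OF a]] by (simp add: d dual_ops)
    then show ?thesis
      using tot[OF a] inv_fibre[OF x]
      by (auto simp: d dual_ops dual_action_apply intro!: restrict_ext)
  qed
qed (rule atlas act_base atlasQ points_AQ submersion)+

text \<open>
  Representatives \<open>g \<cdot> (x, \<alpha>)\<close> and \<open>h l\<close> over the same point satisfy \<open>h l = g l\<close> by \<open>pi_inj\<close>, so
  evaluation gives \<open>\<alpha> l\<close> for all of them and the description in \<^const>\<open>quotient_dual_map\<close> is
  unique.
\<close>

lemma quotient_dual_map_orbit:
  assumes d: "(x, \<alpha>) \<in> total_space D"
  obtains \<beta> where "quotient_dual_map M MQ (orbit G \<Phi>D (x, \<alpha>)) = (p x, \<beta>)"
    "\<beta> \<in> extensional (fibre MQ (p x))" "\<And>l. l \<in> fibre M x \<Longrightarrow> \<beta> (\<pi> l) = \<alpha> l"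
proof -
  have x: "x \<in> points A" using d by (simp add: total_dual)
  let ?o = "orbit G \<Phi>D (x, \<alpha>)"
  define \<beta> where "\<beta> = (\<lambda>q\<in>fibre MQ (p x). THE r. \<exists>(x', \<alpha>')\<in>?o. \<exists>l\<in>q. bproj M l = x' \<and> r = \<alpha>' l)"
  have "fst ` ?o = p x"
    unfolding orbit_image[OF acts_on_dual] orbit_image[OF act_base] image_image
    by (simp add: dual_action_apply[OF d])
  then have "quotient_dual_map M MQ ?o = (p x, \<beta>)" by (simp add: quotient_dual_map_def \<beta>_def)
  moreover have "\<beta> (\<pi> l) = \<alpha> l" if l: "l \<in> fibre M x" for l
  proof -
    have lt: "l \<in> total_space M" "bproj M l = x" using l by (auto simp: mem_fibre)
    have "(THE r. \<exists>(x', \<alpha>')\<in>?o. \<exists>l'\<in>\<pi> l. bproj M l' = x' \<and> r = \<alpha>' l') = \<alpha> l"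
    proof (rule the_equality)
      show "\<exists>(x', \<alpha>')\<in>?o. \<exists>l'\<in>\<pi> l. bproj M l' = x' \<and> \<alpha> l = \<alpha>' l'"
        using orbit_self[OF acts_on_dual d] orbit_self[OF act_total lt(1)] lt(2) by blast
      fix r assume "\<exists>(x', \<alpha>')\<in>?o. \<exists>l'\<in>\<pi> l. bproj M l' = x' \<and> r = \<alpha>' l'"
      then obtain x' \<alpha>' l' where o: "(x', \<alpha>') \<in> ?o" "l' \<in> \<pi> l" "bproj M l' = x'" "r = \<alpha>' l'" by blast
      obtain g where g: "g \<in> carrier G" "(x', \<alpha>') = \<Phi>D g (x, \<alpha>)"
        using o(1) mem_orbit[OF acts_on_dual] by metis
      obtain h where h: "h \<in> carrier G" "l' = \<Phi>M h l" using o(2) mem_orbit[OF act_total] by metis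
      have x': "x' = \<Phi>K g x" "\<alpha>' = (\<lambda>l\<in>fibre M (\<Phi>K g x). \<alpha> (\<Phi>M (inv\<^bsub>G\<^esub> g) l))"
        using g(2) by (simp_all add: dual_action_apply[OF d])
      note gl = act_fibre[OF g(1) l]
      have "l' = \<Phi>M g l"
      proof (rule pi_inj[OF _ gl])
        show "l' \<in> fibre M (\<Phi>K g x)"
          using act_fibre[OF h(1) l] o(3) x' h(2) by (simp add: mem_fibre)
        show "\<pi> l' = \<pi> (\<Phi>M g l)" using h g pi_act lt by simp
      qed
      then show "r = \<alpha> l" using o(4) x' gl act_inv[OF act_total g(1) lt(1)] by simp
    qed
    then show ?thesis using l fibre_MQ[OF x] by (simp add: \<beta>_def)
  qed
  ultimately show ?thesis using that[of \<beta>] by (simp add: \<beta>_def)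
qed

text \<open>
  An invariant trivialization of \<open>M\<close> induces trivializations of both bundles, and both evaluate a
  functional on the same frame.
\<close>

lemma quotient_dual_iso: "line_bundle_iso AQ DQ AQ (dual_bundle MQ) (quotient_dual_map M MQ) (\<lambda>y. y)"
proof -
  interpret D: quotient_line_bundle A D G AQ \<Phi>D \<Phi>K by (rule quotient_line_bundle_dual)
  show ?thesis
  proof (rule line_bundle_iso_of_trivs)
    show "smooth_line_bundle AQ DQ" by unfold_locales
    show "smooth_line_bundle AQ (dual_bundle MQ)" by unfold_locales (rule atlasQ, rule Q.line_bundle_dual)
    show "quotient_dual_map M MQ q \<in> fibre (dual_bundle MQ) y" if q: "q \<in> fibre DQ y" for q y
    proof -
      obtain d where "d \<in> total_space D" "q = orbit G \<Phi>D d" using q by (auto simp: mem_fibre D.total_MQ)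
      then obtain x \<alpha> where d: "(x, \<alpha>) \<in> total_space D" "q = orbit G \<Phi>D (x, \<alpha>)" by (cases d) auto
      have y: "y = p x" using q D.bproj_pi[OF d(1)] by (simp add: mem_fibre d(2) dual_ops)
      have x: "x \<in> points A" and lin: "linear_on_fibre M x \<alpha>" using d(1) by (simp_all add: total_dual)
      obtain \<beta> where b: "quotient_dual_map M MQ q = (p x, \<beta>)" "\<beta> \<in> extensional (fibre MQ (p x))"
        and b': "\<And>l. l \<in> fibre M x \<Longrightarrow> \<beta> (\<pi> l) = \<alpha> l"
        using quotient_dual_map_orbit[OF d(1)] d(2) by metis
      have "linear_on_fibre MQ (p x) \<beta>"
        unfolding linear_on_fibre_def fibre_MQ[OF x]
        using lin fadd_in_fibre fscale_in_fibre
        by (auto simp: fadd_MQ fscale_MQ b' linear_on_fibre_def)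
      then show ?thesis using b p_in_points[OF x] by (simp add: Q.fibre_dual y)
    qed
    fix y assume "y \<in> points AQ"
    then obtain x0 where x0: "x0 \<in> points A" "y = p x0" using points_AQ_cases by blast
    obtain U \<tau> where U: "(U, \<tau>) \<in> triv MQ" "p x0 \<in> U" using obtain_quotient_triv[OF x0(1)] by metis
    have "Q.dual_coord \<tau> (quotient_dual_map M MQ q) = quotient_dual_coord \<tau> q"
      if q: "q \<in> total_space DQ" "bproj DQ q \<in> U" for q
    proof -
      obtain d where "d \<in> total_space D" "q = orbit G \<Phi>D d" using q by (auto simp: D.total_MQ)
      then obtain x \<alpha> where d: "(x, \<alpha>) \<in> total_space D" "q = orbit G \<Phi>D (x, \<alpha>)" by (cases d) auto
      have px: "p x \<in> U" using q D.bproj_pi[OF d(1)] by (simp add: d(2) dual_ops)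
      have x: "x \<in> points A" using d(1) by (simp add: total_dual)
      note c = quotient_triv_coord[OF U(1) x px]
      obtain \<beta> where b: "quotient_dual_map M MQ q = (p x, \<beta>)"
        and b': "\<And>l. l \<in> fibre M x \<Longrightarrow> \<beta> (\<pi> l) = \<alpha> l"
        using quotient_dual_map_orbit[OF d(1)] d(2) by metis
      have "Q.dual_coord \<tau> (quotient_dual_map M MQ q) = \<beta> (\<pi> (frame M (\<lambda>l. \<tau> (\<pi> l)) x))"
        by (simp add: b Q.dual_coord_def frame_MQ[OF x c(2)])
      also have "\<dots> = dual_coord (\<lambda>l. \<tau> (\<pi> l)) (x, \<alpha>)"
        using b'[OF frame_in_fibre[OF c(1)]] by (simp add: dual_coord_def)
      finally show ?thesis using quotient_dual_coord_orbit[OF U(1) d(1) px] d(2) by simp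
    qed
    moreover have "(U, Q.dual_coord \<tau>) \<in> triv (dual_bundle MQ)" using U(1) unfolding Q.triv_dual by blast
    ultimately show "\<exists>U \<tau> \<sigma>. (U, \<tau>) \<in> triv DQ \<and> (U, \<sigma>) \<in> triv (dual_bundle MQ) \<and> y \<in> U \<and>
        (\<forall>q\<in>total_space DQ. bproj DQ q \<in> U \<longrightarrow> \<sigma> (quotient_dual_map M MQ q) = \<tau> q)"
      using quotient_dual_triv[OF U(1)] U(2) x0(2) by blast
  qed
qed

end

lemma quotient_line_bundle_of_representation:
  fixes A :: "('k, 'e::finite_dim_inner) chart set" and L :: "('k, 'l) pre_bundle"
    and AQ :: "('k set, 'f::finite_dim_inner) chart set"
  assumes A: "smooth_atlas A" and L: "line_bundle A L"
    and rep: "bundle_representation G AG A L \<Phi>L \<Phi>K" and quotient: "quotient_manifold G A \<Phi>K AQ"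
    and LQ: "line_bundle AQ (quotient_bundle G A L \<Phi>L \<Phi>K)"
  shows "quotient_line_bundle A L G AQ \<Phi>L \<Phi>K"
proof -
  interpret L: smooth_line_bundle A L by unfold_locales (rule A, rule L)
  have iso: "line_bundle_iso A L A L (\<Phi>L g) (\<Phi>K g)" if "g \<in> carrier G" for g
    using rep that by (simp add: bundle_representation_def)
  have pQ: "points AQ = orbits G (points A) \<Phi>K"
    using quotient by (simp add: quotient_manifold_def)
  show ?thesis
  proof
    show "acts_on G (points A) \<Phi>K"
      using rep by (intro group_action_acts_on) (simp add: bundle_representation_def smooth_action_def)
    show "acts_on G (total_space L) \<Phi>L"
      using rep L.points_total_atlas
      by (intro group_action_acts_on) (simp add: bundle_representation_def smooth_action_def)
    show "bproj L (\<Phi>L g l) = \<Phi>K g (bproj L l)" if "g \<in> carrier G" "l \<in> total_space L" for g l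
      using iso[OF that(1)] that(2) by (simp add: line_bundle_iso_def)
    show "\<Phi>L g (fadd L a b) = fadd L (\<Phi>L g a) (\<Phi>L g b)"
      if "g \<in> carrier G" "a \<in> fibre L x" "b \<in> fibre L x" for g a b x
      using iso[OF that(1)] that(2,3) by (auto simp: line_bundle_iso_def)
    show "\<Phi>L g (fscale L c a) = fscale L c (\<Phi>L g a)" if "g \<in> carrier G" "a \<in> fibre L x" for g a c x
      using iso[OF that(1)] that(2) by (auto simp: line_bundle_iso_def)
    show "smooth_atlas AQ" "submersion A AQ (orbit G \<Phi>K)"
      using quotient by (simp_all add: quotient_manifold_def smooth_manifold_def)
    show "points AQ = orbits G (points A) \<Phi>K" by (rule pQ)
    show "\<exists>U \<tau>. (U, \<tau>) \<in> triv (quotient_bundle G A L \<Phi>L \<Phi>K) \<and> orbit G \<Phi>K x \<in> U" if "x \<in> points A" for x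
    proof -
      have "orbit G \<Phi>K x \<in> points AQ" using that by (auto simp: pQ orbits_def)
      also have "points AQ = (\<Union>(U, \<tau>)\<in>triv (quotient_bundle G A L \<Phi>L \<Phi>K). U)"
        using LQ by (simp add: line_bundle_def)
      finally show ?thesis by auto
    qed
  qed
qed

section \<open>The quotient Kirillov structure\<close>

theorem theorem5p2:
  fixes AK :: "('k, 'e::finite_dim_inner) chart set"
    and L :: "('k, 'l) pre_bundle"
    and bracket :: "('k \<Rightarrow> 'k \<times> ('l \<Rightarrow> real)) \<Rightarrow> ('k \<Rightarrow> 'k \<times> ('l \<Rightarrow> real)) \<Rightarrow> 'k \<Rightarrow> 'k \<times> ('l \<Rightarrow> real)"
    and G :: "('g, 'm) monoid_scheme"
    and AG :: "('g, 'd::finite_dim_inner) chart set"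
    and \<Phi>L :: "'g \<Rightarrow> 'l \<Rightarrow> 'l"
    and \<Phi>K :: "'g \<Rightarrow> 'k \<Rightarrow> 'k"
    and AQ :: "('k set, 'f::finite_dim_inner) chart set"
    and LQ :: "('k set, 'l set) pre_bundle"
    and D :: "('k, 'k \<times> ('l \<Rightarrow> real)) pre_bundle"
    and \<Phi>D :: "'g \<Rightarrow> 'k \<times> ('l \<Rightarrow> real) \<Rightarrow> 'k \<times> ('l \<Rightarrow> real)"
    and DQ :: "('k set, ('k \<times> ('l \<Rightarrow> real)) set) pre_bundle"
    and E :: "('k \<Rightarrow> 'k \<times> ('l \<Rightarrow> real)) set"
    and qs :: "('k \<Rightarrow> 'k \<times> ('l \<Rightarrow> real)) \<Rightarrow> 'k set \<Rightarrow> ('k \<times> ('l \<Rightarrow> real)) set"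
  assumes K: "smooth_manifold AK"
    and L: "line_bundle AK L"
    and kirillov: "kirillov_structure AK L bracket"
    and G: "lie_group G AG"
    and rep: "bundle_representation G AG AK L \<Phi>L \<Phi>K"
    and compatible: "compatible_representation G AK L \<Phi>L \<Phi>K bracket"
    and quotient: "quotient_manifold G AK \<Phi>K AQ"
  defines LQ: "LQ \<equiv> quotient_bundle G AK L \<Phi>L \<Phi>K"
    and D: "D \<equiv> dual_bundle L"
    and \<Phi>D: "\<Phi>D \<equiv> dual_action G L \<Phi>L \<Phi>K"
    and DQ: "DQ \<equiv> quotient_bundle G AK D \<Phi>D \<Phi>K"
    and E: "E \<equiv> equivariant_sections G AK D \<Phi>D \<Phi>K"
    and qs: "qs \<equiv> quotient_section G AK \<Phi>K"
  assumes LQ_bundle: "line_bundle AQ LQ"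
  shows
    "(\<comment> \<open>\<open>L\<^sup>*/G\<close> is a line bundle, canonically isomorphic to \<open>(L/G)\<^sup>*\<close>\<close>
      line_bundle AQ DQ \<and>
      line_bundle_iso AQ DQ AQ (dual_bundle LQ) (quotient_dual_map L LQ) (\<lambda>y. y)) \<and>
     (\<comment> \<open>(1)\<close>
      bij_betw qs E (sections AQ DQ) \<and>
      (\<forall>h\<in>E. \<forall>x\<in>points AK. qs h (orbit G \<Phi>K x) = orbit G \<Phi>D (h x))) \<and>
     (\<comment> \<open>(2)\<close>
      \<exists>bracketQ. kirillov_bracket AQ DQ bracketQ \<and>
        (\<forall>h1\<in>E. \<forall>h2\<in>E. bracketQ (qs h1) (qs h2) = qs (bracket h1 h2)) \<and>
        (\<forall>bracketQ'. (\<forall>h1\<in>E. \<forall>h2\<in>E. bracketQ' (qs h1) (qs h2) = qs (bracket h1 h2)) \<longrightarrow>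
           (\<forall>s\<in>sections AQ DQ. \<forall>t\<in>sections AQ DQ. bracketQ' s t = bracketQ s t))) \<and>
     (\<comment> \<open>(3): for a merely compatible bracket the symbol is invariant up to vertical fields\<close>
      \<forall>h\<in>E. \<forall>X. is_symbol AK D bracket h X \<longrightarrow>
        preserves_G_invariance G AK \<Phi>K X \<and>
        (equivariant_bracket G AK D \<Phi>D \<Phi>K bracket \<longrightarrow> G_invariant_vector_field G AK \<Phi>K X) \<and>
        (\<forall>bracketQ. kirillov_bracket AQ DQ bracketQ \<longrightarrow>
           (\<forall>h1\<in>E. \<forall>h2\<in>E. bracketQ (qs h1) (qs h2) = qs (bracket h1 h2)) \<longrightarrow>
           (\<exists>Y. is_symbol AQ DQ bracketQ (qs h) Y) \<and>
           (\<forall>Y. is_symbol AQ DQ bracketQ (qs h) Y \<longrightarrow> projects_to AK AQ (orbit G \<Phi>K) X Y)))"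
proof -
  have atlas: "smooth_atlas AK" using K by (simp add: smooth_manifold_def)
  have haus: "Hausdorff_space (atlas_topology AQ)"
    using quotient by (simp add: quotient_manifold_def smooth_manifold_def)
  interpret L: quotient_line_bundle AK L G AQ \<Phi>L \<Phi>K
    using quotient_line_bundle_of_representation[OF atlas L rep quotient] LQ_bundle by (simp add: LQ)
  have "quotient_line_bundle AK D G AQ \<Phi>D \<Phi>K"
    unfolding D \<Phi>D by (rule L.quotient_line_bundle_dual)
  then interpret R: bracket_reduction AK D G AQ \<Phi>D \<Phi>K bracket
    unfolding bracket_reduction_def bracket_reduction_axioms_def
    using haus kirillov compatible
    by (simp add: kirillov_structure_def compatible_representation_def Let_def D \<Phi>D)
  have sm: "smooth_map AK AK (\<Phi>K g)" if "g \<in> carrier G" for g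
    using rep that by (simp add: bundle_representation_def line_bundle_iso_def diffeo_def)
  have part0: "line_bundle AQ DQ"
    "line_bundle_iso AQ DQ AQ (dual_bundle LQ) (quotient_dual_map L LQ) (\<lambda>y. y)"
    using R.line_bundle_MQ L.quotient_dual_iso by (simp_all add: DQ D \<Phi>D LQ)
  have part1: "bij_betw qs E (sections AQ DQ)"
    "\<forall>h\<in>E. \<forall>x\<in>points AK. qs h (orbit G \<Phi>K x) = orbit G \<Phi>D (h x)"
    using R.bij_betw_qs R.qs_p by (simp_all add: DQ E qs)
  have part2: "kirillov_bracket AQ DQ R.BQ" "\<forall>h1\<in>E. \<forall>h2\<in>E. R.BQ (qs h1) (qs h2) = qs (bracket h1 h2)"
    using R.kirillov_bracket_BQ R.BQ_qs by (simp_all add: DQ E qs)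
  have unique: "bracketQ' s t = R.BQ s t"
    if bQ': "\<forall>h1\<in>E. \<forall>h2\<in>E. bracketQ' (qs h1) (qs h2) = qs (bracket h1 h2)"
      and st: "s \<in> sections AQ DQ" "t \<in> sections AQ DQ" for bracketQ' s t
  proof -
    obtain h1 h2 where "h1 \<in> E" "h2 \<in> E" "s = qs h1" "t = qs h2"
      using st part1(1) by (metis bij_betw_imp_surj_on image_iff)
    then show ?thesis using bQ' part2(2) by simp
  qed
  have part3: "preserves_G_invariance G AK \<Phi>K X \<and>
        (equivariant_bracket G AK D \<Phi>D \<Phi>K bracket \<longrightarrow> G_invariant_vector_field G AK \<Phi>K X) \<and>
        (\<forall>bracketQ. kirillov_bracket AQ DQ bracketQ \<longrightarrow>
           (\<forall>h1\<in>E. \<forall>h2\<in>E. bracketQ (qs h1) (qs h2) = qs (bracket h1 h2)) \<longrightarrow>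
           (\<exists>Y. is_symbol AQ DQ bracketQ (qs h) Y) \<and>
           (\<forall>Y. is_symbol AQ DQ bracketQ (qs h) Y \<longrightarrow> projects_to AK AQ (orbit G \<Phi>K) X Y))"
    if h: "h \<in> E" and X: "is_symbol AK D bracket h X" for h X
  proof (intro conjI impI allI)
    note h' = h[unfolded E]
    show "preserves_G_invariance G AK \<Phi>K X" by (rule R.symbol_preserves_invariance[OF h' X])
    show "G_invariant_vector_field G AK \<Phi>K X" if "equivariant_bracket G AK D \<Phi>D \<Phi>K bracket"
      by (rule R.symbol_invariant[OF h' X that sm])
    fix bracketQ
    assume kQ: "kirillov_bracket AQ DQ bracketQ"
      and bQ: "\<forall>h1\<in>E. \<forall>h2\<in>E. bracketQ (qs h1) (qs h2) = qs (bracket h1 h2)"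
    have "qs h \<in> sections AQ DQ" using h part1(1) by (auto simp: bij_betw_def)
    then show "\<exists>Y. is_symbol AQ DQ bracketQ (qs h) Y" using kQ by (simp add: kirillov_bracket_def)
    show "projects_to AK AQ (orbit G \<Phi>K) X Y" if "is_symbol AQ DQ bracketQ (qs h) Y" for Y
      using R.symbol_projects[OF h' X, of bracketQ Y] bQ that by (simp add: E qs DQ)
  qed
  show ?thesis
    using part0 part1 part2 unique part3 by blast
qed

end
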